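(* Let $\kappa>0$ and $0<\alpha<\alpha_c(\kappa)$. Suppose Assumption A (stated in the context) holds. For each $N$ let $X_1,\dots,X_{\lfloor \alpha N\rfloor}$ be i.i.d. standard Gaussian vectors in $\mathbb{R}^N$, let $S=\bigcap_{i=1}^{\lfloor\alpha N\rfloor}H_\kappa(X_i)$, and, conditioned on the event $S\neq\emptyset$, let $\sigma$ be sampled uniformly at random from $S$. Then for any $\delta\in(0,\beta_c(\kappa,\alpha))$, $$\{\sigma'\in S:\ \mathrm{dist}(\sigma,\sigma')\le(\beta_c(\kappa,\alpha)-\delta)N\}=\{\sigma\}$$ with probability $1-o(1)$ as $N\to\infty$, where the probability is over both the vectors $X_i$ (conditioned on $S\ne\emptyset$) and the choice of $\sigma$. In particular, $\sigma$ is completely frozen with probability $1-o(1)$.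
   Context: $\Sigma_N=\{\pm1\}^N$; $\mathrm{dist}(\sigma,\sigma')=|\{i:\sigma_i\ne\sigma'_i\}|$ is Hamming distance. For $X\in\mathbb{R}^N$, $H_\kappa(X)=\{\sigma\in\Sigma_N:|\langle X,\sigma\rangle|\le\kappa\sqrt N\}$. All logarithms are base $e$. $p(\kappa)=\Pr[|Z|\le\kappa]$ for a standard Gaussian $Z$, and $\alpha_c(\kappa)=-\log 2/\log p(\kappa)$. For $\beta\in[0,1]$, $H(\beta)=-\beta\log\beta-(1-\beta)\log(1-\beta)$ and $q_\kappa(\beta)=\Pr(|Z_1|\le\kappa,|Z_2|\le\kappa)$, where $(Z_1,Z_2)$ is jointly Gaussian with means $0$, variances $1$ and covariance $2\beta-1$. Set $F_\alpha(\beta)=H(\beta)+\alpha\log q_\kappa(\beta)$. Assumption A: for all $\kappa>0$ and $\alpha>0$ with $F_\alpha''(1/2)<0$, the function $F_\alpha$ has a single critical point in $(0,1/2)$. $\beta_c(\kappa,\alpha)$ denotes the $\beta\in(0,1/2)$ with $F_\alpha(\beta)-\alpha\log p(\kappa)=0$ (under Assumption A it exists and is unique for $0<\alpha<\alpha_c(\kappa)$). A coordinate $i$ of a solution $\sigma\in S$ is frozen if flipping the $i$-th coordinate of $\sigma$ gives a vector not in $S$; $\sigma$ is completely frozen if all its coordinates are frozen. *)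

theory Defs
  imports "HOL-Probability.Probability"
begin

abbreviation std_gaussian :: "real measure" where
  "std_gaussian \<equiv> density lborel (\<lambda>x. ennreal (std_normal_density x))"

text \<open>The centred Gaussian law on the plane with unit variances and covariance \<open>\<rho>\<close>, for
  \<open>\<bar>\<rho>\<bar> \<le> 1\<close>. It is given as a linear image of two independent standard Gaussians, so that
  the degenerate cases \<open>\<rho> = 1\<close> and \<open>\<rho> = -1\<close>, which have no density, are included.\<close>

definition bivariate_gaussian :: "real \<Rightarrow> (real \<times> real) measure" where
  "bivariate_gaussian \<rho> =
     distr (std_gaussian \<Otimes>\<^sub>M std_gaussian) (borel \<Otimes>\<^sub>M borel)
       (\<lambda>(u, v). (u, \<rho> * u + sqrt (1 - \<rho>\<^sup>2) * v))"

definition p :: "real \<Rightarrow> real" where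
  "p \<kappa> = measure std_gaussian {z. \<bar>z\<bar> \<le> \<kappa>}"

definition alpha_c :: "real \<Rightarrow> real" where
  "alpha_c \<kappa> = - ln 2 / ln (p \<kappa>)"

definition entropy :: "real \<Rightarrow> real" where
  "entropy \<beta> = - \<beta> * ln \<beta> - (1 - \<beta>) * ln (1 - \<beta>)"

definition q :: "real \<Rightarrow> real \<Rightarrow> real" where
  "q \<kappa> \<beta> = measure (bivariate_gaussian (2 * \<beta> - 1)) {(z1, z2). \<bar>z1\<bar> \<le> \<kappa> \<and> \<bar>z2\<bar> \<le> \<kappa>}"

definition F :: "real \<Rightarrow> real \<Rightarrow> real \<Rightarrow> real" where
  "F \<kappa> \<alpha> \<beta> = entropy \<beta> + \<alpha> * ln (q \<kappa> \<beta>)"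

definition assumption_A :: bool where
  "assumption_A \<longleftrightarrow>
     (\<forall>\<kappa> > 0. \<forall>\<alpha> > 0. (deriv ^^ 2) (F \<kappa> \<alpha>) (1/2) < 0 \<longrightarrow>
        (\<exists>!\<beta>. \<beta> \<in> {0<..<1/2} \<and> (F \<kappa> \<alpha> has_real_derivative 0) (at \<beta>)))"

definition beta_c :: "real \<Rightarrow> real \<Rightarrow> real" where
  "beta_c \<kappa> \<alpha> = (THE \<beta>. \<beta> \<in> {0<..<1/2} \<and> F \<kappa> \<alpha> \<beta> - \<alpha> * ln (p \<kappa>) = 0)"


text \<open>Vectors of dimension \<open>N\<close> are functions on \<open>{..<N}\<close>, equal to \<open>undefined\<close> elsewhere.\<close>

definition cube :: "nat \<Rightarrow> (nat \<Rightarrow> real) set" where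
  "cube N = {..<N} \<rightarrow>\<^sub>E {-1, 1}"

definition hamming_dist :: "nat \<Rightarrow> (nat \<Rightarrow> real) \<Rightarrow> (nat \<Rightarrow> real) \<Rightarrow> nat" where
  "hamming_dist N \<sigma> \<sigma>' = card {i \<in> {..<N}. \<sigma> i \<noteq> \<sigma>' i}"

definition slab :: "real \<Rightarrow> nat \<Rightarrow> (nat \<Rightarrow> real) \<Rightarrow> (nat \<Rightarrow> real) set" where
  "slab \<kappa> N x = {\<sigma> \<in> cube N. \<bar>\<Sum>j<N. x j * \<sigma> j\<bar> \<le> \<kappa> * sqrt (real N)}"

definition num_constraints :: "real \<Rightarrow> nat \<Rightarrow> nat" where
  "num_constraints \<alpha> N = nat \<lfloor>\<alpha> * real N\<rfloor>"

text \<open>The intersection with the cube matters only when there are no constraints.\<close>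

definition solutions :: "real \<Rightarrow> real \<Rightarrow> nat \<Rightarrow> (nat \<Rightarrow> nat \<Rightarrow> real) \<Rightarrow> (nat \<Rightarrow> real) set" where
  "solutions \<kappa> \<alpha> N X = cube N \<inter> (\<Inter>i<num_constraints \<alpha> N. slab \<kappa> N (X i))"

definition disorder :: "real \<Rightarrow> nat \<Rightarrow> (nat \<Rightarrow> nat \<Rightarrow> real) measure" where
  "disorder \<alpha> N = (\<Pi>\<^sub>M i\<in>{..<num_constraints \<alpha> N}. \<Pi>\<^sub>M j\<in>{..<N}. std_gaussian)"

text \<open>The joint law of \<open>(X, \<sigma>)\<close>: first \<open>X\<close> is drawn from the disorder conditioned on having a
  solution, then \<open>\<sigma>\<close> is drawn uniformly from the solutions. The pair is mapped into one fixed
  measurable space because the space of \<^term>\<open>uniform_count_measure\<close> varies with \<open>X\<close>.\<close>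

definition sample_law ::
    "real \<Rightarrow> real \<Rightarrow> nat \<Rightarrow> ((nat \<Rightarrow> nat \<Rightarrow> real) \<times> (nat \<Rightarrow> real)) measure" where
  "sample_law \<kappa> \<alpha> N =
     uniform_measure (disorder \<alpha> N) {X \<in> space (disorder \<alpha> N). solutions \<kappa> \<alpha> N X \<noteq> {}} \<bind>
       (\<lambda>X. distr (uniform_count_measure (solutions \<kappa> \<alpha> N X))
              (disorder \<alpha> N \<Otimes>\<^sub>M count_space (cube N)) (\<lambda>\<sigma>. (X, \<sigma>)))"

definition frozen :: "(nat \<Rightarrow> real) set \<Rightarrow> (nat \<Rightarrow> real) \<Rightarrow> nat \<Rightarrow> bool" where
  "frozen S \<sigma> i \<longleftrightarrow> \<sigma>(i := - \<sigma> i) \<notin> S"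

definition completely_frozen :: "nat \<Rightarrow> (nat \<Rightarrow> real) set \<Rightarrow> (nat \<Rightarrow> real) \<Rightarrow> bool" where
  "completely_frozen N S \<sigma> \<longleftrightarrow> (\<forall>i<N. frozen S \<sigma> i)"

end

theory Submission imports Defs "HOL-Real_Asymp.Real_Asymp"
begin

text \<open>Let \<open>Z\<^sub>t\<close> be the number of solutions of the first \<open>t\<close> constraints. For \<open>\<alpha> < \<alpha>\<^sub>c\<close> one has
  \<open>F\<^sub>\<alpha>''(1/2) < 0\<close>, so Assumption A makes \<open>1/2\<close> a quadratic maximum of \<open>F\<^sub>\<alpha>\<close>; hence the expected
  number of pairs of solutions that are not nearly orthogonal is negligible against \<open>(E Z\<^sub>t)\<^sup>2\<close>. As
  long as most pairs are nearly orthogonal, a new row keeps a fraction of the solutions close to \<open>p \<kappa>\<close>, and the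
  truncated inverse moment \<open>E[E Z\<^sub>t / Z\<^sub>t]\<close> grows only by a factor \<open>1 + O(ln N / N)\<close> per row. Therefore
  \<open>Z \<ge> N\<^sup>-\<^sup>C E Z\<close> with probability \<open>1 - o(1)\<close>. On the other hand \<open>F\<^sub>\<alpha>(\<beta>) - \<alpha> ln p \<le> - c \<surd>\<beta>\<close> for
  \<open>\<beta> \<le> \<beta>\<^sub>c - \<delta>\<close>, so the expected number of pairs of distinct solutions at distance at most \<open>(\<beta>\<^sub>c - \<delta>) N\<close> is
  below \<open>exp (- c \<surd>N) E Z\<close>, and dividing by \<open>Z\<close> bounds the probability that a sampled solution
  belongs to such a pair.\<close>

section \<open>The one-dimensional small-ball probability\<close>

text \<open>A bound of E Z^2 by a constant times (E Z)^2 only shows that Z is comparable to E Z with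
  probability bounded away from 0, whereas probability 1 - o(1) is needed. The factor exp (- c
  \<surd>N) gained on close pairs leaves room to lose a power of N in Z, and this loss pays for the
  row-by-row argument. The obstacle there is the union over order N rows. Overlaps are controlled
  only up to some \<eta> with \<eta>^2 of order ln N / N; a variance bound on the fraction kept by a
  row fails with probability of order \<eta>^2, which is too large to be summed, while fourth
  moments give \<eta>^3, and N \<eta>^3 tends to 0. The admissible shortfall of Z and the threshold
  \<eta> determine each other, so both have to grow slowly with the rows.

  Negative curvature for all \<alpha> below \<open>alpha_c\<close> amounts to the one-variable
  inequality ln 2 (2 \<kappa> f)^2 < p^2 (- ln p), where f is the normal density at \<kappa>. It
  holds for every \<kappa> > 0 but with little room: after division by p^2 the margin secured at
  \<kappa>^2 = 1.88 is 0.0018, hence the explicit numerics.\<close>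

definition Phi :: "real \<Rightarrow> real" where
  "Phi x = (LBINT t=0..x. std_normal_density t)"

lemma std_normal_density_eq: "std_normal_density x = exp (- x\<^sup>2 / 2) / sqrt (2 * pi)"
  by (simp add: normal_density_def)

lemma continuous_on_std_normal_density [continuous_intros]:
  assumes "continuous_on A f"
  shows "continuous_on A (\<lambda>x. std_normal_density (f x))"
  unfolding std_normal_density_eq by (intro continuous_intros assms) auto

lemma DERIV_Phi: "(Phi has_real_derivative std_normal_density x) (at x)"
proof -
  \<comment> \<open>The interval contains the base point 0 of \<open>Phi\<close> and has x in its
    interior, so that the filter within the interval becomes the full filter at x.\<close>
  let ?a = "- \<bar>x\<bar> - 1" and ?b = "\<bar>x\<bar> + 1"
  have c: "continuous_on {?a..?b} std_normal_density"
    by (rule continuous_on_std_normal_density) (rule continuous_on_id)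
  have "((\<lambda>u. LBINT y=0..u. std_normal_density y) has_vector_derivative std_normal_density x)
          (at x within {?a..?b})"
    using interval_integral_FTC2[of ?a 0 ?b std_normal_density x] c by (simp add: zero_ereal_def)
  moreover have "at x within {?a..?b} = at x"
    by (rule at_within_interior) auto
  ultimately show ?thesis
    unfolding Phi_def has_real_derivative_iff_has_vector_derivative by simp
qed

lemma DERIV_Phi' [derivative_intros]:
  assumes "(f has_real_derivative f') (at x within A)"
  shows "((\<lambda>x. Phi (f x)) has_real_derivative std_normal_density (f x) * f') (at x within A)"
  using DERIV_chain2[OF DERIV_Phi assms] .

lemma continuous_on_Phi [continuous_intros]:
  assumes "continuous_on A f" shows "continuous_on A (\<lambda>x. Phi (f x))"
proof -
  have "continuous_on UNIV Phi"
    using DERIV_Phi DERIV_isCont by (auto intro!: continuous_at_imp_continuous_on)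
  from continuous_on_compose2[OF this assms] show ?thesis by simp
qed

lemma emeasure_std_gaussian_Icc:
  assumes "a \<le> b"
  shows "emeasure std_gaussian {a..b} = ennreal (Phi b - Phi a)"
proof -
  have "emeasure std_gaussian {a..b} =
      (\<integral>\<^sup>+x. ennreal (std_normal_density x) * indicator {a..b} x \<partial>lborel)"
    by (subst emeasure_density) auto
  also have "\<dots> = ennreal (Phi b - Phi a)"
    by (rule nn_integral_FTC_Icc) (use assms DERIV_Phi in auto)
  finally show ?thesis .
qed

lemma Phi_mono: "a \<le> b \<Longrightarrow> Phi a \<le> Phi b"
  by (rule DERIV_nonneg_imp_nondecreasing[of a b]) (use DERIV_Phi normal_density_nonneg in blast)+

lemma measure_std_gaussian_Icc: "a \<le> b \<Longrightarrow> measure std_gaussian {a..b} = Phi b - Phi a"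
  using emeasure_std_gaussian_Icc[of a b] Phi_mono[of a b] by (simp add: measure_def)

lemma prob_space_std_gaussian: "prob_space std_gaussian"
  by (rule prob_space_normal_density) simp

lemma abs_le_Icc: "{z::real. \<bar>z\<bar> \<le> \<kappa>} = {-\<kappa>..\<kappa>}"
  by auto

lemma p_eq_Phi: "\<kappa> \<ge> 0 \<Longrightarrow> p \<kappa> = Phi \<kappa> - Phi (- \<kappa>)"
  unfolding p_def abs_le_Icc by (rule measure_std_gaussian_Icc) simp

lemma DERIV_p:
  assumes "\<kappa> > 0"
  shows "(p has_real_derivative 2 * std_normal_density \<kappa>) (at \<kappa>)"
proof -
  have "((\<lambda>\<kappa>. Phi \<kappa> - Phi (- \<kappa>)) has_real_derivative 2 * std_normal_density \<kappa>) (at \<kappa>)"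
    by (auto intro!: derivative_eq_intros simp: std_normal_density_eq)
  moreover have "eventually (\<lambda>x. x > 0) (nhds \<kappa>)"
    using eventually_nhds_in_open[of "{0<..}" \<kappa>] assms by simp
  then have "eventually (\<lambda>x. p x = Phi x - Phi (- x)) (nhds \<kappa>)"
    by eventually_elim (simp add: p_eq_Phi)
  ultimately show ?thesis by (subst DERIV_cong_ev) auto
qed

lemma p_pos: assumes "\<kappa> > 0" shows "p \<kappa> > 0"
proof -
  have "Phi (-\<kappa>) < Phi \<kappa>"
    by (rule DERIV_pos_imp_increasing[of "-\<kappa>" \<kappa>])
       (use assms DERIV_Phi normal_density_pos[of 1 0] in auto)
  then show ?thesis using assms by (simp add: p_eq_Phi)
qed

lemma p_less_1: assumes "\<kappa> > 0" shows "p \<kappa> < 1"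
proof -
  interpret prob_space std_gaussian by (rule prob_space_std_gaussian)
  have "Phi \<kappa> < Phi (\<kappa> + 1)"
    by (rule DERIV_pos_imp_increasing[of \<kappa>])
       (use assms DERIV_Phi normal_density_pos[of 1 0] in auto)
  then have "measure std_gaussian {-\<kappa>..\<kappa>} < measure std_gaussian {-\<kappa>..\<kappa> + 1}"
    using assms by (simp add: measure_std_gaussian_Icc)
  also have "\<dots> \<le> 1" by (rule prob_le_1)
  finally show ?thesis by (simp add: p_def abs_le_Icc)
qed

section \<open>Tangent, chord and Taylor bounds for powers, exponentials and ln 2\<close>

lemma power_ge_tangent:
  fixes x m :: real
  assumes "x \<ge> 0" "m \<ge> 0"
  shows "m ^ Suc n + real (Suc n) * m ^ n * (x - m) \<le> x ^ Suc n"
proof (induction n)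
  case (Suc n)
  have "x * (m ^ Suc n + real (Suc n) * m ^ n * (x - m)) \<le> x * x ^ Suc n"
    by (rule mult_left_mono[OF Suc assms(1)])
  moreover have "0 \<le> real (Suc n) * m ^ n * (x - m)\<^sup>2" using assms by simp
  ultimately show ?case by (simp add: algebra_simps power2_eq_square)
qed simp

text \<open>Convexity of monomials, multiplied out to avoid division. Together with the tangent
  bound it replaces the polynomials of degree 5 and 6 below by affine functions, after which only
  quadratic inequalities in \<kappa>^2 remain.\<close>

lemma power_le_chord:
  fixes x a b :: real
  assumes "0 \<le> a" "a \<le> x" "x \<le> b"
  shows "(b - a) * x ^ n \<le> (b - x) * a ^ n + (x - a) * b ^ n"
proof (induction n)
  case (Suc n)
  have "x * ((b - a) * x ^ n) \<le> x * ((b - x) * a ^ n + (x - a) * b ^ n)"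
    by (rule mult_left_mono[OF Suc]) (use assms in auto)
  moreover have "0 \<le> (b - x) * (x - a) * (b ^ n - a ^ n)"
    using assms by (intro mult_nonneg_nonneg) (auto intro: power_mono)
  ultimately show ?case by (simp add: algebra_simps)
qed simp

lemma exp_ge_partial_sum:
  fixes x :: real
  assumes "x \<ge> 0"
  shows "(\<Sum>k<n. x ^ k / fact k) \<le> exp x"
proof -
  obtain t where "exp x = (\<Sum>m<n. (x ^ m) / fact m) + (exp t / fact n) * x ^ n"
    using Maclaurin_exp_le by blast
  then show ?thesis using assms by simp
qed

text \<open>Stopping after the cubic term leaves a remainder with a fourth power, which is
  nonnegative for either sign of x.\<close>

lemma exp_minus_ge_cubic: "1 - x + x\<^sup>2 / 2 - x ^ 3 / 6 \<le> exp (- x)" for x :: real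
proof -
  obtain t where "exp (- x) = (\<Sum>m<4. ((- x) ^ m) / fact m) + (exp t / fact 4) * (- x) ^ 4"
    using Maclaurin_exp_le by blast
  moreover have "0 \<le> (exp t / fact 4) * (- x) ^ 4" by simp
  ultimately show ?thesis by (simp add: eval_nat_numeral)
qed

lemma ln_2_bounds: "0.693 \<le> ln (2::real)" "ln (2::real) \<le> 0.69315"
proof -
  have "2 \<le> (\<Sum>k<10. (0.69315::real) ^ k / fact k)" by (simp add: eval_nat_numeral)
  also have "\<dots> \<le> exp 0.69315" by (rule exp_ge_partial_sum) simp
  finally show "ln (2::real) \<le> 0.69315"
    using ln_le_cancel_iff[of 2 "exp (0.69315::real)"] by simp
  \<comment> \<open>0.086625 is 0.693 / 8: the cubic bound is accurate at this small argument, and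
    the eighth power recovers exp (- 0.693).\<close>
  have "(1/2::real) \<le> (1 - 0.086625 + 0.086625\<^sup>2 / 2 - 0.086625 ^ 3 / 6) ^ 8"
    by (simp add: eval_nat_numeral)
  also have "\<dots> \<le> exp (- 0.086625) ^ 8"
    by (rule power_mono[OF exp_minus_ge_cubic]) (simp add: eval_nat_numeral)
  also have "\<dots> = exp (- 0.693)" by (simp flip: exp_of_nat_mult)
  finally have "exp 0.693 \<le> (2::real)" by (simp add: exp_minus field_simps)
  then show "0.693 \<le> ln (2::real)"
    using ln_le_cancel_iff[of "exp (0.693::real)" 2] by simp
qed

text \<open>Truncations of \<open>p \<kappa> / (2 \<kappa> \<phi>(\<kappa>)) = (\<Sum>j. \<kappa>\<^sup>2\<^sup>j / (1 \<cdot> 3 \<cdots> (2 j + 1)))\<close>; the last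
  coefficient of \<open>series_upper\<close> dominates the geometric tail for \<open>\<kappa>\<^sup>2 \<le> 3.24\<close>.\<close>

definition series_lower :: "real \<Rightarrow> real" where
  "series_lower x = 1 + x / 3 + x ^ 2 / 15 + x ^ 3 / 105 + x ^ 4 / 945 + x ^ 5 / 10395"

definition series_upper :: "real \<Rightarrow> real" where
  "series_upper x = series_lower x + x ^ 6 / 101455"

lemma DERIV_std_normal_density:
  "(std_normal_density has_real_derivative - x * std_normal_density x) (at x)"
  unfolding std_normal_density_eq [abs_def]
  by (auto intro!: derivative_eq_intros simp: field_simps)

lemma DERIV_std_normal_density' [derivative_intros]:
  assumes "(f has_real_derivative f') (at x within A)"
  shows "((\<lambda>x. std_normal_density (f x)) has_real_derivative - f x * std_normal_density (f x) * f')
    (at x within A)"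
  using DERIV_chain2[OF DERIV_std_normal_density assms] .

lemma std_normal_density_pos: "std_normal_density x > 0"
  by (rule normal_density_pos) simp

text \<open>Comparison of derivatives: both sides vanish at 0 and the derivative of p is twice the
  density, so the sign of 1 - g decides. The factor f takes squares because p divided by \<kappa>
  times the density is even in \<kappa>.\<close>

lemma p_bounds_aux:
  assumes "\<kappa> \<ge> 0" and "\<And>x. 0 < x \<Longrightarrow> x < \<kappa> \<Longrightarrow>
    ((\<lambda>x. 2 * x * std_normal_density x * f (x\<^sup>2)) has_real_derivative 2 * std_normal_density x * g x) (at x)"
    and "continuous_on {0..\<kappa>} (\<lambda>x. f (x\<^sup>2))"
  shows "(\<And>x. 0 < x \<Longrightarrow> x < \<kappa> \<Longrightarrow> g x \<le> 1) \<Longrightarrow> 2 * \<kappa> * std_normal_density \<kappa> * f (\<kappa>\<^sup>2) \<le> p \<kappa>"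
    and "(\<And>x. 0 < x \<Longrightarrow> x < \<kappa> \<Longrightarrow> g x \<ge> 1) \<Longrightarrow> p \<kappa> \<le> 2 * \<kappa> * std_normal_density \<kappa> * f (\<kappa>\<^sup>2)"
proof -
  let ?h = "\<lambda>x. (Phi x - Phi (- x)) - 2 * x * std_normal_density x * f (x\<^sup>2)"
  have cont: "continuous_on {0..\<kappa>} ?h"
    by (intro continuous_intros assms(3))
  have der: "(?h has_real_derivative 2 * std_normal_density x * (1 - g x)) (at x)"
    if "0 < x" "x < \<kappa>" for x
  proof -
    have "((\<lambda>x. Phi x - Phi (- x)) has_real_derivative 2 * std_normal_density x) (at x)"
      by (auto intro!: derivative_eq_intros simp: std_normal_density_eq)
    from DERIV_diff[OF this assms(2)[OF that]] show ?thesis by (simp add: algebra_simps)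
  qed
  have "p \<kappa> - 2 * \<kappa> * std_normal_density \<kappa> * f (\<kappa>\<^sup>2) = ?h \<kappa>"
    using assms(1) by (simp add: p_eq_Phi)
  moreover have "?h 0 \<le> ?h \<kappa>" if "\<And>x. 0 < x \<Longrightarrow> x < \<kappa> \<Longrightarrow> g x \<le> 1"
    by (rule DERIV_nonneg_imp_increasing_open[OF assms(1) _ cont])
       (use der that std_normal_density_pos in \<open>force intro!: mult_nonneg_nonneg\<close>)
  moreover have "?h 0 \<ge> ?h \<kappa>" if "\<And>x. 0 < x \<Longrightarrow> x < \<kappa> \<Longrightarrow> g x \<ge> 1"
    by (rule DERIV_nonpos_imp_decreasing_open[OF assms(1) _ cont])
       (use der that std_normal_density_pos in \<open>force intro!: mult_nonneg_nonpos\<close>)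
  ultimately show "(\<And>x. 0 < x \<Longrightarrow> x < \<kappa> \<Longrightarrow> g x \<le> 1) \<Longrightarrow> 2 * \<kappa> * std_normal_density \<kappa> * f (\<kappa>\<^sup>2) \<le> p \<kappa>"
    and "(\<And>x. 0 < x \<Longrightarrow> x < \<kappa> \<Longrightarrow> g x \<ge> 1) \<Longrightarrow> p \<kappa> \<le> 2 * \<kappa> * std_normal_density \<kappa> * f (\<kappa>\<^sup>2)"
    by auto
qed

text \<open>With the odd double factorials as denominators the derivative telescopes; only the
  leading 1 and the top term survive, and 10395 is the product of the odd numbers up to 11.\<close>

lemma p_ge_series:
  assumes "\<kappa> \<ge> 0"
  shows "2 * \<kappa> * std_normal_density \<kappa> * series_lower (\<kappa>\<^sup>2) \<le> p \<kappa>"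
proof (rule p_bounds_aux(1)[OF assms, where g = "\<lambda>x. 1 - x ^ 12 / 10395"])
  show "((\<lambda>x. 2 * x * std_normal_density x * series_lower (x\<^sup>2)) has_real_derivative
      2 * std_normal_density x * (1 - x ^ 12 / 10395)) (at x)" for x
    unfolding series_lower_def
    by (auto intro!: derivative_eq_intros simp: field_simps eval_nat_numeral)
qed (auto simp: series_lower_def intro!: continuous_intros)

lemma p_le_series:
  assumes "\<kappa> \<ge> 0" "\<kappa>\<^sup>2 \<le> 3.24"
  shows "p \<kappa> \<le> 2 * \<kappa> * std_normal_density \<kappa> * series_upper (\<kappa>\<^sup>2)"
proof (rule p_bounds_aux(2)[OF assms(1),
      where g = "\<lambda>x. 1 + x ^ 12 * (13 / 101455 - 1 / 10395 - x\<^sup>2 / 101455)"])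
  show "((\<lambda>x. 2 * x * std_normal_density x * series_upper (x\<^sup>2)) has_real_derivative
      2 * std_normal_density x * (1 + x ^ 12 * (13 / 101455 - 1 / 10395 - x\<^sup>2 / 101455))) (at x)" for x
    unfolding series_upper_def series_lower_def
    by (auto intro!: derivative_eq_intros simp: field_simps eval_nat_numeral)
  fix x assume x: "0 < x" "x < \<kappa>"
  then have "x\<^sup>2 \<le> 3.24" using assms power_mono[of x \<kappa> 2] by linarith
  \<comment> \<open>The bracket is nonnegative iff x^2 is at most 13 - 101455 / 10395, a number just
    above 3.24. The coefficient 101455 was fixed by this requirement.\<close>
  then show "1 \<le> 1 + x ^ 12 * (13 / 101455 - 1 / 10395 - x\<^sup>2 / 101455)" by simp
qed (auto simp: series_upper_def series_lower_def intro!: continuous_intros)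

section \<open>Negative curvature of F at 1/2 for all densities below the critical one\<close>

definition vratio :: "real \<Rightarrow> real" where
  "vratio \<kappa> = 2 * \<kappa> * std_normal_density \<kappa> / p \<kappa>"

text \<open>\<open>vratio\<close> is one minus the variance of a standard Gaussian conditioned on
  [-\<kappa>, \<kappa>], and the second derivative of F at 1/2 is 4 (\<alpha> v^2 - 1) with v =
  \<open>vratio \<kappa>\<close>. The gap is positive exactly when this is negative at \<alpha> =
  \<open>alpha_c \<kappa>\<close>.\<close>

definition stability_gap :: "real \<Rightarrow> real" where
  "stability_gap \<kappa> = - ln (p \<kappa>) - ln 2 * (vratio \<kappa>)\<^sup>2"

lemma vratio_pos: "\<kappa> > 0 \<Longrightarrow> vratio \<kappa> > 0"
  using p_pos std_normal_density_pos by (simp add: vratio_def)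

lemma series_lower_pos: "x \<ge> 0 \<Longrightarrow> series_lower x \<ge> 1"
  by (simp add: series_lower_def)

lemma series_upper_pos: "x \<ge> 0 \<Longrightarrow> series_upper x \<ge> 1"
  using series_lower_pos[of x] by (simp add: series_upper_def add_increasing2)

lemma vratio_le: assumes "\<kappa> > 0" shows "vratio \<kappa> \<le> 1 / series_lower (\<kappa>\<^sup>2)"
  using p_ge_series[of \<kappa>] p_pos[OF assms] series_lower_pos[of "\<kappa>\<^sup>2"] assms
  by (simp add: vratio_def field_simps)

lemma vratio_ge: assumes "\<kappa> > 0" "\<kappa>\<^sup>2 \<le> 3.24" shows "1 / series_upper (\<kappa>\<^sup>2) \<le> vratio \<kappa>"
proof -
  have "series_upper (\<kappa>\<^sup>2) \<ge> 1" by (rule series_upper_pos) simp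
  then show ?thesis
    using p_le_series[of \<kappa>] p_pos[OF assms(1)] assms by (simp add: vratio_def field_simps)
qed

definition gap_slope :: "real \<Rightarrow> real" where
  "gap_slope \<kappa> = 2 * ln 2 * vratio \<kappa> * (\<kappa>\<^sup>2 - 1 + vratio \<kappa>)"

text \<open>v = \<open>vratio\<close> solves the Riccati equation v' = v (1 - \<kappa>^2 - v) /
  \<kappa>, and ln p has derivative v / \<kappa>. The derivative of the gap is therefore algebraic
  in \<kappa> and v, and its sign is that of \<open>gap_slope \<kappa> - 1\<close>.\<close>

lemma DERIV_stability_gap:
  assumes "\<kappa> > 0"
  shows "(stability_gap has_real_derivative vratio \<kappa> / \<kappa> * (gap_slope \<kappa> - 1)) (at \<kappa>)"
proof -
  have pp: "p \<kappa> \<noteq> 0" using p_pos[OF assms] by simp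
  have v: "(vratio has_real_derivative vratio \<kappa> * (1 - \<kappa>\<^sup>2 - vratio \<kappa>) / \<kappa>) (at \<kappa>)"
    unfolding vratio_def [abs_def] using assms pp
    by (auto intro!: derivative_eq_intros DERIV_p simp: field_simps power2_eq_square)
  have l: "((\<lambda>\<kappa>. ln (p \<kappa>)) has_real_derivative vratio \<kappa> / \<kappa>) (at \<kappa>)"
    using assms pp p_pos[OF assms] by (auto intro!: derivative_eq_intros DERIV_p simp: vratio_def field_simps)
  show ?thesis
    unfolding stability_gap_def [abs_def]
    by (rule derivative_eq_intros l v refl)+
       (use assms in \<open>simp add: gap_slope_def field_simps power2_eq_square\<close>)
qed

text \<open>In terms of S = 1 / v and x = \<kappa>^2, comparing \<open>gap_slope\<close> with 1
  means finding the sign of S - 2 L (x - 1) - 2 L / S with L = ln 2. As this increases in S, series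
  bounds may be substituted for S.\<close>

lemma quadratic_mono:
  fixes a b L x :: real
  assumes "0 < a" "a \<le> b" "0 \<le> L"
  shows "a - 2 * L * (x - 1) - 2 * L / a \<le> b - 2 * L * (x - 1) - 2 * L / b"
  using assms divide_left_mono[of a b "2 * L"] by simp

text \<open>Both lines are tangents of the convex polynomial, with rounded coefficients, at the
  midpoints 0.755 and 1.695 of their ranges [0, 1.51] and [1.51, 1.88].\<close>

lemma series_lower_tangents:
  assumes "0 \<le> x"
  shows "x \<le> 1.51 \<Longrightarrow> 0.9526 + 0.4523 * x \<le> series_lower x"
    and "1.51 \<le> x \<Longrightarrow> x \<le> 1.88 \<Longrightarrow> 0.6841 + 0.666 * x \<le> series_lower x"
proof -
  have t: "2 * m * x - m ^ 2 \<le> x ^ 2" "3 * m ^ 2 * x - 2 * m ^ 3 \<le> x ^ 3"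
    "4 * m ^ 3 * x - 3 * m ^ 4 \<le> x ^ 4" "5 * m ^ 4 * x - 4 * m ^ 5 \<le> x ^ 5" if "m \<ge> 0" for m
    using power_ge_tangent[OF assms that, of 1] power_ge_tangent[OF assms that, of 2]
      power_ge_tangent[OF assms that, of 3] power_ge_tangent[OF assms that, of 4]
    by (simp_all add: numeral_eq_Suc algebra_simps)
  show "0.9526 + 0.4523 * x \<le> series_lower x" if "x \<le> 1.51"
  proof -
    have "1.51000 * x - 0.57003 \<le> x ^ 2" "1.71007 * x - 0.86074 \<le> x ^ 3" "1.72147 * x - 0.97479 \<le> x ^ 4" "1.62464 * x - 0.98129 \<le> x ^ 5"
      using t[of "0.755"] assms by (simp_all add: power_divide)
    then show ?thesis using that assms unfolding series_lower_def by simp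
  qed
  show "0.6841 + 0.666 * x \<le> series_lower x" if "1.51 \<le> x" "x \<le> 1.88"
  proof -
    have "3.39000 * x - 2.87303 \<le> x ^ 2" "8.61907 * x - 9.73956 \<le> x ^ 3" "19.47910 * x - 24.76282 \<le> x ^ 4" "41.27136 * x - 55.96397 \<le> x ^ 5"
      using t[of "1.695"] assms by (simp_all add: power_divide)
    then show ?thesis using that unfolding series_lower_def by simp
  qed
qed

text \<open>The leading coefficient of f is B (B - 2 L), so f is concave and its values at the two
  endpoints suffice. The identity in the proof is linear interpolation with its exact error
  term.\<close>

lemma concave_quadratic_nonneg:
  fixes A B L a b x :: real
  defines "f \<equiv> \<lambda>x. (A + B * x)\<^sup>2 - 2 * L * ((x - 1) * (A + B * x) + 1)"
  assumes "a \<le> x" "x \<le> b" "a < b" "B * (B - 2 * L) \<le> 0" "f a \<ge> 0" "f b \<ge> 0"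
  shows "0 \<le> f x"
proof -
  have "(b - a) * f x = (b - x) * f a + (x - a) * f b - B * (B - 2 * L) * ((x - a) * (b - x) * (b - a))"
    unfolding f_def by algebra
  also have "\<dots> \<ge> 0"
  proof -
    have "B * (B - 2 * L) * ((x - a) * (b - x) * (b - a)) \<le> 0"
      by (rule mult_nonpos_nonneg[OF assms(5)]) (use assms(2-4) in auto)
    moreover have "0 \<le> (b - x) * f a + (x - a) * f b"
      using assms(2,3,6,7) by (intro add_nonneg_nonneg mult_nonneg_nonneg) auto
    ultimately show ?thesis by linarith
  qed
  finally show ?thesis using assms by (simp add: zero_le_mult_iff)
qed

lemma series_upper_chord:
  assumes "1.88 \<le> x" "x \<le> 3.24"
  shows "series_upper x \<le> 0.1107 + 0.974 * x"
proof -
  have "1.36 * x ^ n \<le> 3.24 * 1.88 ^ n - 1.88 * 3.24 ^ n + (3.24 ^ n - 1.88 ^ n) * x" for n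
    using power_le_chord[OF _ assms, of n] by (simp add: algebra_simps)
  from this[of 2] this[of 3] this[of 4] this[of 5] this[of 6]
  have "x ^ 2 \<le> 5.12000 * x - 6.09120" "x ^ 3 \<le> 20.12320 * x - 31.18694" "x ^ 4 \<le> 71.84385 * x - 122.57443" "x ^ 5 \<le> 245.26603 * x - 437.61519" "x ^ 6 \<le> 818.14685 * x - 1493.96441"
    using assms by (simp_all add: power_divide)
  then show ?thesis unfolding series_upper_def series_lower_def using assms by simp
qed

text \<open>After passing to S = 1 / v, an affine lower bound l for S turns the claim into l^2 - 2 L
  ((x - 1) l + 1) \<ge> 0, a concave quadratic in x = \<kappa>^2 that is checked at the ends of each
  range.\<close>

lemma gap_slope_le_1:
  assumes "\<kappa> > 0" "\<kappa>\<^sup>2 \<le> 1.88"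
  shows "gap_slope \<kappa> \<le> 1"
proof -
  define x S L where "x = \<kappa>\<^sup>2" and "S = 1 / vratio \<kappa>" and "L = (0.69315::real)"
  have x: "0 \<le> x" "x \<le> 1.88" using assms by (auto simp: x_def)
  have v: "vratio \<kappa> > 0" by (rule vratio_pos) fact
  have S: "series_lower x \<le> S"
    using vratio_le[OF assms(1)] v series_lower_pos[OF x(1)] by (simp add: S_def x_def field_simps)
  have sp: "S > 0" using v by (simp add: S_def)
  have key: "0 \<le> S - 2 * L * (x - 1) - 2 * L / S"
    if "l \<le> series_lower x" "0 < l" "0 \<le> l\<^sup>2 - 2 * L * ((x - 1) * l + 1)" for l
  proof -
    have "0 \<le> (l\<^sup>2 - 2 * L * ((x - 1) * l + 1)) / l" using that by simp
    also have "\<dots> = l - 2 * L * (x - 1) - 2 * L / l"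
      using that by (simp add: field_simps power2_eq_square)
    also have "\<dots> \<le> S - 2 * L * (x - 1) - 2 * L / S"
      by (rule quadratic_mono) (use that S in \<open>auto simp: L_def\<close>)
    finally show ?thesis .
  qed
  have *: "0 \<le> S - 2 * L * (x - 1) - 2 * L / S"
  proof (cases "x \<le> 1.51")
    case True
    show ?thesis
      by (rule key[OF series_lower_tangents(1)[OF x(1) True]],
          use x in simp, rule concave_quadratic_nonneg[of 0 _ "1.51"])
        (use True x in \<open>auto simp: L_def power2_eq_square\<close>)
  next
    case False
    show ?thesis
      by (rule key[OF series_lower_tangents(2)[OF x(1) _ x(2)]],
          use False in simp, use x in simp, rule concave_quadratic_nonneg[of "1.51" _ "1.88"])
        (use False x in \<open>auto simp: L_def power2_eq_square\<close>)
  qed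
  have "vratio \<kappa> * (2 * L * (x - 1 + vratio \<kappa>)) \<le> vratio \<kappa> * S"
    using * v by (intro mult_left_mono) (auto simp: S_def algebra_simps)
  then have **: "2 * L * vratio \<kappa> * (x - 1 + vratio \<kappa>) \<le> 1" using v by (simp add: S_def algebra_simps)
  show ?thesis
  \<comment> \<open>L is an upper bound for ln 2, so exchanging them preserves the inequality only
    where the factor is nonnegative; otherwise the slope is already at most 0.\<close>
  proof (cases "x - 1 + vratio \<kappa> \<ge> 0")
    case True
    have "ln 2 * (2 * vratio \<kappa> * (x - 1 + vratio \<kappa>)) \<le> L * (2 * vratio \<kappa> * (x - 1 + vratio \<kappa>))"
      using True v ln_2_bounds by (intro mult_right_mono) (auto simp: L_def)
    then show ?thesis using ** by (simp add: gap_slope_def x_def algebra_simps)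
  next
    case False
    then have "2 * ln 2 * vratio \<kappa> * (x - 1 + vratio \<kappa>) \<le> 0"
      using v by (intro mult_nonneg_nonpos) auto
    then show ?thesis unfolding gap_slope_def x_def by linarith
  qed
qed

text \<open>The reverse comparison uses an upper bound for S. Taking L = 0.693 / 0.99 builds the
  target 0.99 and the lower bound 0.693 for ln 2 into a single constant.\<close>

lemma gap_slope_ge:
  assumes "\<kappa> > 0" "1.88 \<le> \<kappa>\<^sup>2" "\<kappa>\<^sup>2 \<le> 3.24"
  shows "0.99 \<le> gap_slope \<kappa>"
proof -
  define x S L where "x = \<kappa>\<^sup>2" and "S = 1 / vratio \<kappa>" and "L = (0.693 / 0.99::real)"
  have x: "1.88 \<le> x" "x \<le> 3.24" using assms by (auto simp: x_def)
  have v: "vratio \<kappa> > 0" by (rule vratio_pos) fact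
  define U where "U = 0.1107 + 0.974 * x"
  have "series_upper x \<ge> 1" using x by (intro series_upper_pos) simp
  then have S: "S \<le> series_upper x"
    using vratio_ge[OF assms(1,3)] v by (simp add: S_def x_def field_simps)
  have SU: "S \<le> U" using S series_upper_chord[OF x] by (simp add: U_def)
  have sp: "S > 0" using v by (simp add: S_def)
  have "S - 2 * L * (x - 1) - 2 * L / S \<le> U - 2 * L * (x - 1) - 2 * L / U"
    by (rule quadratic_mono) (use SU sp in \<open>auto simp: L_def\<close>)
  also have "\<dots> = (U\<^sup>2 - 2 * L * ((x - 1) * U + 1)) / U"
    using sp SU by (simp add: field_simps power2_eq_square)
  also have "\<dots> \<le> 0"
  proof (rule divide_nonpos_pos)
    have "U\<^sup>2 - 2 * L * ((x - 1) * U + 1) = - 1.23276551 + 1.4242636 * x - 0.414924 * x\<^sup>2"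
      unfolding U_def L_def by (simp add: field_simps power2_eq_square)
    also have "\<dots> \<le> 0"
    proof -
      \<comment> \<open>1.7163 approximates the point where the concave quadratic is largest; the
        tangent of x^2 there bounds it accurately.\<close>
      have "2 * 1.7163 * x - 1.7163\<^sup>2 \<le> x\<^sup>2"
        using zero_le_power2[of "x - 1.7163"] by (simp add: power2_diff)
      then show ?thesis using x by (simp add: power_divide)
    qed
    finally show "U\<^sup>2 - 2 * L * ((x - 1) * U + 1) \<le> 0" .
  qed (use sp SU in auto)
  finally have "S \<le> 2 * L * (x - 1 + vratio \<kappa>)" by (simp add: S_def algebra_simps)
  then have "vratio \<kappa> * S \<le> vratio \<kappa> * (2 * L * (x - 1 + vratio \<kappa>))"
    using v by (intro mult_left_mono) auto
  then have "0.99 \<le> 0.693 * (2 * vratio \<kappa> * (x - 1 + vratio \<kappa>))"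
    using v by (simp add: S_def L_def field_simps)
  also have "\<dots> \<le> ln 2 * (2 * vratio \<kappa> * (x - 1 + vratio \<kappa>))"
    using ln_2_bounds v x by (intro mult_right_mono) auto
  finally show ?thesis by (simp add: gap_slope_def x_def algebra_simps)
qed

text \<open>The gap does not increase up to \<kappa>^2 = 1.88 and hardly decreases between there and
  \<kappa> = 1.8, so this single value carries the whole range \<kappa> \<le> 1.8.\<close>

lemma stability_gap_at: "stability_gap (sqrt 1.88) \<ge> 0.0018"
proof -
  let ?k = "sqrt 1.88 :: real"
  have sq: "?k\<^sup>2 = 1.88" by simp
  have kp: "?k > 0" by simp
  have pp: "p ?k > 0" by (rule p_pos[OF kp])
  have "6.551 \<le> (\<Sum>k<14. (1.88::real) ^ k / fact k)" by (simp add: eval_nat_numeral)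
  also have "\<dots> \<le> exp 1.88" by (rule exp_ge_partial_sum) simp
  finally have e: "6.551 \<le> exp (1.88::real)" .
  have "p ?k \<le> 2 * ?k * std_normal_density ?k * series_upper 1.88"
    using p_le_series[of ?k] by simp
  \<comment> \<open>Squaring removes the roots of 1.88 and of 2 pi.\<close>
  then have "(p ?k)\<^sup>2 \<le> (2 * ?k * std_normal_density ?k * series_upper 1.88)\<^sup>2"
    using pp by (intro power_mono) auto
  also have "\<dots> = 4 * 1.88 * (series_upper 1.88)\<^sup>2 * (std_normal_density ?k)\<^sup>2"
    by (simp add: power_mult_distrib)
  finally have p2: "(p ?k)\<^sup>2 \<le> 4 * 1.88 * (series_upper 1.88)\<^sup>2 * (std_normal_density ?k)\<^sup>2" .
  have "(std_normal_density ?k)\<^sup>2 = 1 / (exp 1.88 * (2 * pi))"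
  proof -
    have "(exp (- (1.88 / 2)) :: real)\<^sup>2 = exp (- 1.88)"
      unfolding power2_eq_square mult_exp_exp by simp
    then show ?thesis
      by (simp add: std_normal_density_eq power_divide exp_minus field_simps)
  qed
  also have "\<dots> \<le> 1 / (6.551 * (2 * 3.14159))"
    using e pi_approx by (intro divide_left_mono mult_mono) auto
  finally have "4 * 1.88 * (series_upper 1.88)\<^sup>2 * (std_normal_density ?k)\<^sup>2
      \<le> 4 * 1.88 * (series_upper 1.88)\<^sup>2 * (1 / (6.551 * (2 * 3.14159)))"
    by (rule mult_left_mono) simp
  also have "\<dots> \<le> 0.83\<^sup>2" by (simp add: series_upper_def series_lower_def eval_nat_numeral)
  finally have "(p ?k)\<^sup>2 \<le> 0.83\<^sup>2" using p2 by linarith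
  then have "p ?k \<le> 0.83" by (rule power2_le_imp_le) simp
  also have "0.83 \<le> (1 - 0.1862 + 0.1862\<^sup>2 / 2 - 0.1862 ^ 3 / 6 :: real)" by (simp add: eval_nat_numeral)
  also have "\<dots> \<le> exp (- 0.1862)" by (rule exp_minus_ge_cubic)
  finally have y: "- ln (p ?k) \<ge> 0.1862"
    using pp ln_le_cancel_iff[of "p ?k" "exp (- 0.1862)"] by simp
  have "vratio ?k \<le> 1 / series_lower 1.88" using vratio_le[OF kp] by simp
  also have "\<dots> \<le> 0.5152" by (simp add: series_lower_def eval_nat_numeral)
  finally have "(vratio ?k)\<^sup>2 \<le> 0.5152\<^sup>2" using vratio_pos[OF kp] by (intro power_mono) auto
  then have "ln 2 * (vratio ?k)\<^sup>2 \<le> 0.69315 * 0.5152\<^sup>2"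
    using ln_2_bounds by (intro mult_mono) auto
  then show ?thesis using y by (simp add: stability_gap_def eval_nat_numeral)
qed

lemma stability_gap_pos_left:
  assumes "\<kappa> > 0" "\<kappa>\<^sup>2 \<le> 1.88"
  shows "stability_gap \<kappa> > 0"
proof -
  have "\<kappa> \<le> sqrt 1.88" using assms by (simp add: real_le_rsqrt)
  then have "stability_gap \<kappa> \<ge> stability_gap (sqrt 1.88)"
  proof (rule DERIV_nonpos_imp_nonincreasing)
    fix x assume x: "\<kappa> \<le> x" "x \<le> sqrt 1.88"
    then have "x > 0" "x\<^sup>2 \<le> 1.88" using assms(1) power_mono[of x "sqrt 1.88" 2] by auto
    then have "vratio x / x * (gap_slope x - 1) \<le> 0"
      using gap_slope_le_1[of x] vratio_pos[of x] by (intro mult_nonneg_nonpos) auto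
    then show "\<exists>y. (stability_gap has_real_derivative y) (at x) \<and> y \<le> 0"
      using DERIV_stability_gap \<open>x > 0\<close> by blast
  qed
  then show ?thesis using stability_gap_at by simp
qed

text \<open>With \<open>gap_slope\<close> at least 0.99 the gap can decrease, but at a rate of at
  most 0.01 v / \<kappa> \<le> 0.004. Over an interval inside [1.37, 1.8] this loses at most
  0.00172, less than the 0.0018 available at the left end.\<close>

lemma stability_gap_pos_middle:
  assumes "\<kappa> > 0" "1.88 \<le> \<kappa>\<^sup>2" "\<kappa> \<le> 1.8"
  shows "stability_gap \<kappa> > 0"
proof -
  have k0: "(1.37::real) \<le> sqrt 1.88" by (rule real_le_rsqrt) (simp add: power2_eq_square)
  have le: "sqrt 1.88 \<le> \<kappa>" using assms by (simp add: real_le_lsqrt)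
  have "stability_gap (sqrt 1.88) + 0.004 * sqrt 1.88 \<le> stability_gap \<kappa> + 0.004 * \<kappa>"
  proof (rule DERIV_nonneg_imp_nondecreasing[OF le])
    fix x assume x: "sqrt 1.88 \<le> x" "x \<le> \<kappa>"
    have x0: "x \<ge> 1.37" using x k0 by linarith
    have x2: "1.88 \<le> x\<^sup>2" using sqrt_le_D[OF x(1)] .
    have x3: "x\<^sup>2 \<le> 3.24" using power_mono[of x "1.8" 2] x assms x0 by (simp add: power2_eq_square)
    have "1.88\<^sup>2 \<le> (x\<^sup>2)\<^sup>2" using x2 by (intro power_mono) auto
    moreover have "1 + x\<^sup>2 / 3 + (x\<^sup>2)\<^sup>2 / 15 \<le> series_lower (x\<^sup>2)"
      by (simp add: series_lower_def)
    ultimately have "1.85 \<le> series_lower (x\<^sup>2)" using x2 by (simp add: power_divide)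
    then have "1 / series_lower (x\<^sup>2) \<le> 1 / 1.85" by (intro divide_left_mono) auto
    then have v: "vratio x \<le> 0.548" using vratio_le[of x] x0 by simp
    have "0.99 \<le> gap_slope x" by (rule gap_slope_ge) (use x0 x2 x3 in auto)
    moreover define r where "r = vratio x / x"
    have r: "r \<le> 0.4" "0 \<le> r"
      using v x0 vratio_pos[of x] by (auto simp: r_def divide_simps)
    ultimately have "r * (0.99 - gap_slope x) \<le> 0"
      by (intro mult_nonneg_nonpos) auto
    moreover have "r * 0.01 \<le> 0.004" using r by simp
    ultimately have "0 \<le> vratio x / x * (gap_slope x - 1) + 0.004"
      by (simp add: r_def [symmetric] algebra_simps)
    moreover have "((\<lambda>x. stability_gap x + 0.004 * x) has_real_derivative
        vratio x / x * (gap_slope x - 1) + 0.004) (at x)"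
      using x0 by (auto intro!: derivative_eq_intros DERIV_stability_gap)
    ultimately show "\<exists>y. ((\<lambda>x. stability_gap x + 0.004 * x) has_real_derivative y) (at x) \<and> 0 \<le> y"
      by blast
  qed
  then show ?thesis using stability_gap_at k0 assms(3) by simp
qed

text \<open>The difference of the two sides is decreasing in \<kappa>, and at any larger x it is at
  least minus a quantity that tends to 0; hence it is nonnegative.\<close>

lemma mills_ratio_lower:
  assumes "\<kappa> > 0"
  shows "2 * std_normal_density \<kappa> * \<kappa> / (1 + \<kappa>\<^sup>2) \<le> 1 - p \<kappa>"
proof -
  let ?g = "\<lambda>x. 1 - p x - 2 * std_normal_density x * x / (1 + x\<^sup>2)"
  have der: "(?g has_real_derivative - 4 * std_normal_density x / (1 + x\<^sup>2)\<^sup>2) (at x)" if "x > 0" for x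
  proof -
    have "1 + x\<^sup>2 \<noteq> 0" by (metis add_pos_nonneg less_numeral_extra(3) zero_le_power2 zero_less_one)
    then show ?thesis using that
      by (auto intro!: derivative_eq_intros DERIV_p) (simp add: divide_simps, simp add: algebra_simps power2_eq_square)
  qed
  have "?g \<kappa> \<ge> - (2 * std_normal_density x * x / (1 + x\<^sup>2))" if "x \<ge> \<kappa>" for x
  proof -
    have "?g \<kappa> \<ge> ?g x"
    proof (rule DERIV_nonpos_imp_nonincreasing[OF that])
      fix y assume "\<kappa> \<le> y" "y \<le> x"
      then show "\<exists>d. (?g has_real_derivative d) (at y) \<and> d \<le> 0"
        using der[of y] assms std_normal_density_pos[of y]
        by (intro exI[of _ "- 4 * std_normal_density y / (1 + y\<^sup>2)\<^sup>2"]) (auto simp: divide_nonpos_pos)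
    qed
    then show ?thesis using p_less_1[of x] that assms by simp
  qed
  then have "eventually (\<lambda>x. - (2 * std_normal_density x * x / (1 + x\<^sup>2)) \<le> ?g \<kappa>) at_top"
    by (rule eventually_at_top_linorderI)
  moreover have "((\<lambda>x. - (2 * std_normal_density x * x / (1 + x\<^sup>2))) \<longlongrightarrow> 0) at_top"
    unfolding std_normal_density_eq by real_asymp
  ultimately have "0 \<le> ?g \<kappa>"
    using tendsto_upperbound trivial_limit_at_top_linorder by blast
  then show ?thesis by simp
qed

text \<open>Since - ln p \<ge> 1 - p, the Mills bound reduces the claim to 2 ln 2 h(\<kappa>) < p^2
  with h(\<kappa>) equal to the density times \<kappa> (1 + \<kappa>^2). Beyond 1.8 the function h
  decreases while p increases, so the check at 1.8 suffices.\<close>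

lemma stability_gap_pos_right:
  assumes "\<kappa> \<ge> 1.8"
  shows "stability_gap \<kappa> > 0"
proof -
  let ?h = "\<lambda>x. std_normal_density x * x * (1 + x\<^sup>2)"
  have k: "\<kappa> > 0" using assms by simp
  have pp: "p \<kappa> > 0" by (rule p_pos[OF k])
  have "?h \<kappa> \<le> ?h 1.8"
  proof (rule DERIV_nonpos_imp_nonincreasing[OF assms])
    fix y :: real assume y: "1.8 \<le> y" "y \<le> \<kappa>"
    have "3 \<le> y * y" using mult_mono[of "1.8" y "1.8" y] y by simp
    then have "0 \<le> (y * y) * (y * y - 3)" using y by (intro mult_nonneg_nonneg) auto
    then have "1 + 2 * y\<^sup>2 - y ^ 4 \<le> 0" using \<open>3 \<le> y * y\<close> by (simp add: eval_nat_numeral algebra_simps)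
    moreover have "(?h has_real_derivative std_normal_density y * (1 + 2 * y\<^sup>2 - y ^ 4)) (at y)"
      by (auto intro!: derivative_eq_intros simp: algebra_simps eval_nat_numeral)
    ultimately show "\<exists>d. (?h has_real_derivative d) (at y) \<and> d \<le> 0"
      using std_normal_density_pos[of y] by (blast intro: mult_nonneg_nonpos less_imp_le)
  qed
  moreover have "1.3863 * ?h 1.8 < (p 1.8)\<^sup>2"
  proof -
    have "(0.194::real) \<le> (1 - 0.405 + 0.405\<^sup>2 / 2 - 0.405 ^ 3 / 6) ^ 4" by (simp add: eval_nat_numeral)
    also have "\<dots> \<le> exp (- 0.405) ^ 4"
      by (rule power_mono[OF exp_minus_ge_cubic]) (simp add: eval_nat_numeral)
    also have "\<dots> = exp (- 1.62)" by (simp flip: exp_of_nat_mult)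
    finally have e: "0.194 \<le> exp (- 1.62 :: real)" .
    have "sqrt (2 * pi) \<le> 2.507"
      using pi_approx by (intro real_le_lsqrt) (auto simp: power2_eq_square)
    then have "0.194 / 2.507 \<le> std_normal_density 1.8"
      using e unfolding std_normal_density_eq by (intro frac_le) (auto simp: power2_eq_square)
    then have f: "0.0773 \<le> std_normal_density 1.8" by simp
    \<comment> \<open>3.254 is below \<open>series_lower\<close> at 3.24, and (2 * 1.8 * 3.254)^2
      exceeds 137.2. One factor of the density stays on both sides and the other is bounded by
      0.0773, which leaves 1.3863 * 1.8 * 4.24 < 137.2 * 0.0773.\<close>
    have "2 * 1.8 * std_normal_density 1.8 * 3.254 \<le> 2 * 1.8 * std_normal_density 1.8 * series_lower (1.8\<^sup>2)"
      using std_normal_density_pos[of "1.8"] by (intro mult_left_mono) (auto simp: series_lower_def eval_nat_numeral)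
    also have "\<dots> \<le> p 1.8" by (rule p_ge_series) simp
    finally have "(2 * 1.8 * std_normal_density 1.8 * 3.254)\<^sup>2 \<le> (p 1.8)\<^sup>2"
      using std_normal_density_pos[of "1.8"] by (intro power_mono) auto
    moreover have "137.2 * std_normal_density 1.8 * 0.0773 \<le> 137.2 * std_normal_density 1.8 * std_normal_density 1.8"
      using f std_normal_density_pos[of "1.8"] by (intro mult_left_mono) auto
    moreover have "137.2 * std_normal_density 1.8 * std_normal_density 1.8 \<le> (2 * 1.8 * std_normal_density 1.8 * 3.254)\<^sup>2"
      by (simp add: power2_eq_square)
    moreover have "1.3863 * ?h 1.8 < 137.2 * std_normal_density 1.8 * 0.0773"
      using std_normal_density_pos[of "1.8"] by (simp add: power2_eq_square)
    ultimately show ?thesis by linarith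
  qed
  moreover have "(p 1.8)\<^sup>2 \<le> (p \<kappa>)\<^sup>2"
    using assms p_pos[of "1.8"] Phi_mono[of "1.8" \<kappa>] Phi_mono[of "-\<kappa>" "-1.8"]
    by (intro power_mono) (auto simp: p_eq_Phi)
  ultimately have "1.3863 * ?h \<kappa> < (p \<kappa>)\<^sup>2"
    using mult_left_mono[of "?h \<kappa>" "?h 1.8" "1.3863"] by (smt (verit) zero_le_divide_iff zero_le_numeral zero_le_power)
  moreover have "2 * ln 2 * ?h \<kappa> \<le> 1.3863 * ?h \<kappa>"
    using ln_2_bounds k std_normal_density_pos[of \<kappa>] by (intro mult_right_mono) auto
  ultimately have *: "2 * ln 2 * ?h \<kappa> < (p \<kappa>)\<^sup>2" by linarith
  have pos: "1 + \<kappa>\<^sup>2 > 0" by (simp add: add_pos_nonneg)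
  have "ln 2 * (vratio \<kappa>)\<^sup>2 = 2 * ln 2 * ?h \<kappa> * (2 * std_normal_density \<kappa> * \<kappa>) / ((p \<kappa>)\<^sup>2 * (1 + \<kappa>\<^sup>2))"
    unfolding vratio_def using pos pp
    by (simp add: divide_simps del: power_strict_mono) (simp add: algebra_simps power2_eq_square)
  also have "\<dots> < (p \<kappa>)\<^sup>2 * (2 * std_normal_density \<kappa> * \<kappa>) / ((p \<kappa>)\<^sup>2 * (1 + \<kappa>\<^sup>2))"
    using * k pos pp std_normal_density_pos[of \<kappa>] by (intro divide_strict_right_mono mult_strict_right_mono) auto
  also have "\<dots> = 2 * std_normal_density \<kappa> * \<kappa> / (1 + \<kappa>\<^sup>2)" using pp by simp
  also have "\<dots> \<le> 1 - p \<kappa>" by (rule mills_ratio_lower[OF k])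
  also have "\<dots> \<le> - ln (p \<kappa>)" using ln_le_minus_one[OF pp] by simp
  finally show ?thesis by (simp add: stability_gap_def)
qed

lemma stability_gap_pos:
  assumes "\<kappa> > 0"
  shows "ln 2 * (2 * \<kappa> * std_normal_density \<kappa>)\<^sup>2 < (p \<kappa>)\<^sup>2 * - ln (p \<kappa>)"
proof -
  have "stability_gap \<kappa> > 0"
    using stability_gap_pos_left[OF assms] stability_gap_pos_middle[OF assms] stability_gap_pos_right[of \<kappa>]
    by linarith
  then show ?thesis
    using p_pos[OF assms] by (simp add: stability_gap_def vratio_def power_divide field_simps)
qed

section \<open>The two-point function\<close>

text \<open>Oddness comes from basing \<open>Phi\<close> at 0 rather than at minus infinity: the sum
  of the two sides has derivative 0 and vanishes at 0.\<close>

lemma Phi_minus: "Phi (- x) = - Phi x"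
proof -
  have "\<forall>x. ((\<lambda>x. Phi x + Phi (- x)) has_real_derivative 0) (at x)"
    by (auto intro!: derivative_eq_intros simp: std_normal_density_eq)
  then have "Phi x + Phi (- x) = Phi 0 + Phi (- 0)" by (rule DERIV_isconst_all)
  moreover have "Phi 0 = 0" by (simp add: Phi_def zero_ereal_def [symmetric])
  ultimately show ?thesis by simp
qed

interpretation std: prob_space std_gaussian
  by (rule prob_space_std_gaussian)

lemma measure_std_gaussian_times:
  assumes "A \<in> sets borel" "B \<in> sets borel"
  shows "measure (std_gaussian \<Otimes>\<^sub>M std_gaussian) (A \<times> B) = measure std_gaussian A * measure std_gaussian B"
  using assms by (simp add: measure_def std.emeasure_pair_measure_Times enn2real_mult)

interpretation std2: pair_prob_space std_gaussian std_gaussian ..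

text \<open>The preimage of the square under the linear map that creates correlation \<rho>. It
  moves the dependence on \<rho> from the measure to the set, so q becomes the mass of this set
  under two independent Gaussians.\<close>

definition corr_box :: "real \<Rightarrow> real \<Rightarrow> (real \<times> real) set" where
  "corr_box \<kappa> \<rho> = {w. \<bar>fst w\<bar> \<le> \<kappa> \<and> \<bar>\<rho> * fst w + sqrt (1 - \<rho>\<^sup>2) * snd w\<bar> \<le> \<kappa>}"

lemma corr_box_sets: "corr_box \<kappa> \<rho> \<in> sets (std_gaussian \<Otimes>\<^sub>M std_gaussian)"
    "corr_box \<kappa> \<rho> \<in> sets (borel \<Otimes>\<^sub>M borel)"
proof -
  have "{x \<in> space (borel \<Otimes>\<^sub>M borel). \<bar>fst x\<bar> \<le> \<kappa> \<and> \<bar>\<rho> * fst x + sqrt (1 - \<rho>\<^sup>2) * snd x\<bar> \<le> \<kappa>}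
      \<in> sets (borel \<Otimes>\<^sub>M borel)" by measurable
  moreover have "sets (std_gaussian \<Otimes>\<^sub>M std_gaussian) = sets (borel \<Otimes>\<^sub>M borel)"
    by (intro sets_pair_measure_cong) auto
  ultimately show "corr_box \<kappa> \<rho> \<in> sets (std_gaussian \<Otimes>\<^sub>M std_gaussian)"
    "corr_box \<kappa> \<rho> \<in> sets (borel \<Otimes>\<^sub>M borel)"
    by (simp_all add: corr_box_def space_pair_measure)
qed

lemma q_eq_measure: "q \<kappa> ((1 + \<rho>) / 2) = measure (std_gaussian \<Otimes>\<^sub>M std_gaussian) (corr_box \<kappa> \<rho>)"
proof -
  have m: "(\<lambda>(u, v). (u, \<rho> * u + sqrt (1 - \<rho>\<^sup>2) * v)) \<in>
      std_gaussian \<Otimes>\<^sub>M std_gaussian \<rightarrow>\<^sub>M borel \<Otimes>\<^sub>M borel"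
    by measurable
  have s: "{(z1::real, z2::real). \<bar>z1\<bar> \<le> \<kappa> \<and> \<bar>z2\<bar> \<le> \<kappa>} \<in> sets (borel \<Otimes>\<^sub>M borel)"
  proof -
    have "{x \<in> space (borel \<Otimes>\<^sub>M borel). \<bar>fst x::real\<bar> \<le> \<kappa> \<and> \<bar>snd x::real\<bar> \<le> \<kappa>} \<in> sets (borel \<Otimes>\<^sub>M borel)"
      by measurable
    then show ?thesis by (simp add: space_pair_measure case_prod_unfold)
  qed
  have *: "2 * ((1 + \<rho>) / 2) - 1 = \<rho>" by (simp add: field_simps)
  show ?thesis
    unfolding q_def bivariate_gaussian_def * measure_distr[OF m s] corr_box_def
    by (rule arg_cong[of _ _ "measure _"]) (auto simp: space_pair_measure)
qed

lemma q_le_p: "q \<kappa> ((1 + \<rho>) / 2) \<le> p \<kappa>"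
proof -
  have "measure (std_gaussian \<Otimes>\<^sub>M std_gaussian) (corr_box \<kappa> \<rho>)
      \<le> measure (std_gaussian \<Otimes>\<^sub>M std_gaussian) ({z. \<bar>z\<bar> \<le> \<kappa>} \<times> UNIV)"
    by (rule std2.P.finite_measure_mono) (auto simp: corr_box_def)
  also have "\<dots> = p \<kappa>"
    using std.prob_space by (subst measure_std_gaussian_times) (auto simp: p_def)
  finally show ?thesis by (simp add: q_eq_measure)
qed

lemma q_endpoints: assumes "\<bar>\<rho>\<bar> = 1" shows "q \<kappa> ((1 + \<rho>) / 2) = p \<kappa>"
proof -
  have "\<rho>\<^sup>2 = 1" using assms by (simp add: abs_square_eq_1)
  then have "corr_box \<kappa> \<rho> = {z. \<bar>z\<bar> \<le> \<kappa>} \<times> UNIV"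
    using assms by (auto simp: corr_box_def abs_mult)
  then show ?thesis
    using std.prob_space by (simp only: q_eq_measure, subst measure_std_gaussian_times) (auto simp: p_def)
qed

lemma nn_integral_continuous_Icc:
  fixes f :: "real \<Rightarrow> real"
  assumes "continuous_on {a..b} f" "\<And>x. x \<in> {a..b} \<Longrightarrow> 0 \<le> f x"
  shows "(\<integral>\<^sup>+x. ennreal (f x) * indicator {a..b} x \<partial>lborel) = ennreal (integral {a..b} f)"
proof -
  have i: "set_integrable lborel {a..b} f" using assms(1) by (rule borel_integrable_atLeastAtMost')
  have "(\<integral>\<^sup>+x. ennreal (f x) * indicator {a..b} x \<partial>lborel) =
      (\<integral>\<^sup>+x. ennreal (indicator {a..b} x *\<^sub>R f x) \<partial>lborel)"
    by (intro nn_integral_cong) (auto simp: indicator_def)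
  also have "\<dots> = ennreal (\<integral>x. indicator {a..b} x *\<^sub>R f x \<partial>lborel)"
    using i assms(2) by (intro nn_integral_eq_integral) (auto simp: set_integrable_def indicator_def)
  also have "(\<integral>x. indicator {a..b} x *\<^sub>R f x \<partial>lborel) = integral {a..b} f"
    using set_borel_integral_eq_integral(2)[OF i] by (simp add: set_lebesgue_integral_def)
  finally show ?thesis .
qed

text \<open>For \<bar>\<rho>\<bar> < 1 the coefficient s is positive, so the slice of
  \<open>corr_box\<close> over a fixed first coordinate is an interval and its Gaussian mass is a
  difference of values of \<open>Phi\<close>.\<close>

lemma q_eq_integral:
  assumes "\<kappa> > 0" "\<bar>\<rho>\<bar> < 1"
  defines "s \<equiv> sqrt (1 - \<rho>\<^sup>2)"
  shows "q \<kappa> ((1 + \<rho>) / 2) =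
    integral {-\<kappa>..\<kappa>} (\<lambda>u. std_normal_density u * (Phi ((\<kappa> - \<rho> * u) / s) - Phi ((- \<kappa> - \<rho> * u) / s)))"
    (is "_ = integral _ ?f")
proof -
  have s: "s > 0" using assms by (simp add: abs_square_less_1)
  have c: "continuous_on {-\<kappa>..\<kappa>} ?f"
    using s by (intro continuous_intros) auto
  have nn: "0 \<le> ?f u" for u
    using s assms(1) by (intro mult_nonneg_nonneg) (auto intro!: Phi_mono divide_right_mono)
  have fib: "emeasure std_gaussian (Pair u -` corr_box \<kappa> \<rho>) =
      ennreal (Phi ((\<kappa> - \<rho> * u) / s) - Phi ((- \<kappa> - \<rho> * u) / s)) * indicator {-\<kappa>..\<kappa>} u" for u
  proof (cases "u \<in> {-\<kappa>..\<kappa>}")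
    case True
    have "Pair u -` corr_box \<kappa> \<rho> = {(- \<kappa> - \<rho> * u) / s .. (\<kappa> - \<rho> * u) / s}"
      using True s by (auto simp: corr_box_def s_def[symmetric] abs_le_iff field_simps)
    then show ?thesis
      using True s assms(1) by (subst \<open>Pair u -` _ = _\<close>, subst emeasure_std_gaussian_Icc)
        (auto intro!: divide_right_mono)
  next
    case False
    then have "Pair u -` corr_box \<kappa> \<rho> = {}" by (auto simp: corr_box_def)
    then show ?thesis using False by simp
  qed
  have "emeasure (std_gaussian \<Otimes>\<^sub>M std_gaussian) (corr_box \<kappa> \<rho>) =
      (\<integral>\<^sup>+u. emeasure std_gaussian (Pair u -` corr_box \<kappa> \<rho>) \<partial>std_gaussian)"
    by (rule std.emeasure_pair_measure_alt) (rule corr_box_sets(1))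
  also have "\<dots> = (\<integral>\<^sup>+u. ennreal (?f u) * indicator {-\<kappa>..\<kappa>} u \<partial>lborel)"
  proof -
    have m: "(\<lambda>u. Phi ((\<kappa> - \<rho> * u) / s) - Phi ((- \<kappa> - \<rho> * u) / s)) \<in> borel_measurable borel"
      using s by (intro borel_measurable_continuous_onI continuous_intros) auto
    show ?thesis unfolding fib using m
      by (subst nn_integral_density)
        (auto intro!: nn_integral_cong simp: ennreal_mult' indicator_def mult_ac)
  qed
  also have "\<dots> = ennreal (integral {-\<kappa>..\<kappa>} ?f)"
    by (rule nn_integral_continuous_Icc[OF c nn])
  finally show ?thesis
    using nn c by (simp add: q_eq_measure measure_def integral_nonneg integrable_continuous_interval)
qed

lemma q_sym:
  assumes "\<kappa> > 0" "\<bar>\<rho>\<bar> \<le> 1"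
  shows "q \<kappa> ((1 - \<rho>) / 2) = q \<kappa> ((1 + \<rho>) / 2)"
proof (cases "\<bar>\<rho>\<bar> = 1")
  case True
  then show ?thesis using q_endpoints[of \<rho>] q_endpoints[of "-\<rho>"] by simp
next
  case False
  then have "\<bar>\<rho>\<bar> < 1" using assms by simp
  moreover have "Phi ((\<kappa> + \<rho> * u) / s) - Phi ((- \<kappa> + \<rho> * u) / s) =
      Phi ((\<kappa> - \<rho> * u) / s) - Phi ((- \<kappa> - \<rho> * u) / s)" for u s
    using Phi_minus[of "(- \<kappa> - \<rho> * u) / s"] Phi_minus[of "(\<kappa> - \<rho> * u) / s"]
    by (simp add: minus_divide_left add.commute)
  ultimately show ?thesis
    using q_eq_integral[OF assms(1), of \<rho>] q_eq_integral[OF assms(1), of "-\<rho>"] by simp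
qed

lemma q_at_half: assumes "\<kappa> > 0" shows "q \<kappa> (1/2) = (p \<kappa>)\<^sup>2"
proof -
  have "(std_normal_density has_integral (Phi \<kappa> - Phi (-\<kappa>))) {-\<kappa>..\<kappa>}"
    using assms DERIV_Phi
    by (intro fundamental_theorem_of_calculus)
      (auto simp: has_real_derivative_iff_has_vector_derivative[symmetric] intro: DERIV_subset)
  then show ?thesis
    using q_eq_integral[OF assms, of 0] assms
    by (simp add: p_eq_Phi power2_eq_square integral_unique)
qed

text \<open>The derivative of the two-point probability in the correlation: the signed sum of the
  bivariate density over the four corners of the square, as in Plackett's identity.\<close>

definition q_slope :: "real \<Rightarrow> real \<Rightarrow> real" where
  "q_slope \<kappa> \<rho> = (exp (- \<kappa>\<^sup>2 / (1 + \<rho>)) - exp (- \<kappa>\<^sup>2 / (1 - \<rho>))) / (pi * sqrt (1 - \<rho>\<^sup>2))"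

text \<open>Differentiation under the integral sign yields an integrand that is itself an exact
  derivative in u; integrating it leaves only the values at \<kappa> and - \<kappa>, which are the
  corner densities.\<close>

lemma DERIV_q_corr:
  assumes "\<kappa> > 0" "\<bar>\<rho>\<bar> < 1"
  shows "((\<lambda>\<rho>. q \<kappa> ((1 + \<rho>) / 2)) has_real_derivative q_slope \<kappa> \<rho>) (at \<rho>)"
proof -
  define s where "s = (\<lambda>\<rho>::real. sqrt (1 - \<rho>\<^sup>2))"
  have sp: "s x > 0" if "\<bar>x\<bar> < 1" for x using that by (simp add: s_def abs_square_less_1)
  have s2: "(s x)\<^sup>2 = 1 - x\<^sup>2" if "\<bar>x\<bar> < 1" for x
    using that by (simp add: s_def abs_square_le_1)
  have ds: "(s has_real_derivative - x / s x) (at x within A)" if "\<bar>x\<bar> < 1" for x A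
    using sp[OF that] unfolding s_def
    by (auto intro!: derivative_eq_intros simp: field_simps)
  define f where "f = (\<lambda>\<rho> u. std_normal_density u * (Phi ((\<kappa> - \<rho> * u) / s \<rho>) - Phi ((- \<kappa> - \<rho> * u) / s \<rho>)))"
  define fx where "fx = (\<lambda>\<rho> u. std_normal_density u *
      (std_normal_density ((\<kappa> - \<rho> * u) / s \<rho>) * ((\<kappa> * \<rho> - u) / s \<rho> ^ 3) +
       std_normal_density ((- \<kappa> - \<rho> * u) / s \<rho>) * ((\<kappa> * \<rho> + u) / s \<rho> ^ 3)))"
  have quot: "((\<lambda>x. (k - x * u) / s x) has_real_derivative (k * x - u) / s x ^ 3) (at x within A)"
    if "\<bar>x\<bar> < 1" for k x u A
  proof -
    have "((\<lambda>x. (k - x * u) / s x) has_real_derivative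
        ((- u) * s x - (k - x * u) * (- x / s x)) / (s x * s x)) (at x within A)"
      using sp[OF that] by (auto intro!: derivative_eq_intros ds[OF that])
    moreover have "((- u) * s x - (k - x * u) * (- x / s x)) / (s x * s x) = (- u * (s x)\<^sup>2 + (k - x * u) * x) / s x ^ 3"
      using sp[OF that] by (simp add: field_simps power2_eq_square power3_eq_cube)
    moreover have "\<dots> = (k * x - u) / s x ^ 3"
      unfolding s2[OF that] by (simp add: algebra_simps power2_eq_square)
    ultimately show ?thesis by (simp only:)
  qed
  have cs: "continuous_on A (\<lambda>x. s (g x))" if "continuous_on A g" for A and g :: "'a :: topological_space \<Rightarrow> real"
    unfolding s_def by (intro continuous_intros that)
  have "((\<lambda>x. integral (cbox (-\<kappa>) \<kappa>) (f x)) has_field_derivative integral (cbox (-\<kappa>) \<kappa>) (fx \<rho>))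
      (at \<rho> within {-1<..<1})"
  proof (rule leibniz_rule_field_derivative)
    fix x u :: real assume "x \<in> {-1<..<1}"
    then have x: "\<bar>x\<bar> < 1" by auto
    show "((\<lambda>x. f x u) has_real_derivative fx x u) (at x within {-1<..<1})"
    proof -
      have eq: "fx x u = std_normal_density u *
          (std_normal_density ((\<kappa> - x * u) / s x) * ((\<kappa> * x - u) / s x ^ 3) -
           std_normal_density ((- \<kappa> - x * u) / s x) * ((- \<kappa> * x - u) / s x ^ 3))"
      proof -
        have "(- \<kappa> * x - u) / s x ^ 3 = - ((\<kappa> * x + u) / s x ^ 3)"
          by (simp add: minus_divide_left)
        then show ?thesis unfolding fx_def by simp
      qed
      show ?thesis unfolding eq f_def
        by (intro DERIV_cmult DERIV_diff DERIV_Phi' quot[OF x])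
    qed
    show "f x integrable_on cbox (-\<kappa>) \<kappa>"
      unfolding f_def using sp[OF x] by (intro integrable_continuous continuous_intros) auto
  next
    show "continuous_on ({-1<..<1} \<times> cbox (-\<kappa>) \<kappa>) (\<lambda>(x, t). fx x t)"
    proof -
      have "s (fst z) \<noteq> 0" if "z \<in> {-1<..<1} \<times> cbox (-\<kappa>) \<kappa>" for z
        using sp[of "fst z"] that by (auto simp: abs_less_iff)
      then show ?thesis
        unfolding fx_def case_prod_beta by (intro continuous_intros cs) auto
    qed
  qed (use assms in auto)
  moreover have "at \<rho> within {-1<..<1} = at \<rho>"
    using assms by (intro at_within_open) auto
  ultimately have d: "((\<lambda>x. integral {-\<kappa>..\<kappa>} (f x)) has_real_derivative integral {-\<kappa>..\<kappa>} (fx \<rho>)) (at \<rho>)"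
    by simp
  let ?s = "s \<rho>"
  let ?E = "\<lambda>\<epsilon> u. exp (- (\<kappa>\<^sup>2 - 2 * \<epsilon> * \<rho> * \<kappa> * u + u\<^sup>2) / (2 * ?s\<^sup>2))"
  \<comment> \<open>The primitive: a difference of bivariate densities along the two horizontal
    edges of the square.\<close>
  let ?W = "\<lambda>u. (?E 1 u - ?E (-1) u) / (2 * pi * ?s)"
  have prod: "std_normal_density u * std_normal_density ((\<epsilon> * \<kappa> - \<rho> * u) / ?s) = ?E \<epsilon> u / (2 * pi)"
    if "\<epsilon>\<^sup>2 = 1" for u \<epsilon>
  proof -
    have "- u\<^sup>2 / 2 + - ((\<epsilon> * \<kappa> - \<rho> * u) / ?s)\<^sup>2 / 2 = - (?s\<^sup>2 * u\<^sup>2 + (\<epsilon> * \<kappa> - \<rho> * u)\<^sup>2) / (2 * ?s\<^sup>2)"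
      using sp[OF assms(2)] by (simp add: field_simps power_divide)
    also have "?s\<^sup>2 * u\<^sup>2 + (\<epsilon> * \<kappa> - \<rho> * u)\<^sup>2 = \<kappa>\<^sup>2 - 2 * \<epsilon> * \<rho> * \<kappa> * u + u\<^sup>2"
      unfolding s2[OF assms(2)] using that by (simp add: power2_diff power_mult_distrib) (simp add: algebra_simps)
    finally have "exp (- u\<^sup>2 / 2) * exp (- ((\<epsilon> * \<kappa> - \<rho> * u) / ?s)\<^sup>2 / 2) = ?E \<epsilon> u"
      by (simp only: mult_exp_exp)
    then show ?thesis by (simp add: std_normal_density_eq)
  qed
  have "(fx \<rho> has_integral (?W \<kappa> - ?W (- \<kappa>))) {-\<kappa>..\<kappa>}"
  proof (rule fundamental_theorem_of_calculus)
    fix u assume "u \<in> {-\<kappa>..\<kappa>}"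
    have dE: "(?E \<epsilon> has_real_derivative ?E \<epsilon> u * ((\<epsilon> * \<rho> * \<kappa> - u) / ?s\<^sup>2)) (at u within {-\<kappa>..\<kappa>})" for \<epsilon>
      using sp[OF assms(2)] by (auto intro!: derivative_eq_intros simp: field_simps)
    have "(?W has_real_derivative (?E 1 u * ((1 * \<rho> * \<kappa> - u) / ?s\<^sup>2) - ?E (-1) u * ((-1 * \<rho> * \<kappa> - u) / ?s\<^sup>2))
        / (2 * pi * ?s)) (at u within {-\<kappa>..\<kappa>})"
      by (intro DERIV_cdivide DERIV_diff dE)
    moreover have "fx \<rho> u = ?E 1 u / (2 * pi) * ((\<kappa> * \<rho> - u) / ?s ^ 3) + ?E (-1) u / (2 * pi) * ((\<kappa> * \<rho> + u) / ?s ^ 3)"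
      using prod[of 1 u] prod[of "-1" u] unfolding fx_def distrib_left mult.assoc[symmetric] by simp
    moreover have "\<dots> = (?E 1 u * ((1 * \<rho> * \<kappa> - u) / ?s\<^sup>2) - ?E (-1) u * ((-1 * \<rho> * \<kappa> - u) / ?s\<^sup>2)) / (2 * pi * ?s)"
    proof -
      have "e1 / (2 * pi) * ((\<kappa> * \<rho> - u) / t ^ 3) + e2 / (2 * pi) * ((\<kappa> * \<rho> + u) / t ^ 3) =
        (e1 * ((1 * \<rho> * \<kappa> - u) / t\<^sup>2) - e2 * ((-1 * \<rho> * \<kappa> - u) / t\<^sup>2)) / (2 * pi * t)" if "t > 0" for e1 e2 t
        using that by (simp add: field_simps power2_eq_square power3_eq_cube)
      from this[OF sp[OF assms(2)]] show ?thesis .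
    qed
    ultimately show "(?W has_vector_derivative fx \<rho> u) (at u within {-\<kappa>..\<kappa>})"
      by (simp add: has_real_derivative_iff_has_vector_derivative)
  qed (use assms in auto)
  moreover have "?W \<kappa> - ?W (- \<kappa>) = q_slope \<kappa> \<rho>"
  proof -
    have ne: "1 + \<rho> \<noteq> 0" "1 - \<rho> \<noteq> 0" using assms by auto
    have "?s\<^sup>2 = (1 + \<rho>) * (1 - \<rho>)" unfolding s2[OF assms(2)] by (simp add: power2_eq_square algebra_simps)
    then have "- (\<kappa>\<^sup>2 - 2 * \<rho> * \<kappa> * \<kappa> + \<kappa>\<^sup>2) / (2 * ?s\<^sup>2) = - \<kappa>\<^sup>2 / (1 + \<rho>)"
      "- (\<kappa>\<^sup>2 + 2 * \<rho> * \<kappa> * \<kappa> + \<kappa>\<^sup>2) / (2 * ?s\<^sup>2) = - \<kappa>\<^sup>2 / (1 - \<rho>)"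
      using ne by (auto simp: divide_simps power2_eq_square) (simp_all add: algebra_simps)
    then have "?E 1 \<kappa> = exp (- \<kappa>\<^sup>2 / (1 + \<rho>))" "?E (-1) \<kappa> = exp (- \<kappa>\<^sup>2 / (1 - \<rho>))"
      "?E 1 (- \<kappa>) = exp (- \<kappa>\<^sup>2 / (1 - \<rho>))" "?E (-1) (- \<kappa>) = exp (- \<kappa>\<^sup>2 / (1 + \<rho>))"
      by simp_all
    moreover have "(A - B) / (2 * pi * t) - (B - A) / (2 * pi * t) = (A - B) / (pi * t)"
      if "t > 0" for A B t :: real
      using that by (simp add: field_simps)
    ultimately show ?thesis
      using sp[OF assms(2)] unfolding q_slope_def s_def[symmetric]
      by (simp only:) (simp add: s_def)
  qed
  ultimately have "integral {-\<kappa>..\<kappa>} (fx \<rho>) = q_slope \<kappa> \<rho>" by (simp add: integral_unique)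
  moreover have "eventually (\<lambda>x. integral {-\<kappa>..\<kappa>} (f x) = q \<kappa> ((1 + x) / 2)) (nhds \<rho>)"
  proof -
    have "eventually (\<lambda>x. x \<in> {-1<..<1}) (nhds \<rho>)"
      using assms by (intro eventually_nhds_in_open) auto
    then show ?thesis
      by eventually_elim (subst q_eq_integral[OF assms(1)], auto simp: f_def s_def)
  qed
  ultimately show ?thesis
    using d by (subst (asm) DERIV_cong_ev[OF refl _ refl]) auto
qed

lemma q_slope_nonneg:
  assumes "0 \<le> \<rho>" "\<rho> < 1" shows "0 \<le> q_slope \<kappa> \<rho>"
proof -
  have "\<kappa>\<^sup>2 / (1 + \<rho>) \<le> \<kappa>\<^sup>2 / (1 - \<rho>)"
    using assms by (intro divide_left_mono) auto
  moreover have "0 \<le> 1 - \<rho>\<^sup>2" using assms by (simp add: abs_square_le_1)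
  ultimately show ?thesis by (auto simp: q_slope_def intro!: divide_nonneg_nonneg mult_nonneg_nonneg)
qed

text \<open>From 1 - exp (- t) \<le> t, 1 - \<rho>^2 \<ge> 3/4 and pi sqrt (1 - \<rho>^2) \<ge> 3/2
  the constant is 16/9, rounded up to 2.\<close>

lemma q_slope_le:
  assumes "0 \<le> \<rho>" "\<rho> \<le> 1/2" shows "q_slope \<kappa> \<rho> \<le> 2 * \<kappa>\<^sup>2 * \<rho>"
proof -
  define a b where "a = \<kappa>\<^sup>2 / (1 + \<rho>)" and "b = \<kappa>\<^sup>2 / (1 - \<rho>)"
  have ab: "0 \<le> a" "a \<le> b" using assms by (auto simp: a_def b_def intro!: divide_left_mono)
  have sq: "\<rho>\<^sup>2 \<le> 1/4" using power_mono[of \<rho> "1/2" 2] assms by (simp add: power2_eq_square)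
  have "exp (- a) - exp (- b) = exp (- a) * (1 - exp (- (b - a)))"
    by (simp add: algebra_simps mult_exp_exp)
  also have "\<dots> \<le> 1 * (1 - exp (- (b - a)))"
    using ab by (intro mult_right_mono) auto
  also have "\<dots> \<le> b - a" unfolding minus_diff_eq mult_1 using exp_ge_add_one_self[of "a - b"] by linarith
  also have "b - a = 2 * \<rho> * \<kappa>\<^sup>2 / (1 - \<rho>\<^sup>2)"
    using assms sq by (simp add: a_def b_def divide_simps) (simp add: algebra_simps power2_eq_square)
  also have "\<dots> \<le> 2 * \<rho> * \<kappa>\<^sup>2 / (3/4)"
    using assms sq by (intro divide_left_mono) auto
  finally have num: "exp (- a) - exp (- b) \<le> 8 / 3 * (\<rho> * \<kappa>\<^sup>2)" by simp
  have "1/2 \<le> sqrt (1 - \<rho>\<^sup>2)" using sq by (intro real_le_rsqrt) (simp add: power2_eq_square)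
  then have den: "3 / 2 \<le> pi * sqrt (1 - \<rho>\<^sup>2)"
    using mult_mono[of 3 pi "1/2" "sqrt (1 - \<rho>\<^sup>2)"] pi_gt3 by simp
  have "q_slope \<kappa> \<rho> \<le> (8 / 3 * (\<rho> * \<kappa>\<^sup>2)) / (3 / 2)"
    unfolding q_slope_def using num den ab assms
    by (intro frac_le) (auto simp: a_def b_def)
  also have "\<dots> \<le> 2 * \<kappa>\<^sup>2 * \<rho>" using assms by (simp add: field_simps)
  finally show ?thesis .
qed

text \<open>A correlation inequality for two slabs: the probability equals p^2 at \<rho> = 0,
  increases for positive \<rho> and is even in \<rho>.\<close>

lemma q_ge_p_squared:
  assumes "\<kappa> > 0" "\<bar>\<rho>\<bar> \<le> 1"
  shows "(p \<kappa>)\<^sup>2 \<le> q \<kappa> ((1 + \<rho>) / 2)"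
proof -
  have *: "(p \<kappa>)\<^sup>2 \<le> q \<kappa> ((1 + r) / 2)" if r: "0 \<le> r" "r \<le> 1" for r
  proof (cases "r = 1")
    case True
    then show ?thesis using q_endpoints[of r] p_pos[OF assms(1)] p_less_1[OF assms(1)]
      by (simp add: power2_eq_square mult_left_le_one_le)
  next
    case False
    have "q \<kappa> ((1 + 0) / 2) \<le> q \<kappa> ((1 + r) / 2)"
    proof (rule DERIV_nonneg_imp_nondecreasing[OF r(1)])
      fix x assume "0 \<le> x" "x \<le> r"
      then show "\<exists>y. ((\<lambda>r. q \<kappa> ((1 + r) / 2)) has_real_derivative y) (at x) \<and> 0 \<le> y"
        using r False DERIV_q_corr[OF assms(1), of x] q_slope_nonneg[of x] by auto
    qed
    then show ?thesis using q_at_half[OF assms(1)] by simp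
  qed
  show ?thesis
    using *[of \<rho>] *[of "- \<rho>"] q_sym[OF assms] assms by (cases "\<rho> \<ge> 0") auto
qed

lemma q_pos:
  assumes "\<kappa> > 0" "\<bar>\<rho>\<bar> \<le> 1" shows "0 < q \<kappa> ((1 + \<rho>) / 2)"
  using q_ge_p_squared[OF assms] p_pos[OF assms(1)] by (meson less_le_trans zero_less_power)

text \<open>Integrating the slope bound gives \<kappa>^2 \<rho>^2 for \<bar>\<rho>\<bar> \<le> 1/2.
  For larger correlations 4 \<rho>^2 is at least 1, which exceeds any probability involved.\<close>

lemma q_le_p_squared_plus:
  assumes "\<kappa> > 0" "\<bar>\<rho>\<bar> \<le> 1"
  shows "q \<kappa> ((1 + \<rho>) / 2) \<le> (p \<kappa>)\<^sup>2 + (\<kappa>\<^sup>2 + 4) * \<rho>\<^sup>2"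
proof -
  have *: "q \<kappa> ((1 + r) / 2) \<le> (p \<kappa>)\<^sup>2 + (\<kappa>\<^sup>2 + 4) * r\<^sup>2" if r: "0 \<le> r" "r \<le> 1" for r
  proof (cases "r \<le> 1/2")
    case True
    have "q \<kappa> ((1 + r) / 2) - \<kappa>\<^sup>2 * r\<^sup>2 \<le> q \<kappa> ((1 + 0) / 2) - \<kappa>\<^sup>2 * 0\<^sup>2"
    proof (rule DERIV_nonpos_imp_nonincreasing[OF r(1)])
      fix x assume x: "0 \<le> x" "x \<le> r"
      have "((\<lambda>r. q \<kappa> ((1 + r) / 2) - \<kappa>\<^sup>2 * r\<^sup>2) has_real_derivative q_slope \<kappa> x - \<kappa>\<^sup>2 * (2 * x)) (at x)"
        using x True assms(1) by (auto intro!: derivative_eq_intros DERIV_q_corr)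
      then show "\<exists>y. ((\<lambda>r. q \<kappa> ((1 + r) / 2) - \<kappa>\<^sup>2 * r\<^sup>2) has_real_derivative y) (at x) \<and> y \<le> 0"
        using q_slope_le[of x \<kappa>] x True by (intro exI) (auto simp: algebra_simps)
    qed
    then have "q \<kappa> ((1 + r) / 2) \<le> (p \<kappa>)\<^sup>2 + \<kappa>\<^sup>2 * r\<^sup>2"
      using q_at_half[OF assms(1)] by simp
    moreover have "0 \<le> 4 * r\<^sup>2" by simp
    ultimately show ?thesis unfolding distrib_right by linarith
  next
    case False
    then have "1 \<le> 4 * r\<^sup>2" using power_mono[of "1/2" r 2] by (simp add: power2_eq_square)
    also have "\<dots> \<le> (p \<kappa>)\<^sup>2 + (\<kappa>\<^sup>2 + 4) * r\<^sup>2" by (simp add: algebra_simps)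
    finally show ?thesis using q_le_p[of \<kappa> r] p_less_1[OF assms(1)] by simp
  qed
  show ?thesis
    using *[of \<rho>] *[of "- \<rho>"] q_sym[OF assms] assms by (cases "\<rho> \<ge> 0") auto
qed

text \<open>A strongly correlated pair is separated when the first coordinate lies within s of the
  boundary and the independent noise, whose size s is at least sqrt \<beta>, pushes the second one
  out. This has probability of order sqrt \<beta>, which later beats the entropy.\<close>

lemma q_near_zero:
  assumes "\<kappa> > 0"
  obtains c b where "c > 0" "b > 0" "b \<le> 1/2"
    "\<And>\<beta>. 0 < \<beta> \<Longrightarrow> \<beta> \<le> b \<Longrightarrow> q \<kappa> \<beta> \<le> p \<kappa> - c * sqrt \<beta>"
proof -
  define t where "t = Phi (3 + \<kappa>) - Phi (2 + \<kappa>)"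
  have "Phi (2 + \<kappa>) < Phi (3 + \<kappa>)"
    by (rule DERIV_pos_imp_increasing) (use DERIV_Phi std_normal_density_pos in auto)
  then have t: "t > 0" by (simp add: t_def)
  \<comment> \<open>\<beta> \<le> 1/2 gives sqrt \<beta> \<le> s. 4 \<beta> \<le> \<kappa>^2 gives s
    \<le> \<kappa>, which keeps the strip [\<kappa> - s, \<kappa>] inside [0, \<kappa>], where the
    density is at least its value at \<kappa>.\<close>
  define b where "b = min (1/2) (\<kappa>\<^sup>2 / 4)"
  have "q \<kappa> \<beta> \<le> p \<kappa> - (std_normal_density \<kappa> * t) * sqrt \<beta>" if \<beta>: "0 < \<beta>" "\<beta> \<le> b" for \<beta>
  proof -
    define \<rho> s where "\<rho> = 1 - 2 * \<beta>" and "s = sqrt (1 - \<rho>\<^sup>2)"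
    have b: "\<beta> \<le> 1/2" "4 * \<beta> \<le> \<kappa>\<^sup>2" using \<beta> by (auto simp: b_def)
    have \<rho>: "0 \<le> \<rho>" "\<rho> < 1" using b \<beta> by (auto simp: \<rho>_def)
    have s2: "1 - \<rho>\<^sup>2 = 4 * \<beta> * (1 - \<beta>)" by (simp add: \<rho>_def power2_eq_square algebra_simps)
    have "\<beta> * 1 \<le> \<beta> * (4 * (1 - \<beta>))" using b \<beta> by (intro mult_left_mono) auto
    then have s\<beta>: "sqrt \<beta> \<le> s" unfolding s_def s2 by (simp add: algebra_simps)
    have s0: "s > 0" using s\<beta> \<beta> by (meson less_le_trans real_sqrt_gt_zero)
    have "4 * \<beta> * (1 - \<beta>) \<le> 4 * \<beta> * 1" using \<beta> by (intro mult_left_mono) auto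
    then have "s \<le> sqrt (\<kappa>\<^sup>2)" unfolding s_def s2 using b by (intro real_sqrt_le_mono) linarith
    then have s\<kappa>: "s \<le> \<kappa>" using assms by simp
    have ss: "s\<^sup>2 = 1 - \<rho>\<^sup>2" using \<rho> by (simp add: s_def abs_square_le_1)
    then have s1: "s \<le> 1" using s0 by (intro power2_le_imp_le[of s 1]) auto
    have "1 - \<rho> \<le> 1 - \<rho>\<^sup>2" using \<rho> by (simp add: power2_eq_square mult_left_le_one_le)
    also have "\<dots> \<le> s" unfolding ss[symmetric] using s0 s1 by (simp add: power2_eq_square mult_left_le_one_le)
    finally have r1: "1 - \<rho> \<le> s" .
    have disj: "corr_box \<kappa> \<rho> \<inter> ({\<kappa> - s..\<kappa>} \<times> {2 + \<kappa>..3 + \<kappa>}) = {}"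
    proof -
      \<comment> \<open>Replacing \<kappa> by \<rho> u costs at most s + s \<kappa>, while s v
        contributes at least s (2 + \<kappa>).\<close>
      have "\<rho> * u + s * v > \<kappa>" if u: "\<kappa> - s \<le> u" "u \<le> \<kappa>" and v: "2 + \<kappa> \<le> v" for u v
      proof -
        have "(1 - \<rho>) * u \<le> s * \<kappa>" using u r1 \<rho> s\<kappa> s0 by (intro mult_mono) auto
        moreover have "s * (2 + \<kappa>) \<le> s * v" using v s0 by (intro mult_left_mono) auto
        ultimately show ?thesis using u s0 by (simp add: algebra_simps)
      qed
      then show ?thesis by (fastforce simp: corr_box_def s_def[symmetric])
    qed
    let ?M = "measure (std_gaussian \<Otimes>\<^sub>M std_gaussian)"
    have "?M (corr_box \<kappa> \<rho>) + ?M ({\<kappa> - s..\<kappa>} \<times> {2 + \<kappa>..3 + \<kappa>}) =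
        ?M (corr_box \<kappa> \<rho> \<union> ({\<kappa> - s..\<kappa>} \<times> {2 + \<kappa>..3 + \<kappa>}))"
      by (rule std2.P.finite_measure_Union[symmetric]) (use disj corr_box_sets in \<open>auto intro!: pair_measureI\<close>)
    also have "\<dots> \<le> ?M ({z. \<bar>z\<bar> \<le> \<kappa>} \<times> UNIV)"
      by (rule std2.P.finite_measure_mono) (use s\<kappa> in \<open>auto simp: corr_box_def\<close>)
    also have "\<dots> = p \<kappa>"
      using std.prob_space by (subst measure_std_gaussian_times) (auto simp: p_def)
    also have "?M ({\<kappa> - s..\<kappa>} \<times> {2 + \<kappa>..3 + \<kappa>}) = (Phi \<kappa> - Phi (\<kappa> - s)) * t"
      using s0 by (simp add: measure_std_gaussian_times measure_std_gaussian_Icc t_def)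
    finally have "q \<kappa> ((1 + \<rho>) / 2) + (Phi \<kappa> - Phi (\<kappa> - s)) * t \<le> p \<kappa>" by (simp add: q_eq_measure)
    moreover have "q \<kappa> ((1 + \<rho>) / 2) = q \<kappa> \<beta>"
    proof -
      have "(1 - \<rho>) / 2 = \<beta>" by (simp add: \<rho>_def)
      then show ?thesis using q_sym[OF assms, of \<rho>] \<rho> by simp
    qed
    moreover have "std_normal_density \<kappa> * sqrt \<beta> * t \<le> (Phi \<kappa> - Phi (\<kappa> - s)) * t"
    proof (rule mult_right_mono)
      obtain z where z: "\<kappa> - s < z" "z < \<kappa>" "Phi \<kappa> - Phi (\<kappa> - s) = (\<kappa> - (\<kappa> - s)) * std_normal_density z"
        using MVT2[of "\<kappa> - s" \<kappa> Phi std_normal_density] DERIV_Phi s0 by auto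
      have "z\<^sup>2 \<le> \<kappa>\<^sup>2" using z s\<kappa> by (intro power_mono) auto
      then have "std_normal_density \<kappa> \<le> std_normal_density z"
        by (simp add: std_normal_density_eq divide_right_mono)
      then have "std_normal_density \<kappa> * sqrt \<beta> \<le> std_normal_density z * s"
        using s\<beta> \<beta> std_normal_density_pos[of z] by (intro mult_mono) auto
      then show "std_normal_density \<kappa> * sqrt \<beta> \<le> Phi \<kappa> - Phi (\<kappa> - s)" using z by (simp add: mult.commute)
    qed (use t in simp)
    ultimately show ?thesis by (simp add: algebra_simps)
  qed
  then show ?thesis
    using that[of "std_normal_density \<kappa> * t" b] t std_normal_density_pos[of \<kappa>] assms
    by (auto simp: b_def)
qed

definition F_slope :: "real \<Rightarrow> real \<Rightarrow> real \<Rightarrow> real" where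
  "F_slope \<kappa> \<alpha> \<beta> = ln (1 - \<beta>) - ln \<beta> + 2 * \<alpha> * q_slope \<kappa> (2 * \<beta> - 1) / q \<kappa> \<beta>"

lemma DERIV_q:
  assumes "\<kappa> > 0" "0 < \<beta>" "\<beta> < 1"
  shows "(q \<kappa> has_real_derivative 2 * q_slope \<kappa> (2 * \<beta> - 1)) (at \<beta>)"
proof -
  have "((\<lambda>\<beta>. q \<kappa> ((1 + (2 * \<beta> - 1)) / 2)) has_real_derivative q_slope \<kappa> (2 * \<beta> - 1) * 2) (at \<beta>)"
    by (rule DERIV_chain2[OF DERIV_q_corr[OF assms(1)]])
      (use assms in \<open>auto intro!: derivative_eq_intros\<close>)
  then show ?thesis by (simp add: mult.commute)
qed

lemma q_bounds:
  assumes "\<kappa> > 0" "0 \<le> \<beta>" "\<beta> \<le> 1"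
  shows "0 < q \<kappa> \<beta>" "(p \<kappa>)\<^sup>2 \<le> q \<kappa> \<beta>" "q \<kappa> \<beta> \<le> p \<kappa>"
    "q \<kappa> \<beta> \<le> (p \<kappa>)\<^sup>2 + (\<kappa>\<^sup>2 + 4) * (2 * \<beta> - 1)\<^sup>2" "q \<kappa> (1 - \<beta>) = q \<kappa> \<beta>"
  using q_pos[OF assms(1), of "2 * \<beta> - 1"] q_ge_p_squared[OF assms(1), of "2 * \<beta> - 1"]
    q_le_p[of \<kappa> "2 * \<beta> - 1"] q_le_p_squared_plus[OF assms(1), of "2 * \<beta> - 1"]
    q_sym[OF assms(1), of "2 * \<beta> - 1"] assms by (auto simp: diff_divide_distrib)

lemma DERIV_F:
  assumes "\<kappa> > 0" "0 < \<beta>" "\<beta> < 1"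
  shows "(F \<kappa> \<alpha> has_real_derivative F_slope \<kappa> \<alpha> \<beta>) (at \<beta>)"
proof -
  have q: "q \<kappa> \<beta> > 0" using q_bounds(1)[of \<kappa> \<beta>] assms by simp
  have "(entropy has_real_derivative ln (1 - \<beta>) - ln \<beta>) (at \<beta>)"
  proof -
    have x: "((\<lambda>x. x * ln x) has_real_derivative ln x + 1) (at x)" if "x > 0" for x :: real
      using that by (auto intro!: derivative_eq_intros)
    have "((\<lambda>\<beta>. (1 - \<beta>) * ln (1 - \<beta>)) has_real_derivative (ln (1 - \<beta>) + 1) * (- 1)) (at \<beta>)"
      using assms by (intro DERIV_chain2[where f = "\<lambda>x. x * ln x"] x) (auto intro!: derivative_eq_intros)
    from DERIV_diff[OF DERIV_minus[OF x] this] assms show ?thesis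
      unfolding entropy_def [abs_def] by (simp add: algebra_simps)
  qed
  moreover have "((\<lambda>\<beta>. \<alpha> * ln (q \<kappa> \<beta>)) has_real_derivative \<alpha> * (2 * q_slope \<kappa> (2 * \<beta> - 1) / q \<kappa> \<beta>)) (at \<beta>)"
    using DERIV_ln_divide[OF q] DERIV_q[OF assms]
    by (auto intro!: derivative_eq_intros q)
  ultimately show ?thesis
    unfolding F_def [abs_def] F_slope_def by (auto intro: DERIV_cong[OF DERIV_add])
qed

text \<open>The second derivative of F at 1/2, equal to 4 (\<alpha> v^2 - 1) with v =
  \<open>vratio \<kappa>\<close>. Because \<open>q_slope\<close> vanishes at correlation 0, the
  two-point function enters only through the derivative of \<open>q_slope\<close> there.\<close>

lemma DERIV_F_slope_half:
  assumes "\<kappa> > 0"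
  shows "(F_slope \<kappa> \<alpha> has_real_derivative
    (4 * \<alpha> * (2 * \<kappa> * std_normal_density \<kappa>)\<^sup>2 / (p \<kappa>)\<^sup>2 - 4)) (at (1/2))"
proof -
  have e: "exp (- \<kappa>\<^sup>2) = 2 * pi * (std_normal_density \<kappa>)\<^sup>2"
  proof -
    have "(exp (- (\<kappa>\<^sup>2 / 2)))\<^sup>2 = exp (- \<kappa>\<^sup>2)"
      unfolding power2_eq_square mult_exp_exp by simp
    then show ?thesis by (simp add: std_normal_density_eq power_divide)
  qed
  have "(q_slope \<kappa> has_real_derivative 2 * \<kappa>\<^sup>2 * exp (- \<kappa>\<^sup>2) / pi) (at 0)"
    unfolding q_slope_def [abs_def]
    by (auto intro!: derivative_eq_intros simp: field_simps)
  then have s: "((\<lambda>\<beta>. q_slope \<kappa> (2 * \<beta> - 1)) has_real_derivative 2 * \<kappa>\<^sup>2 * exp (- \<kappa>\<^sup>2) / pi * 2) (at (1/2))"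
    by (intro DERIV_chain2[where f = "q_slope \<kappa>"]) (auto intro!: derivative_eq_intros)
  have q0: "q_slope \<kappa> 0 = 0" by (simp add: q_slope_def)
  have q2: "(q \<kappa> has_real_derivative 0) (at (1/2))"
    using DERIV_q[OF assms, of "1/2"] q0 by simp
  have pp: "p \<kappa> > 0" by (rule p_pos) fact
  show ?thesis
    unfolding F_slope_def [abs_def]
    by (rule derivative_eq_intros s q2 refl | simp add: q_at_half[OF assms] pp[THEN less_imp_neq, THEN not_sym])+
      (use pp in \<open>simp add: q_at_half[OF assms] q0 e, simp add: field_simps eval_nat_numeral\<close>)
qed

section \<open>Consequences of Assumption A\<close>

lemma q_slope_odd: "q_slope \<kappa> (- \<rho>) = - q_slope \<kappa> \<rho>"
  unfolding q_slope_def power2_minus diff_minus_eq_add add_uminus_conv_diff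
  by (metis minus_diff_eq minus_divide_left)

lemma F_sym:
  assumes "\<kappa> > 0" "0 \<le> \<beta>" "\<beta> \<le> 1"
  shows "F \<kappa> \<alpha> (1 - \<beta>) = F \<kappa> \<alpha> \<beta>"
proof -
  have e: "1 - (1 - \<beta>) = \<beta>" by simp
  show ?thesis
    unfolding F_def entropy_def e q_bounds(5)[OF assms] by linarith
qed

lemma F_half:
  assumes "\<kappa> > 0"
  shows "F \<kappa> \<alpha> (1/2) = ln 2 + 2 * \<alpha> * ln (p \<kappa>)"
proof -
  have "ln (1/2 :: real) = - ln 2" using ln_inverse[of "2::real"] by (simp add: inverse_eq_divide)
  moreover have "ln ((p \<kappa>)\<^sup>2) = 2 * ln (p \<kappa>)" using ln_realpow[of "p \<kappa>" 2] p_pos[OF assms] by simp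
  ultimately show ?thesis unfolding F_def entropy_def q_at_half[OF assms] by simp
qed

lemma F_slope_half: "F_slope \<kappa> \<alpha> (1/2) = 0"
  by (simp add: F_slope_def q_slope_def)

lemma isCont_F_slope:
  assumes "\<kappa> > 0" "0 < \<beta>" "\<beta> < 1"
  shows "isCont (F_slope \<kappa> \<alpha>) \<beta>"
proof -
  have q: "isCont (q \<kappa>) \<beta>" using DERIV_q[OF assms] by (rule DERIV_isCont)
  have "0 < \<beta> * (1 - \<beta>)" using assms by simp
  moreover have "1 - (2 * \<beta> - 1)\<^sup>2 = 4 * (\<beta> * (1 - \<beta>))" by (simp add: power2_eq_square algebra_simps)
  ultimately have "1 - (2 * \<beta> - 1)\<^sup>2 \<noteq> 0" by (simp only:)
  then show ?thesis
    unfolding F_slope_def q_slope_def using assms q_bounds(1)[of \<kappa> \<beta>]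
    by (intro continuous_intros q) auto
qed

text \<open>The entropy slope tends to infinity only like - ln \<beta>, whereas the term with
  \<open>q_slope\<close> tends to minus infinity like 1 / sqrt \<beta>. Since \<open>q_slope\<close>
  is nonpositive here, q may be replaced by the larger p.\<close>

lemma F_slope_neg_near_0:
  assumes "\<kappa> > 0" "\<alpha> > 0"
  shows "eventually (\<lambda>\<beta>. F_slope \<kappa> \<alpha> \<beta> < 0) (at_right 0)"
proof -
  have pp: "p \<kappa> > 0" by (rule p_pos) fact
  define P where "P = p \<kappa>"
  have P: "P > 0" using pp by (simp add: P_def)
  have lim: "filterlim (\<lambda>\<beta>. ln (1 - \<beta>) - ln \<beta> + 2 * \<alpha> * ((exp (- \<kappa>\<^sup>2 / (2 * \<beta>)) - exp (- \<kappa>\<^sup>2 / (2 - 2 * \<beta>)))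
      / (pi * sqrt (4 * \<beta> * (1 - \<beta>)))) / P) at_bot (at_right 0)"
    using assms P by real_asymp
  have "eventually (\<lambda>\<beta>. ln (1 - \<beta>) - ln \<beta> + 2 * \<alpha> * ((exp (- \<kappa>\<^sup>2 / (2 * \<beta>)) - exp (- \<kappa>\<^sup>2 / (2 - 2 * \<beta>)))
      / (pi * sqrt (4 * \<beta> * (1 - \<beta>)))) / P < 0) (at_right 0)"
    using lim unfolding filterlim_at_bot_dense by blast
  moreover have "eventually (\<lambda>\<beta>::real. \<beta> \<in> {0<..<1/2}) (at_right 0)"
    by (rule eventually_at_right_real) simp
  ultimately show ?thesis
  proof eventually_elim
    case (elim \<beta>)
    let ?s = "q_slope \<kappa> (2 * \<beta> - 1)"
    have e: "?s = (exp (- \<kappa>\<^sup>2 / (2 * \<beta>)) - exp (- \<kappa>\<^sup>2 / (2 - 2 * \<beta>))) / (pi * sqrt (4 * \<beta> * (1 - \<beta>)))"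
      by (simp add: q_slope_def power2_eq_square algebra_simps)
    have "?s \<le> 0"
      using q_slope_odd[of \<kappa> "1 - 2 * \<beta>"] q_slope_nonneg[of "1 - 2 * \<beta>" \<kappa>] elim by simp
    then have "2 * \<alpha> * ?s / q \<kappa> \<beta> \<le> 2 * \<alpha> * ?s / P"
      using q_bounds(1,3)[of \<kappa> \<beta>] elim assms P
      by (intro divide_left_mono_neg) (auto simp: mult_nonneg_nonpos P_def)
    then show ?case using elim unfolding F_slope_def e by simp
  qed
qed

lemma same_sign_neg:
  fixes f :: "real \<Rightarrow> real"
  assumes "a \<le> b" "f a < 0" "\<And>x. a \<le> x \<Longrightarrow> x \<le> b \<Longrightarrow> isCont f x" "\<And>x. a \<le> x \<Longrightarrow> x \<le> b \<Longrightarrow> f x \<noteq> 0"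
  shows "f b < 0"
proof (rule ccontr)
  assume "\<not> f b < 0"
  then have "\<exists>x\<ge>a. x \<le> b \<and> f x = 0" using assms by (intro IVT) auto
  then show False using assms(4) by blast
qed

lemma same_sign_pos:
  fixes f :: "real \<Rightarrow> real"
  assumes "a \<le> b" "f b > 0" "\<And>x. a \<le> x \<Longrightarrow> x \<le> b \<Longrightarrow> isCont f x" "\<And>x. a \<le> x \<Longrightarrow> x \<le> b \<Longrightarrow> f x \<noteq> 0"
  shows "f a > 0"
proof (rule ccontr)
  assume "\<not> f a > 0"
  then have "\<exists>x\<ge>a. x \<le> b \<and> f x = 0" using assms by (intro IVT) auto
  then show False using assms(4) by blast
qed

locale frozen_regime =
  fixes \<kappa> \<alpha> :: real
  assumes \<kappa>_pos: "\<kappa> > 0" and \<alpha>_pos: "0 < \<alpha>" and \<alpha>_less: "\<alpha> < alpha_c \<kappa>"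
    and A: assumption_A
begin

abbreviation "\<phi> \<equiv> F \<kappa> \<alpha>"
abbreviation "P \<equiv> p \<kappa>"

lemma P_pos: "P > 0" by (rule p_pos[OF \<kappa>_pos])
lemma P_less_1: "P < 1" by (rule p_less_1[OF \<kappa>_pos])
lemma ln_P_neg: "ln P < 0" using P_pos P_less_1 by simp

lemma \<alpha>_bound: "\<alpha> * - ln P < ln 2"
  using \<alpha>_less ln_P_neg by (simp add: alpha_c_def field_simps)

lemma curvature_neg: "4 * \<alpha> * (2 * \<kappa> * std_normal_density \<kappa>)\<^sup>2 / P\<^sup>2 - 4 < 0"
proof -
  let ?u = "(2 * \<kappa> * std_normal_density \<kappa>)\<^sup>2"
  have "\<alpha> * - ln P * ?u \<le> ln 2 * ?u" using \<alpha>_bound by (intro mult_right_mono) auto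
  also have "\<dots> < P\<^sup>2 * - ln P" by (rule stability_gap_pos[OF \<kappa>_pos])
  finally have "(\<alpha> * ?u) * - ln P < P\<^sup>2 * - ln P" by (simp only: mult_ac)
  then have "\<alpha> * ?u < P\<^sup>2" using ln_P_neg by (simp add: mult_less_cancel_right)
  then show ?thesis using P_pos by (simp add: field_simps)
qed

lemma deriv2_neg: "(deriv ^^ 2) \<phi> (1/2) < 0"
proof -
  have "eventually (\<lambda>\<beta>. \<beta> \<in> {0<..<1}) (nhds (1/2 :: real))"
    by (intro eventually_nhds_in_open) auto
  then have ev: "eventually (\<lambda>\<beta>. F_slope \<kappa> \<alpha> \<beta> = deriv \<phi> \<beta>) (nhds (1/2))"
    by eventually_elim (rule DERIV_imp_deriv[OF DERIV_F[OF \<kappa>_pos], symmetric], auto)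
  have "(deriv \<phi> has_real_derivative (4 * \<alpha> * (2 * \<kappa> * std_normal_density \<kappa>)\<^sup>2 / P\<^sup>2 - 4)) (at (1/2))"
    by (rule iffD1[OF DERIV_cong_ev[OF refl ev refl] DERIV_F_slope_half[OF \<kappa>_pos]])
  then show ?thesis
    using curvature_neg by (simp add: eval_nat_numeral DERIV_imp_deriv)
qed

text \<open>Assumption A leaves b as the only zero of the slope in (0, 1/2). The slope is negative
  near 0, and positive just left of 1/2 because it vanishes at 1/2 with negative derivative;
  continuity then fixes its sign on both sides of b. The last bound is this same derivative at 1/2,
  made quantitative.\<close>

lemma critical_point:
  obtains b k d where "0 < b" "b < 1/2" "\<And>\<beta>. 0 < \<beta> \<Longrightarrow> \<beta> < b \<Longrightarrow> F_slope \<kappa> \<alpha> \<beta> < 0"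
    "\<And>\<beta>. b < \<beta> \<Longrightarrow> \<beta> < 1/2 \<Longrightarrow> F_slope \<kappa> \<alpha> \<beta> > 0"
    "k > 0" "0 < d" "d < 1/2" "b < 1/2 - d"
    "\<And>\<beta>. 1/2 - d \<le> \<beta> \<Longrightarrow> \<beta> \<le> 1/2 \<Longrightarrow> k * (1/2 - \<beta>) \<le> F_slope \<kappa> \<alpha> \<beta>"
proof -
  have "\<exists>!\<beta>. \<beta> \<in> {0<..<1/2} \<and> (\<phi> has_real_derivative 0) (at \<beta>)"
    using A deriv2_neg \<kappa>_pos \<alpha>_pos unfolding assumption_A_def by blast
  then obtain b where b0: "b \<in> {0<..<1/2} \<and> (\<phi> has_real_derivative 0) (at b)"
    and b1: "\<forall>\<beta>. \<beta> \<in> {0<..<1/2} \<and> (\<phi> has_real_derivative 0) (at \<beta>) \<longrightarrow> \<beta> = b"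
    unfolding Ex1_def by blast
  have b: "0 < b" "b < 1/2" using b0 by auto
  have uniq: "\<beta> = b" if "0 < \<beta>" "\<beta> < 1/2" "(\<phi> has_real_derivative 0) (at \<beta>)" for \<beta>
    using b1 that by simp
  have nz: "F_slope \<kappa> \<alpha> \<beta> \<noteq> 0" if "0 < \<beta>" "\<beta> < 1/2" "\<beta> \<noteq> b" for \<beta>
    using DERIV_F[OF \<kappa>_pos, of \<beta> \<alpha>] uniq[of \<beta>] that by auto
  define c where "c = 4 * \<alpha> * (2 * \<kappa> * std_normal_density \<kappa>)\<^sup>2 / P\<^sup>2 - 4"
  have c: "c < 0" using curvature_neg by (simp add: c_def)
  have "((\<lambda>h. (F_slope \<kappa> \<alpha> (1/2 + h) - F_slope \<kappa> \<alpha> (1/2)) / h) \<longlongrightarrow> c) (at 0)"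
    using DERIV_F_slope_half[OF \<kappa>_pos, of \<alpha>] unfolding DERIV_def c_def .
  then have "eventually (\<lambda>h. (F_slope \<kappa> \<alpha> (1/2 + h) - F_slope \<kappa> \<alpha> (1/2)) / h < c / 2) (at 0)"
    using c by (intro order_tendstoD) auto
  then obtain e where e: "e > 0" "\<And>h. h \<noteq> 0 \<Longrightarrow> \<bar>h\<bar> < e \<Longrightarrow> F_slope \<kappa> \<alpha> (1/2 + h) / h < c / 2"
    unfolding eventually_at F_slope_half by (auto simp: dist_real_def)
  have quad: "- c / 2 * (1/2 - \<beta>) \<le> F_slope \<kappa> \<alpha> \<beta>" if "1/2 - e < \<beta>" "\<beta> \<le> 1/2" for \<beta>
  proof (cases "\<beta> = 1/2")
    case True
    show ?thesis unfolding True by (simp add: F_slope_half)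
  next
    case False
    then have "F_slope \<kappa> \<alpha> \<beta> / (\<beta> - 1/2) < c / 2" using e(2)[of "\<beta> - 1/2"] that by auto
    then show ?thesis using False that by (simp add: divide_less_eq algebra_simps split: if_splits)
  qed
  define d where "d = min (e / 2) ((1/2 - b) / 2)"
  have d: "0 < d" "d < e" "d < 1/2" "b < 1/2 - d" using e b by (auto simp: d_def min_def field_simps)
  show ?thesis
  proof (rule that[of b "- c / 2" d])
    fix \<beta> assume \<beta>: "0 < \<beta>" "\<beta> < b"
    have "eventually (\<lambda>x. F_slope \<kappa> \<alpha> x < 0 \<and> x \<in> {0<..<\<beta>}) (at_right 0)"
      by (intro eventually_conj F_slope_neg_near_0 \<kappa>_pos \<alpha>_pos eventually_at_right_real \<beta>)
    then obtain x where "F_slope \<kappa> \<alpha> x < 0" "0 < x" "x < \<beta>"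
      using eventually_happens[of _ "at_right (0::real)"] by force
    then show "F_slope \<kappa> \<alpha> \<beta> < 0"
      using \<beta> b by (intro same_sign_neg[of x \<beta> "F_slope \<kappa> \<alpha>"] isCont_F_slope nz \<kappa>_pos) auto
  next
    fix \<beta> assume \<beta>: "b < \<beta>" "\<beta> < 1/2"
    \<comment> \<open>A point at or to the right of \<beta> that lies in the window where the linear
      bound already shows the slope to be positive.\<close>
    define y where "y = max \<beta> (1/2 - d)"
    have y: "\<beta> \<le> y" "y < 1/2" "1/2 - e < y" using \<beta> d by (auto simp: y_def max_def)
    have "0 < - c / 2 * (1/2 - y)" using c y by (intro mult_pos_pos) auto
    then have "F_slope \<kappa> \<alpha> y > 0" using quad[of y] y by simp
    then show "F_slope \<kappa> \<alpha> \<beta> > 0"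
      using \<beta> b y by (intro same_sign_pos[of \<beta> y "F_slope \<kappa> \<alpha>"] isCont_F_slope nz \<kappa>_pos) auto
  qed (use b c d quad in auto)
qed

text \<open>By \<open>q_near_zero\<close> the energy term loses order sqrt \<beta>, and the entropy
  is o(sqrt \<beta>).\<close>

lemma F_near_0:
  obtains c b where "c > 0" "0 < b" "b < 1/2" "\<And>\<beta>. 0 < \<beta> \<Longrightarrow> \<beta> \<le> b \<Longrightarrow> \<phi> \<beta> \<le> \<alpha> * ln P - c * sqrt \<beta>"
proof -
  from q_near_zero[OF \<kappa>_pos] obtain c b where c: "c > 0" and b: "b > 0" "b \<le> 1/2"
    and q: "\<And>\<beta>. 0 < \<beta> \<Longrightarrow> \<beta> \<le> b \<Longrightarrow> q \<kappa> \<beta> \<le> P - c * sqrt \<beta>" by metis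
  \<comment> \<open>Half of the rate \<alpha> c / P; the other half absorbs the entropy.\<close>
  define k where "k = \<alpha> * c / (2 * P)"
  have k: "k > 0" using \<alpha>_pos c P_pos by (simp add: k_def)
  have "((\<lambda>\<beta>. (- \<beta> * ln \<beta> - (1 - \<beta>) * ln (1 - \<beta>)) / sqrt \<beta>) \<longlongrightarrow> 0) (at_right 0)"
    by real_asymp
  then have "eventually (\<lambda>\<beta>. entropy \<beta> / sqrt \<beta> < k) (at_right 0)"
    unfolding entropy_def using k by (rule order_tendstoD)
  then obtain b' where b': "b' > 0" "\<And>\<beta>. 0 < \<beta> \<Longrightarrow> \<beta> < b' \<Longrightarrow> entropy \<beta> / sqrt \<beta> < k"
    unfolding eventually_at_right_field by auto
  define b'' where "b'' = min b (b' / 2) / 2"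
  have b'': "b'' > 0" "b'' < b" "b'' < b'" "b'' < 1/2" using b b' by (auto simp: b''_def)
  show ?thesis
  proof (rule that[of k b''])
    fix \<beta> assume \<beta>: "0 < \<beta>" "\<beta> \<le> b''"
    have e: "entropy \<beta> \<le> k * sqrt \<beta>"
      using b'(2)[of \<beta>] \<beta> b'' by (simp add: divide_less_eq)
    have qp: "q \<kappa> \<beta> > 0" using q_bounds(1)[OF \<kappa>_pos, of \<beta>] \<beta> b'' by simp
    have "q \<kappa> \<beta> / P \<le> 1 - c * sqrt \<beta> / P"
      using q[of \<beta>] \<beta> b'' P_pos by (simp add: field_simps)
    moreover have "ln (q \<kappa> \<beta> / P) \<le> q \<kappa> \<beta> / P - 1"
      using qp P_pos by (intro ln_le_minus_one) simp
    ultimately have "ln (q \<kappa> \<beta>) - ln P \<le> - (c * sqrt \<beta> / P)"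
      using qp P_pos by (simp add: ln_div)
    then have "\<alpha> * (ln (q \<kappa> \<beta>) - ln P) \<le> \<alpha> * (- (c * sqrt \<beta> / P))"
      using \<alpha>_pos by (intro mult_left_mono) auto
    also have "\<dots> = - 2 * k * sqrt \<beta>" using P_pos by (simp add: k_def)
    finally show "\<phi> \<beta> \<le> \<alpha> * ln P - k * sqrt \<beta>"
      using e by (simp add: F_def algebra_simps)
  qed (use k b'' in auto)
qed

lemma F_shape:
  obtains b k d where "0 < b" "b < 1/2" "k > 0" "0 < d" "b < 1/2 - d"
    "\<And>x y. 0 < x \<Longrightarrow> x \<le> y \<Longrightarrow> y \<le> b \<Longrightarrow> \<phi> y \<le> \<phi> x"
    "\<And>x y. b \<le> x \<Longrightarrow> x < y \<Longrightarrow> y \<le> 1/2 \<Longrightarrow> \<phi> x < \<phi> y"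
    "\<And>x. 1/2 - d \<le> x \<Longrightarrow> x \<le> 1/2 \<Longrightarrow> \<phi> x \<le> \<phi> (1/2) - k * (2 * x - 1)\<^sup>2"
proof -
  obtain b k d where b: "0 < b" "b < 1/2" "\<And>\<beta>. 0 < \<beta> \<Longrightarrow> \<beta> < b \<Longrightarrow> F_slope \<kappa> \<alpha> \<beta> < 0"
    "\<And>\<beta>. b < \<beta> \<Longrightarrow> \<beta> < 1/2 \<Longrightarrow> F_slope \<kappa> \<alpha> \<beta> > 0"
    and k: "k > 0" "0 < d" "d < 1/2" "b < 1/2 - d"
    "\<And>\<beta>. 1/2 - d \<le> \<beta> \<Longrightarrow> \<beta> \<le> 1/2 \<Longrightarrow> k * (1/2 - \<beta>) \<le> F_slope \<kappa> \<alpha> \<beta>"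
    by (fact critical_point)
  have cont: "continuous_on {x..y} \<phi>" if "0 < x" "y \<le> 1/2" for x y
    using that by (intro continuous_at_imp_continuous_on ballI DERIV_isCont[OF DERIV_F[OF \<kappa>_pos]]) auto
  show ?thesis
  proof (rule that[of b "k / 8" d])
    fix x y assume xy: "0 < x" "x \<le> y" "y \<le> b"
    show "\<phi> y \<le> \<phi> x"
    proof (rule DERIV_nonpos_imp_decreasing_open[OF xy(2)])
      fix z assume "x < z" "z < y"
      then show "\<exists>w. (\<phi> has_real_derivative w) (at z) \<and> w \<le> 0"
        using xy b DERIV_F[OF \<kappa>_pos, of z \<alpha>] by (intro exI[of _ "F_slope \<kappa> \<alpha> z"]) (auto intro: less_imp_le)
    qed (use xy b cont in auto)
  next
    fix x y assume xy: "b \<le> x" "x < y" "y \<le> 1/2"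
    show "\<phi> x < \<phi> y"
    proof (rule DERIV_pos_imp_increasing_open[OF xy(2)])
      fix z assume "x < z" "z < y"
      then show "\<exists>w. (\<phi> has_real_derivative w) (at z) \<and> w > 0"
        using xy b DERIV_F[OF \<kappa>_pos, of z \<alpha>] by (intro exI[of _ "F_slope \<kappa> \<alpha> z"]) auto
    qed (use xy b cont in auto)
  next
    fix x assume x: "1/2 - d \<le> x" "x \<le> 1/2"
    have "\<phi> x + k / 2 * (1/2 - x)\<^sup>2 \<le> \<phi> (1/2) + k / 2 * (1/2 - 1/2)\<^sup>2"
    proof (rule DERIV_nonneg_imp_nondecreasing[OF x(2)])
      fix z assume z: "x \<le> z" "z \<le> 1/2"
      have "((\<lambda>x. \<phi> x + k / 2 * (1/2 - x)\<^sup>2) has_real_derivative F_slope \<kappa> \<alpha> z - k * (1/2 - z)) (at z)"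
        using z x b k by (auto intro!: derivative_eq_intros DERIV_F \<kappa>_pos simp: field_simps)
      then show "\<exists>y. ((\<lambda>x. \<phi> x + k / 2 * (1/2 - x)\<^sup>2) has_real_derivative y) (at z) \<and> 0 \<le> y"
        using k(5)[of z] x z by (intro exI) auto
    qed
    moreover have "k / 2 * (1/2 - x)\<^sup>2 = k / 8 * (2 * x - 1)\<^sup>2"
      by (simp add: power2_eq_square field_simps)
    moreover have "k / 2 * (1/2 - 1/2)\<^sup>2 = 0" by simp
    ultimately show "\<phi> x \<le> \<phi> (1/2) - k / 8 * (2 * x - 1)\<^sup>2" by linarith
  qed (use b k in auto)
qed

lemma F_half_gt: "\<alpha> * ln P < \<phi> (1/2)"
  using \<alpha>_bound by (simp add: F_half[OF \<kappa>_pos])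

text \<open>Near 1/2 this is the curvature. On [0, 1/2 - d] the function decreases and then
  increases, so it is bounded by its limiting value \<alpha> ln P at 0 or its value at 1/2 - d; both
  are strictly below F at 1/2. The half above 1/2 follows by symmetry.\<close>

lemma F_quadratic_gap:
  obtains c where "c > 0" "\<And>\<beta>. 0 \<le> \<beta> \<Longrightarrow> \<beta> \<le> 1 \<Longrightarrow> \<phi> \<beta> \<le> \<phi> (1/2) - c * (2 * \<beta> - 1)\<^sup>2"
proof -
  obtain b k d where s: "0 < b" "b < 1/2" "k > 0" "0 < d" "b < 1/2 - d"
    "\<And>x y. 0 < x \<Longrightarrow> x \<le> y \<Longrightarrow> y \<le> b \<Longrightarrow> \<phi> y \<le> \<phi> x"
    "\<And>x y. b \<le> x \<Longrightarrow> x < y \<Longrightarrow> y \<le> 1/2 \<Longrightarrow> \<phi> x < \<phi> y"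
    "\<And>x. 1/2 - d \<le> x \<Longrightarrow> x \<le> 1/2 \<Longrightarrow> \<phi> x \<le> \<phi> (1/2) - k * (2 * x - 1)\<^sup>2"
    by (fact F_shape)
  obtain c0 b0 where n: "c0 > 0" "0 < b0" "b0 < 1/2" "\<And>\<beta>. 0 < \<beta> \<Longrightarrow> \<beta> \<le> b0 \<Longrightarrow> \<phi> \<beta> \<le> \<alpha> * ln P - c0 * sqrt \<beta>"
    by (fact F_near_0)
  define g where "g = min (\<phi> (1/2) - \<alpha> * ln P) (\<phi> (1/2) - \<phi> (1/2 - d))"
  have g: "g > 0" using F_half_gt s by (auto simp: g_def)
  have left: "\<phi> x \<le> \<phi> (1/2) - g" if x: "0 \<le> x" "x \<le> 1/2 - d" for x
  proof -
    consider "x = 0" | "0 < x" "x \<le> b" | "b < x" using x by linarith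
    then show ?thesis
    proof cases
      case 1
      have "q \<kappa> 0 = P" using q_endpoints[of "-1" \<kappa>] by simp
      then have "\<phi> 0 = \<alpha> * ln P" by (simp add: F_def entropy_def)
      then show ?thesis using 1 by (simp add: g_def)
    next
      case 2
      \<comment> \<open>F decreases on (0, b], so x may be moved left into the range of the estimate
        near 0.\<close>
      define y where "y = min x b0"
      have "\<phi> x \<le> \<phi> y" using 2 n s(6)[of y x] by (auto simp: y_def)
      moreover have "\<phi> y \<le> \<alpha> * ln P - c0 * sqrt y" by (rule n(4)) (use 2 n in \<open>auto simp: y_def\<close>)
      moreover have "0 \<le> c0 * sqrt y" using 2 n by (auto simp: y_def)
      ultimately show ?thesis by (simp add: g_def)
    next
      case 3
      then have "\<phi> x \<le> \<phi> (1/2 - d)" using x s(4,5) s(7)[of x "1/2 - d"] by (cases "x = 1/2 - d") auto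
      then show ?thesis by (simp add: g_def)
    qed
  qed
  define c where "c = min g k"
  have half: "\<phi> x \<le> \<phi> (1/2) - c * (2 * x - 1)\<^sup>2" if x: "0 \<le> x" "x \<le> 1/2" for x
  proof (cases "x \<le> 1/2 - d")
    case True
    have "(2 * x - 1)\<^sup>2 \<le> 1" using x by (simp add: abs_square_le_1 abs_le_iff)
    then have "c * (2 * x - 1)\<^sup>2 \<le> g * 1" using g s by (intro mult_mono) (auto simp: c_def)
    then show ?thesis using left[OF x(1) True] by simp
  next
    case False
    have "c * (2 * x - 1)\<^sup>2 \<le> k * (2 * x - 1)\<^sup>2" by (intro mult_right_mono) (auto simp: c_def)
    moreover have "\<phi> x \<le> \<phi> (1/2) - k * (2 * x - 1)\<^sup>2" by (rule s(8)) (use False x in auto)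
    ultimately show ?thesis by linarith
  qed
  show ?thesis
  proof (rule that[of c])
    fix \<beta> :: real assume \<beta>: "0 \<le> \<beta>" "\<beta> \<le> 1"
    show "\<phi> \<beta> \<le> \<phi> (1/2) - c * (2 * \<beta> - 1)\<^sup>2"
    proof (cases "\<beta> \<le> 1/2")
      case False
      have "(2 * (1 - \<beta>) - 1)\<^sup>2 = (2 * \<beta> - 1)\<^sup>2" by (simp add: power2_eq_square algebra_simps)
      then show ?thesis using half[of "1 - \<beta>"] F_sym[OF \<kappa>_pos \<beta>, of \<alpha>] False \<beta> by simp
    qed (use half \<beta> in auto)
  qed (use g s in \<open>simp add: c_def\<close>)
qed

text \<open>F stays below \<alpha> ln P on (0, b] and increases strictly on [b, 1/2] from below this
  level to above it. There is thus exactly one crossing, which gives the definite description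
  \<open>beta_c\<close> its meaning.\<close>

lemma beta_c_props:
  shows "0 < beta_c \<kappa> \<alpha>" "beta_c \<kappa> \<alpha> < 1/2"
    and "\<And>\<delta>. \<delta> \<in> {0<..<beta_c \<kappa> \<alpha>} \<Longrightarrow>
      \<exists>c>0. \<forall>\<beta>. 0 < \<beta> \<longrightarrow> \<beta> \<le> beta_c \<kappa> \<alpha> - \<delta> \<longrightarrow> \<phi> \<beta> \<le> \<alpha> * ln P - c * sqrt \<beta>"
proof -
  obtain b k d where s: "0 < b" "b < 1/2" "k > 0" "0 < d" "b < 1/2 - d"
    "\<And>x y. 0 < x \<Longrightarrow> x \<le> y \<Longrightarrow> y \<le> b \<Longrightarrow> \<phi> y \<le> \<phi> x"
    "\<And>x y. b \<le> x \<Longrightarrow> x < y \<Longrightarrow> y \<le> 1/2 \<Longrightarrow> \<phi> x < \<phi> y"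
    "\<And>x. 1/2 - d \<le> x \<Longrightarrow> x \<le> 1/2 \<Longrightarrow> \<phi> x \<le> \<phi> (1/2) - k * (2 * x - 1)\<^sup>2"
    by (fact F_shape)
  obtain c0 b0 where n: "c0 > 0" "0 < b0" "b0 < 1/2" "\<And>\<beta>. 0 < \<beta> \<Longrightarrow> \<beta> \<le> b0 \<Longrightarrow> \<phi> \<beta> \<le> \<alpha> * ln P - c0 * sqrt \<beta>"
    by (fact F_near_0)
  define c1 where "c1 = min c0 (c0 * sqrt b0)"
  have c1: "c1 > 0" using n by (simp add: c1_def)
  have left: "\<phi> x \<le> \<alpha> * ln P - c1 * sqrt x" if x: "0 < x" "x \<le> b" for x
  proof (cases "x \<le> b0")
    case True
    have "c1 * sqrt x \<le> c0 * sqrt x" using x by (intro mult_right_mono) (auto simp: c1_def)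
    then show ?thesis using n(4)[OF x(1) True] by linarith
  next
    case False
    have "\<phi> x \<le> \<phi> b0" using s(6)[of b0 x] n x False by simp
    also have "\<dots> \<le> \<alpha> * ln P - c0 * sqrt b0" using n by simp
    also have "c1 * sqrt x \<le> (c0 * sqrt b0) * 1"
      using x s n by (intro mult_mono) (auto simp: c1_def)
    ultimately show ?thesis by simp
  qed
  have neg: "\<phi> x < \<alpha> * ln P" if "0 < x" "x \<le> b" for x
  proof -
    have "0 < c1 * sqrt x" using c1 that by simp
    then show ?thesis using left[OF that] by linarith
  qed
  have "\<exists>x\<ge>b. x \<le> 1/2 \<and> \<phi> x = \<alpha> * ln P"
  proof (rule IVT)
    show "\<forall>x. b \<le> x \<and> x \<le> 1/2 \<longrightarrow> isCont \<phi> x"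
      using s(1) by (intro allI impI DERIV_isCont[OF DERIV_F[OF \<kappa>_pos]]) auto
  qed (use neg[of b] F_half_gt s(1,2) in auto)
  then obtain x where x: "b \<le> x" "x \<le> 1/2" "\<phi> x = \<alpha> * ln P" by blast
  have "x \<noteq> 1/2"
  proof
    assume h: "x = 1/2"
    show False using x(3) F_half_gt unfolding h by linarith
  qed
  moreover have "x \<noteq> b"
  proof
    assume h: "x = b"
    show False using x(3) neg[OF s(1) order_refl] unfolding h by linarith
  qed
  ultimately have x': "b < x" "x < 1/2" using x(1,2) by linarith+
  have "beta_c \<kappa> \<alpha> = x"
    unfolding beta_c_def
  proof (rule the_equality)
    fix y assume "y \<in> {0<..<1/2} \<and> \<phi> y - \<alpha> * ln P = 0"
    then have y: "0 < y" "y < 1/2" "\<phi> y = \<alpha> * ln P" by auto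
    have "b < y" 
    proof (rule ccontr)
      assume "\<not> b < y"
      then have "\<phi> y < \<alpha> * ln P" using y(1) by (intro neg) auto
      then show False using y(3) by linarith
    qed
    show "y = x"
    proof (cases x y rule: linorder_cases)
      case less
      then have "\<phi> x < \<phi> y" using x(1) y(2) by (intro s(7)) auto
      then show ?thesis using x(3) y(3) by linarith
    next
      case greater
      then have "\<phi> y < \<phi> x" using x(2) \<open>b < y\<close> by (intro s(7)) auto
      then show ?thesis using x(3) y(3) by linarith
    qed simp
  next
    show "x \<in> {0<..<1/2} \<and> \<phi> x - \<alpha> * ln P = 0"
      using x(3) x' s(1) by simp
  qed
  note bc = this
  show "0 < beta_c \<kappa> \<alpha>" "beta_c \<kappa> \<alpha> < 1/2" using bc x' s(1) by auto
  fix \<delta> assume \<delta>: "\<delta> \<in> {0<..<beta_c \<kappa> \<alpha>}"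
  \<comment> \<open>Beyond b, F is at most its value at x - \<delta>, strictly below \<alpha> ln P.
    As sqrt \<beta> \<le> 1, this fixed gap can serve as a coefficient of sqrt \<beta>.\<close>
  define c where "c = (if b < x - \<delta> then min c1 (\<alpha> * ln P - \<phi> (x - \<delta>)) else c1)"
  have c: "c > 0" using c1 s(7)[of "x - \<delta>" x] x(2,3) \<delta> by (auto simp: c_def)
  have "\<phi> \<beta> \<le> \<alpha> * ln P - c * sqrt \<beta>" if \<beta>: "0 < \<beta>" "\<beta> \<le> x - \<delta>" for \<beta>
  proof (cases "\<beta> \<le> b")
    case True
    have "c * sqrt \<beta> \<le> c1 * sqrt \<beta>" using \<beta> by (intro mult_right_mono) (auto simp: c_def)
    then show ?thesis using left[OF \<beta>(1) True] by linarith
  next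
    case False
    have "\<phi> \<beta> \<le> \<phi> (x - \<delta>)"
      using False \<beta> \<delta> x(2) bc s(7)[of \<beta> "x - \<delta>"] by (cases "\<beta> = x - \<delta>") auto
    moreover have "c * sqrt \<beta> \<le> c * 1" using c \<beta> x(2) \<delta> bc by (intro mult_left_mono) auto
    moreover have "c \<le> \<alpha> * ln P - \<phi> (x - \<delta>)" using False \<beta> by (auto simp: c_def)
    ultimately show ?thesis by simp
  qed
  then show "\<exists>c>0. \<forall>\<beta>. 0 < \<beta> \<longrightarrow> \<beta> \<le> beta_c \<kappa> \<alpha> - \<delta> \<longrightarrow> \<phi> \<beta> \<le> \<alpha> * ln P - c * sqrt \<beta>"
    using c bc by auto
qed

end

section \<open>Gaussian rows\<close>

lemma nn_integral_std_gaussian_density: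
  assumes [measurable]: "f \<in> borel_measurable borel"
  shows "(\<integral>\<^sup>+x. f x \<partial>std_gaussian) = (\<integral>\<^sup>+x. ennreal (std_normal_density x) * f x \<partial>lborel)"
  by (subst nn_integral_density) auto

text \<open>The linear map is orthogonal, so it preserves the product of the densities. The change
  of variables is done one coordinate at a time: an affine substitution, an exchange of integrals,
  and a second substitution, whose factors 1 / \<bar>s\<bar> and \<bar>s\<bar> cancel.\<close>

lemma nn_integral_std_gaussian_rotation:
  fixes c s :: real and f :: "real \<Rightarrow> real \<Rightarrow> ennreal"
  assumes [measurable]: "(\<lambda>z. f (fst z) (snd z)) \<in> borel_measurable (borel \<Otimes>\<^sub>M borel)"
    and cs: "c\<^sup>2 + s\<^sup>2 = 1" "s \<noteq> 0"
  shows "(\<integral>\<^sup>+y. \<integral>\<^sup>+u. f (c * y + s * u) (s * y - c * u) \<partial>std_gaussian \<partial>std_gaussian) =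
    (\<integral>\<^sup>+y. \<integral>\<^sup>+u. f y u \<partial>std_gaussian \<partial>std_gaussian)"
proof -
  define g where "g = (\<lambda>y u. ennreal (std_normal_density y * std_normal_density u) * f y u)"
  have fm: "(\<lambda>w. f (a w) (b w)) \<in> borel_measurable M"
    if "a \<in> borel_measurable M" "b \<in> borel_measurable M" for a b and M :: "'c measure"
    using measurable_compose[OF measurable_Pair[OF that] assms(1)] by simp
  have gm: "(\<lambda>w. g (a w) (b w)) \<in> borel_measurable M"
    if [measurable]: "a \<in> borel_measurable M" "b \<in> borel_measurable M" for a b and M :: "'c measure"
    unfolding g_def using fm[OF that] by measurable
  have gm1: "(\<lambda>u. g y u) \<in> borel_measurable borel" for y
    by (rule gm) auto
  have gm2: "(\<lambda>w. g w ((y - c * w) / s)) \<in> borel_measurable borel" for y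
    by (rule gm) auto
  have dbl: "(\<integral>\<^sup>+y. \<integral>\<^sup>+u. h y u \<partial>std_gaussian \<partial>std_gaussian) =
      (\<integral>\<^sup>+y. \<integral>\<^sup>+u. ennreal (std_normal_density y * std_normal_density u) * h y u \<partial>lborel \<partial>lborel)"
    if h: "(\<lambda>z. h (fst z) (snd z)) \<in> borel_measurable (borel \<Otimes>\<^sub>M borel)" for h :: "real \<Rightarrow> real \<Rightarrow> ennreal"
  proof -
    have h1: "(\<lambda>u. h y u) \<in> borel_measurable borel" for y
      using measurable_compose[OF _ h, of "\<lambda>u. (y, u)"] by simp
    have h2: "(\<lambda>y. \<integral>\<^sup>+u. h y u \<partial>std_gaussian) \<in> borel_measurable borel"
    proof -
      have "(\<lambda>(y, u). h y u) \<in> borel_measurable (borel \<Otimes>\<^sub>M std_gaussian)"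
        using h by (simp add: case_prod_unfold cong: measurable_cong_sets)
      then show ?thesis by (rule std.borel_measurable_nn_integral)
    qed
    have "(\<integral>\<^sup>+y. \<integral>\<^sup>+u. h y u \<partial>std_gaussian \<partial>std_gaussian) =
        (\<integral>\<^sup>+y. ennreal (std_normal_density y) * (\<integral>\<^sup>+u. ennreal (std_normal_density u) * h y u \<partial>lborel) \<partial>lborel)"
      by (subst nn_integral_std_gaussian_density[OF h2], intro nn_integral_cong, subst nn_integral_std_gaussian_density[OF h1]) simp
    also have "\<dots> = (\<integral>\<^sup>+y. \<integral>\<^sup>+u. ennreal (std_normal_density y * std_normal_density u) * h y u \<partial>lborel \<partial>lborel)"
      using h1 by (intro nn_integral_cong, subst nn_integral_cmult[symmetric])
        (auto intro!: nn_integral_cong simp: ennreal_mult mult.assoc)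
    finally show ?thesis .
  qed
  have inv: "std_normal_density y * std_normal_density u =
      std_normal_density (c * y + s * u) * std_normal_density (s * y - c * u)" for y u
  proof -
    have "(c * y + s * u)\<^sup>2 + (s * y - c * u)\<^sup>2 = (c\<^sup>2 + s\<^sup>2) * (y\<^sup>2 + u\<^sup>2)"
      by (simp add: power2_eq_square algebra_simps)
    then have *: "(c * y + s * u)\<^sup>2 + (s * y - c * u)\<^sup>2 = y\<^sup>2 + u\<^sup>2" using cs by simp
    have "std_normal_density a * std_normal_density b = exp (- (a\<^sup>2 + b\<^sup>2) / 2) / (2 * pi)" for a b
      unfolding std_normal_density_eq by (simp add: mult_exp_exp add_divide_distrib diff_divide_distrib)
    then show ?thesis using * by simp
  qed
  have "(\<integral>\<^sup>+y. \<integral>\<^sup>+u. f y u \<partial>std_gaussian \<partial>std_gaussian) = (\<integral>\<^sup>+w. \<integral>\<^sup>+z. g w z \<partial>lborel \<partial>lborel)"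
    unfolding g_def by (rule dbl) measurable
  also have "\<dots> = (\<integral>\<^sup>+w. ennreal \<bar>1 / s\<bar> * (\<integral>\<^sup>+y. g w (- (c * w / s) + (1 / s) * y) \<partial>lborel) \<partial>lborel)"
    using cs gm1 by (intro nn_integral_cong nn_integral_real_affine) auto
  also have "\<dots> = (\<integral>\<^sup>+w. \<integral>\<^sup>+y. ennreal \<bar>1 / s\<bar> * g w ((y - c * w) / s) \<partial>lborel \<partial>lborel)"
    by (intro nn_integral_cong, subst nn_integral_cmult[symmetric], rule gm)
      (auto simp: diff_divide_distrib)
  also have "\<dots> = (\<integral>\<^sup>+y. \<integral>\<^sup>+w. ennreal \<bar>1 / s\<bar> * g w ((y - c * w) / s) \<partial>lborel \<partial>lborel)"
    unfolding case_prod_unfold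
    by (rule lborel_pair.Fubini') (auto simp: case_prod_unfold intro!: gm borel_measurable_times_ennreal)
  also have "\<dots> = (\<integral>\<^sup>+y. ennreal \<bar>s\<bar> * (\<integral>\<^sup>+u. ennreal \<bar>1 / s\<bar> * g (c * y + s * u) ((y - c * (c * y + s * u)) / s) \<partial>lborel) \<partial>lborel)"
    using cs gm2 by (intro nn_integral_cong nn_integral_real_affine) auto
  also have "\<dots> = (\<integral>\<^sup>+y. \<integral>\<^sup>+u. g (c * y + s * u) (s * y - c * u) \<partial>lborel \<partial>lborel)"
  proof (intro nn_integral_cong, subst nn_integral_cmult[symmetric])
    fix y
    have e: "(y - c * (c * y + s * u)) / s = s * y - c * u" for u
    proof -
      have "y - c * (c * y + s * u) = (1 - c\<^sup>2) * y - c * s * u" by (simp add: power2_eq_square algebra_simps)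
      also have "1 - c\<^sup>2 = s\<^sup>2" using cs by simp
      finally show ?thesis using cs by (simp add: field_simps power2_eq_square)
    qed
    have "ennreal \<bar>s\<bar> * (ennreal \<bar>1 / s\<bar> * t) = t" for t
      using cs by (simp add: mult.assoc[symmetric] ennreal_mult[symmetric])
    then show "(\<integral>\<^sup>+u. ennreal \<bar>s\<bar> * (ennreal \<bar>1 / s\<bar> * g (c * y + s * u) ((y - c * (c * y + s * u)) / s)) \<partial>lborel) =
        (\<integral>\<^sup>+u. g (c * y + s * u) (s * y - c * u) \<partial>lborel)"
      unfolding e by simp
  qed (auto intro!: gm borel_measurable_times_ennreal)
  also have "\<dots> = (\<integral>\<^sup>+y. \<integral>\<^sup>+u. f (c * y + s * u) (s * y - c * u) \<partial>std_gaussian \<partial>std_gaussian)"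
    unfolding g_def inv[symmetric] by (rule dbl[symmetric], rule fm) measurable
  finally show ?thesis ..
qed

text \<open>Supplies the degenerate case of the next induction, where all other coefficients vanish
  and the rotation would have s = 0.\<close>

lemma nn_integral_std_gaussian_reflect:
  assumes [measurable]: "f \<in> borel_measurable borel"
  shows "(\<integral>\<^sup>+y. f (a * y) \<partial>std_gaussian) = (\<integral>\<^sup>+y. f (\<bar>a\<bar> * y) \<partial>std_gaussian)"
proof (cases "a \<ge> 0")
  case False
  have "(\<integral>\<^sup>+y. f (a * y) \<partial>std_gaussian) = (\<integral>\<^sup>+y. ennreal (std_normal_density y) * f (a * y) \<partial>lborel)"
    by (rule nn_integral_std_gaussian_density) simp
  also have "\<dots> = ennreal \<bar>-1\<bar> * (\<integral>\<^sup>+y. ennreal (std_normal_density (0 + (-1) * y)) * f (a * (0 + (-1) * y)) \<partial>lborel)"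
    by (rule nn_integral_real_affine) auto
  also have "\<dots> = (\<integral>\<^sup>+y. ennreal (std_normal_density y) * f (\<bar>a\<bar> * y) \<partial>lborel)"
    using False by (simp add: std_normal_density_eq)
  also have "\<dots> = (\<integral>\<^sup>+y. f (\<bar>a\<bar> * y) \<partial>std_gaussian)"
    by (rule nn_integral_std_gaussian_density[symmetric]) simp
  finally show ?thesis .
qed simp

interpretation stdP: product_prob_space "\<lambda>_. std_gaussian" UNIV ..

text \<open>Sums of independent Gaussians are Gaussian: the induction merges one more coordinate
  with the sum so far by rotating the pair onto the direction of their combined
  coefficients.\<close>

lemma nn_integral_gaussian_sum:
  assumes "finite I" and [measurable]: "f \<in> borel_measurable borel"
  shows "(\<integral>\<^sup>+x. f (\<Sum>j\<in>I. w j * x j) \<partial>(\<Pi>\<^sub>M j\<in>I. std_gaussian)) =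
    (\<integral>\<^sup>+z. f (sqrt (\<Sum>j\<in>I. (w j)\<^sup>2) * z) \<partial>std_gaussian)"
  using assms
proof (induction I arbitrary: f rule: finite_induct)
  case empty
  show ?case using std.emeasure_space_1 by (simp add: PiM_empty nn_integral_count_space_finite)
next
  case (insert i I)
  note [measurable] = insert.prems
  let ?b = "sqrt (\<Sum>j\<in>I. (w j)\<^sup>2)"
  let ?r = "sqrt ((w i)\<^sup>2 + ?b\<^sup>2)"
  have b2: "?b\<^sup>2 = (\<Sum>j\<in>I. (w j)\<^sup>2)" by (simp add: sum_nonneg)
  have "(\<integral>\<^sup>+x. f (\<Sum>j\<in>insert i I. w j * x j) \<partial>(\<Pi>\<^sub>M j\<in>insert i I. std_gaussian)) =
    (\<integral>\<^sup>+y. (\<integral>\<^sup>+x. f (\<Sum>j\<in>insert i I. w j * (x(i := y)) j) \<partial>(\<Pi>\<^sub>M j\<in>I. std_gaussian)) \<partial>std_gaussian)"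
    by (rule stdP.product_nn_integral_insert_rev) (use insert.hyps in measurable)
  also have "\<dots> = (\<integral>\<^sup>+y. (\<integral>\<^sup>+x. f (w i * y + (\<Sum>j\<in>I. w j * x j)) \<partial>(\<Pi>\<^sub>M j\<in>I. std_gaussian)) \<partial>std_gaussian)"
  proof -
    have "(\<Sum>j\<in>I. w j * (if j = i then y else x j)) = (\<Sum>j\<in>I. w j * x j)" for x y
      using insert.hyps by (intro sum.cong) auto
    then show ?thesis using insert.hyps by simp
  qed
  also have "\<dots> = (\<integral>\<^sup>+y. (\<integral>\<^sup>+z. f (w i * y + ?b * z) \<partial>std_gaussian) \<partial>std_gaussian)"
    by (intro nn_integral_cong insert.IH[of "\<lambda>t. f (w i * y + t)" for y]) measurable
  also have "\<dots> = (\<integral>\<^sup>+z. f (?r * z) \<partial>std_gaussian)"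
  proof (cases "?b = 0")
    case True
    then show ?thesis
      using nn_integral_std_gaussian_reflect[OF insert.prems, of "w i"] std.emeasure_space_1 by simp
  next
    case False
    define b r where "b = ?b" and "r = ?r"
    have b: "b \<noteq> 0" using False by (simp add: b_def)
    have r2: "r\<^sup>2 = (w i)\<^sup>2 + b\<^sup>2" by (simp add: r_def b_def sum_nonneg)
    have "r > 0" using b by (simp add: r_def b_def [symmetric] add_nonneg_pos)
    then have cs: "(w i / r)\<^sup>2 + (b / r)\<^sup>2 = 1"
      using r2 b by (simp add: power_divide add_divide_distrib [symmetric] add_nonneg_eq_0_iff)
    have "(\<integral>\<^sup>+y. (\<integral>\<^sup>+z. f (r * (w i / r * y + b / r * z)) \<partial>std_gaussian) \<partial>std_gaussian) =
       (\<integral>\<^sup>+y. (\<integral>\<^sup>+z. f (r * y) \<partial>std_gaussian) \<partial>std_gaussian)"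
      by (rule nn_integral_std_gaussian_rotation[OF _ cs, of "\<lambda>y u. f (r * y)"])
        (use b \<open>r > 0\<close> in auto)
    moreover have "r * (w i / r * y + b / r * z) = w i * y + b * z" for y z
      using \<open>r > 0\<close> by (simp add: distrib_left)
    ultimately have "(\<integral>\<^sup>+y. (\<integral>\<^sup>+z. f (w i * y + b * z) \<partial>std_gaussian) \<partial>std_gaussian) = (\<integral>\<^sup>+y. f (r * y) \<partial>std_gaussian)"
      using std.emeasure_space_1 by simp
    then show ?thesis unfolding b_def r_def .
  qed
  also have "?r = sqrt (\<Sum>j\<in>insert i I. (w j)\<^sup>2)"
    using insert.hyps b2 by simp
  finally show ?case .
qed

abbreviation gaussian_row :: "nat \<Rightarrow> (nat \<Rightarrow> real) measure" where
  "gaussian_row N \<equiv> \<Pi>\<^sub>M j\<in>{..<N}. std_gaussian"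

definition sat :: "real \<Rightarrow> nat \<Rightarrow> (nat \<Rightarrow> real) \<Rightarrow> (nat \<Rightarrow> real) \<Rightarrow> bool" where
  "sat \<kappa> N x \<sigma> \<longleftrightarrow> \<bar>\<Sum>j<N. x j * \<sigma> j\<bar> \<le> \<kappa> * sqrt (real N)"

lemma measurable_dot [measurable]: "(\<lambda>x. \<Sum>j<N. x j * \<sigma> j :: real) \<in> borel_measurable (gaussian_row N)"
  by measurable

lemma measurable_sat [measurable]: "Measurable.pred (gaussian_row N) (\<lambda>x. sat \<kappa> N x \<sigma>)"
  unfolding sat_def by measurable

lemma finite_cube [simp]: "finite (cube N)"
  by (simp add: cube_def finite_PiE)

lemma cubeD: "\<sigma> \<in> cube N \<Longrightarrow> j < N \<Longrightarrow> \<sigma> j = 1 \<or> \<sigma> j = -1"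
  by (auto simp: cube_def PiE_def Pi_def)

text \<open>Let U and V be the parts of the scalar product over agreeing and disagreeing
  coordinates. They are independent with variances N - d and d, and the two products are U + V and U
  - V. Rotating the normalised pair gives the standard form with correlation 1 - 2 d / N.\<close>

lemma emeasure_pair_sat:
  assumes "\<kappa> > 0" "N > 0" "\<sigma> \<in> cube N" "\<sigma>' \<in> cube N"
  shows "emeasure (gaussian_row N) {x \<in> space (gaussian_row N). sat \<kappa> N x \<sigma> \<and> sat \<kappa> N x \<sigma>'} =
    ennreal (q \<kappa> (real (hamming_dist N \<sigma> \<sigma>') / real N))"
proof -
  define J where "J = {i \<in> {..<N}. \<sigma> i \<noteq> \<sigma>' i}"
  define I where "I = {..<N} - J"
  have fin: "finite I" "finite J" "I \<inter> J = {}" "I \<union> J = {..<N}" by (auto simp: I_def J_def)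
  have card: "real (card I) + real (card J) = real N"
    using card_Un_disjoint[OF fin(1,2,3)] unfolding fin(4) by simp
  define d where "d = real (card J)"
  have hd: "real (hamming_dist N \<sigma> \<sigma>') = d" by (simp add: hamming_dist_def J_def d_def)
  have d: "0 \<le> d" "d \<le> N" using card by (auto simp: d_def)
  have sI: "\<sigma>' j = \<sigma> j" if "j \<in> I" for j using that by (auto simp: I_def J_def)
  have sJ: "\<sigma>' j = - \<sigma> j" if "j \<in> J" for j
    using that cubeD[OF assms(3), of j] cubeD[OF assms(4), of j] by (auto simp: J_def)
  have sq: "(\<sigma> j)\<^sup>2 = 1" if "j < N" for j using cubeD[OF assms(3) that] by auto
  define f :: "real \<Rightarrow> real \<Rightarrow> ennreal" where
    "f = (\<lambda>U V. if \<bar>U + V\<bar> \<le> \<kappa> * sqrt N \<and> \<bar>U - V\<bar> \<le> \<kappa> * sqrt N then 1 else 0)"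
  have fm: "(\<lambda>w. f (a w) (b w)) \<in> borel_measurable M"
    if [measurable]: "a \<in> borel_measurable M" "b \<in> borel_measurable M" for a b and M :: "'c measure"
    unfolding f_def by measurable
  have dots: "(\<Sum>j<N. x j * \<sigma> j) = (\<Sum>j\<in>I. \<sigma> j * x j) + (\<Sum>j\<in>J. \<sigma> j * x j)"
    "(\<Sum>j<N. x j * \<sigma>' j) = (\<Sum>j\<in>I. \<sigma> j * x j) - (\<Sum>j\<in>J. \<sigma> j * x j)" for x
  proof -
    have u: "(\<Sum>j<N. x j * \<tau> j) = (\<Sum>j\<in>I. x j * \<tau> j) + (\<Sum>j\<in>J. x j * \<tau> j)" for \<tau>
      using sum.union_disjoint[OF fin(1,2,3), of "\<lambda>j. x j * \<tau> j"] unfolding fin(4) .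
    have "(\<Sum>j\<in>I. x j * \<sigma>' j) = (\<Sum>j\<in>I. \<sigma> j * x j)"
      by (intro sum.cong refl) (simp add: sI)
    moreover have "(\<Sum>j\<in>J. x j * \<sigma>' j) = - (\<Sum>j\<in>J. \<sigma> j * x j)"
      unfolding sum_negf[symmetric] by (intro sum.cong refl) (simp add: sJ)
    moreover have "(\<Sum>j\<in>A. x j * \<sigma> j) = (\<Sum>j\<in>A. \<sigma> j * x j)" for A
      by (intro sum.cong refl) simp
    ultimately show "(\<Sum>j<N. x j * \<sigma> j) = (\<Sum>j\<in>I. \<sigma> j * x j) + (\<Sum>j\<in>J. \<sigma> j * x j)"
      "(\<Sum>j<N. x j * \<sigma>' j) = (\<Sum>j\<in>I. \<sigma> j * x j) - (\<Sum>j\<in>J. \<sigma> j * x j)"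
      unfolding u by simp_all
  qed
  have "emeasure (gaussian_row N) {x \<in> space (gaussian_row N). sat \<kappa> N x \<sigma> \<and> sat \<kappa> N x \<sigma>'} =
      (\<integral>\<^sup>+x. indicator {x \<in> space (gaussian_row N). sat \<kappa> N x \<sigma> \<and> sat \<kappa> N x \<sigma>'} x \<partial>gaussian_row N)"
    by (subst nn_integral_indicator) auto
  also have "\<dots> = (\<integral>\<^sup>+x. f (\<Sum>j\<in>I. \<sigma> j * x j) (\<Sum>j\<in>J. \<sigma> j * x j) \<partial>gaussian_row N)"
    by (intro nn_integral_cong) (auto simp: f_def sat_def dots)
  also have "\<dots> = (\<integral>\<^sup>+x. f (\<Sum>j\<in>I. \<sigma> j * x j) (\<Sum>j\<in>J. \<sigma> j * x j) \<partial>(\<Pi>\<^sub>M j\<in>I \<union> J. std_gaussian))"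
    by (simp only: fin(4))
  also have "\<dots> = (\<integral>\<^sup>+x. (\<integral>\<^sup>+y. f (\<Sum>j\<in>I. \<sigma> j * merge I J (x, y) j) (\<Sum>j\<in>J. \<sigma> j * merge I J (x, y) j)
      \<partial>(\<Pi>\<^sub>M j\<in>J. std_gaussian)) \<partial>(\<Pi>\<^sub>M j\<in>I. std_gaussian))"
    by (rule stdP.product_nn_integral_fold[OF fin(3,1,2)]) (rule fm; measurable)
  also have "\<dots> = (\<integral>\<^sup>+x. (\<integral>\<^sup>+y. f (\<Sum>j\<in>I. \<sigma> j * x j) (\<Sum>j\<in>J. \<sigma> j * y j)
      \<partial>(\<Pi>\<^sub>M j\<in>J. std_gaussian)) \<partial>(\<Pi>\<^sub>M j\<in>I. std_gaussian))"
    using fin(3) by (intro nn_integral_cong arg_cong2[where f = f] sum.cong) (auto simp: merge_def)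
  also have "\<dots> = (\<integral>\<^sup>+x. (\<integral>\<^sup>+v. f (\<Sum>j\<in>I. \<sigma> j * x j) (sqrt (\<Sum>j\<in>J. (\<sigma> j)\<^sup>2) * v)
      \<partial>std_gaussian) \<partial>(\<Pi>\<^sub>M j\<in>I. std_gaussian))"
    by (intro nn_integral_cong nn_integral_gaussian_sum fin fm) auto
  also have "\<dots> = (\<integral>\<^sup>+u. (\<integral>\<^sup>+v. f (sqrt (\<Sum>j\<in>I. (\<sigma> j)\<^sup>2) * u) (sqrt (\<Sum>j\<in>J. (\<sigma> j)\<^sup>2) * v)
      \<partial>std_gaussian) \<partial>std_gaussian)"
  proof (rule nn_integral_gaussian_sum[OF fin(1), of "\<lambda>U. \<integral>\<^sup>+v. f U (sqrt (\<Sum>j\<in>J. (\<sigma> j)\<^sup>2) * v) \<partial>std_gaussian"])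
    have "(\<lambda>z. f (fst z) (sqrt (\<Sum>j\<in>J. (\<sigma> j)\<^sup>2) * snd z)) \<in> borel_measurable (borel \<Otimes>\<^sub>M std_gaussian)"
      by (rule fm) measurable
    then show "(\<lambda>U. \<integral>\<^sup>+v. f U (sqrt (\<Sum>j\<in>J. (\<sigma> j)\<^sup>2) * v) \<partial>std_gaussian) \<in> borel_measurable borel"
      using std.borel_measurable_nn_integral[of "\<lambda>U v. f U (sqrt (\<Sum>j\<in>J. (\<sigma> j)\<^sup>2) * v)" borel]
      by (simp add: case_prod_unfold)
  qed
  also have "(\<Sum>j\<in>I. (\<sigma> j)\<^sup>2) = real N - d" using sq fin card by (simp add: I_def d_def)
  also have "(\<Sum>j\<in>J. (\<sigma> j)\<^sup>2) = d" using sq by (simp add: J_def d_def)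
  finally have main: "emeasure (gaussian_row N) {x \<in> space (gaussian_row N). sat \<kappa> N x \<sigma> \<and> sat \<kappa> N x \<sigma>'} =
    (\<integral>\<^sup>+u. \<integral>\<^sup>+v. f (sqrt (real N - d) * u) (sqrt d * v) \<partial>std_gaussian \<partial>std_gaussian)" .
  have N: "sqrt (real N) > 0" using assms by simp
  show ?thesis
  proof (cases "d = 0")
    case True
    have "f (sqrt (real N) * u) 0 = indicator {z. \<bar>z\<bar> \<le> \<kappa>} u" for u
      using N by (simp add: f_def abs_mult mult.commute[of \<kappa>])
    then have "(\<integral>\<^sup>+u. \<integral>\<^sup>+v. f (sqrt (real N - d) * u) (sqrt d * v) \<partial>std_gaussian \<partial>std_gaussian) =
        emeasure std_gaussian {z. \<bar>z\<bar> \<le> \<kappa>}"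
      using True std.emeasure_space_1 by simp
    also have "\<dots> = ennreal (p \<kappa>)" by (simp add: p_def std.emeasure_eq_measure)
    also have "p \<kappa> = q \<kappa> 0" using q_endpoints[of "-1" \<kappa>] by simp
    finally show ?thesis using main True hd by simp
  next
    case False
    define c s \<rho> where "c = sqrt ((real N - d) / N)" and "s = sqrt (d / N)" and "\<rho> = 1 - 2 * (d / N)"
    have c2: "c\<^sup>2 = (real N - d) / N" and s2: "s\<^sup>2 = d / N" using d by (auto simp: c_def s_def)
    have cs: "c\<^sup>2 + s\<^sup>2 = 1" using assms unfolding c2 s2 by (simp add: field_simps)
    have s0: "s \<noteq> 0" using False assms by (simp add: s_def)
    have \<rho>: "\<rho> = c\<^sup>2 - s\<^sup>2" using cs by (simp add: \<rho>_def s2)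
    have "1 - \<rho>\<^sup>2 = (c\<^sup>2 + s\<^sup>2)\<^sup>2 - (c\<^sup>2 - s\<^sup>2)\<^sup>2" using cs by (simp add: \<rho>)
    also have "\<dots> = (2 * c * s)\<^sup>2" by (simp add: power2_eq_square algebra_simps)
    finally have root: "sqrt (1 - \<rho>\<^sup>2) = 2 * c * s" using d by (simp add: c_def s_def)
    have f_eq: "f (sqrt (real N - d) * u) (sqrt d * v) = indicator (corr_box \<kappa> \<rho>) (c * u + s * v, s * u - c * v)" for u v
    proof -
      have e1: "sqrt (real N - d) = sqrt N * c" "sqrt d = sqrt N * s"
        using assms d by (simp_all add: c_def s_def real_sqrt_mult[symmetric])
      have "\<rho> * (c * u + s * v) + sqrt (1 - \<rho>\<^sup>2) * (s * u - c * v) = (c\<^sup>2 + s\<^sup>2) * (c * u - s * v)"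
        unfolding root unfolding \<rho> by (simp add: power2_eq_square algebra_simps)
      then have e2: "\<rho> * (c * u + s * v) + sqrt (1 - \<rho>\<^sup>2) * (s * u - c * v) = c * u - s * v" using cs by simp
      have "\<bar>sqrt N * t\<bar> \<le> \<kappa> * sqrt N \<longleftrightarrow> \<bar>t\<bar> \<le> \<kappa>" for t
        using N by (simp add: abs_mult mult.commute[of \<kappa>])
      from this[of "c * u + s * v"] this[of "c * u - s * v"] show ?thesis
        unfolding f_def e1 corr_box_def indicator_def mem_Collect_eq fst_conv snd_conv e2
        by (simp add: algebra_simps)
    qed
    have im: "(\<lambda>z. indicator (corr_box \<kappa> \<rho>) (fst z, snd z) :: ennreal) \<in> borel_measurable (borel \<Otimes>\<^sub>M borel)"
      using corr_box_sets(2)[of \<kappa> \<rho>] by simp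
    have "(\<integral>\<^sup>+u. \<integral>\<^sup>+v. f (sqrt (real N - d) * u) (sqrt d * v) \<partial>std_gaussian \<partial>std_gaussian) =
        (\<integral>\<^sup>+u. \<integral>\<^sup>+v. indicator (corr_box \<kappa> \<rho>) (u, v) \<partial>std_gaussian \<partial>std_gaussian)"
      unfolding f_eq by (rule nn_integral_std_gaussian_rotation[OF im cs s0])
    also have "\<dots> = (\<integral>\<^sup>+u. emeasure std_gaussian (Pair u -` corr_box \<kappa> \<rho>) \<partial>std_gaussian)"
    proof (intro nn_integral_cong)
      fix u
      have "Pair u -` corr_box \<kappa> \<rho> \<in> sets std_gaussian" by (rule sets_Pair1[OF corr_box_sets(1)])
      moreover have "(\<lambda>v. indicator (corr_box \<kappa> \<rho>) (u, v) :: ennreal) = indicator (Pair u -` corr_box \<kappa> \<rho>)"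
        by (auto simp: indicator_def)
      ultimately show "(\<integral>\<^sup>+v. indicator (corr_box \<kappa> \<rho>) (u, v) \<partial>std_gaussian) = emeasure std_gaussian (Pair u -` corr_box \<kappa> \<rho>)"
        by (simp only: nn_integral_indicator)
    qed
    also have "\<dots> = emeasure (std_gaussian \<Otimes>\<^sub>M std_gaussian) (corr_box \<kappa> \<rho>)"
      by (rule std.emeasure_pair_measure_alt[OF corr_box_sets(1), symmetric])
    also have "\<dots> = ennreal (q \<kappa> ((1 + \<rho>) / 2))"
      by (simp add: q_eq_measure std2.P.emeasure_eq_measure)
    also have "q \<kappa> ((1 + \<rho>) / 2) = q \<kappa> (1 - d / N)" by (simp add: \<rho>_def diff_divide_distrib)
    also have "\<dots> = q \<kappa> (d / N)" by (rule q_bounds(5)) (use d assms in \<open>auto simp: divide_le_eq\<close>)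
    finally show ?thesis using main hd by simp
  qed
qed

section \<open>The effect of one new constraint\<close>

lemma prob_space_gaussian_row: "prob_space (gaussian_row N)"
  by (intro prob_space_PiM prob_space_std_gaussian)

interpretation row: prob_space "gaussian_row N" for N
  by (rule prob_space_gaussian_row)

lemma distr_gaussian_sum:
  "distr (gaussian_row N) borel (\<lambda>x. \<Sum>j<N. w j * x j) =
    distr std_gaussian borel (\<lambda>z. sqrt (\<Sum>j<N. (w j)\<^sup>2) * z)"
proof (rule measure_eqI)
  fix A assume "A \<in> sets (distr (gaussian_row N) borel (\<lambda>x. \<Sum>j<N. w j * x j))"
  then have A [measurable]: "A \<in> sets borel" by simp
  have "emeasure (distr (gaussian_row N) borel (\<lambda>x. \<Sum>j<N. w j * x j)) A =
      (\<integral>\<^sup>+x. indicator A (\<Sum>j<N. w j * x j) \<partial>gaussian_row N)"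
    by (subst nn_integral_indicator[symmetric], simp, subst nn_integral_distr) auto
  also have "\<dots> = (\<integral>\<^sup>+z. indicator A (sqrt (\<Sum>j<N. (w j)\<^sup>2) * z) \<partial>std_gaussian)"
    by (rule nn_integral_gaussian_sum) auto
  also have "\<dots> = emeasure (distr std_gaussian borel (\<lambda>z. sqrt (\<Sum>j<N. (w j)\<^sup>2) * z)) A"
    by (subst nn_integral_indicator[symmetric], simp, subst nn_integral_distr) auto
  finally show "emeasure (distr (gaussian_row N) borel (\<lambda>x. \<Sum>j<N. w j * x j)) A =
    emeasure (distr std_gaussian borel (\<lambda>z. sqrt (\<Sum>j<N. (w j)\<^sup>2) * z)) A" .
qed simp

lemma integral_cos_std_gaussian: "(\<integral>z. cos (t * z) \<partial>std_gaussian) = exp (- t\<^sup>2 / 2)"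
proof -
  have i: "integrable std_gaussian (\<lambda>z. iexp (t * z))"
    by (rule std.integrable_const_bound[where B = 1]) auto
  have "exp (- t\<^sup>2 / 2) = Re (char std_gaussian t)"
    using char_std_normal_distribution by simp
  also have "\<dots> = (\<integral>z. Re (iexp (t * z)) \<partial>std_gaussian)"
    unfolding char_def by (rule integral_Re[OF i, symmetric])
  also have "\<dots> = (\<integral>z. cos (t * z) \<partial>std_gaussian)"
    by (intro Bochner_Integration.integral_cong refl) (simp add: Re_exp)
  finally show ?thesis ..
qed

lemma integral_cos_row: "(\<integral>x. cos (\<Sum>j<N. w j * x j) \<partial>gaussian_row N) = exp (- (\<Sum>j<N. (w j)\<^sup>2) / 2)"
proof -
  have "(\<integral>x. cos (\<Sum>j<N. w j * x j) \<partial>gaussian_row N) =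
      (\<integral>y. cos y \<partial>distr (gaussian_row N) borel (\<lambda>x. \<Sum>j<N. w j * x j))"
    by (subst integral_distr) auto
  also have "\<dots> = (\<integral>z. cos (sqrt (\<Sum>j<N. (w j)\<^sup>2) * z) \<partial>std_gaussian)"
    unfolding distr_gaussian_sum by (subst integral_distr) auto
  finally show ?thesis by (simp add: integral_cos_std_gaussian sum_nonneg)
qed

section \<open>Cosine moments of projections of a Gaussian row\<close>

definition proj :: "nat \<Rightarrow> (nat \<Rightarrow> real) \<Rightarrow> (nat \<Rightarrow> real) \<Rightarrow> real" where
  "proj N \<sigma> x = (\<Sum>j<N. x j * \<sigma> j) / sqrt (real N)"

text \<open>The correlation of the two projections under a Gaussian row; for vectors of the cube
  each projection is standard Gaussian.\<close>

definition overlap :: "nat \<Rightarrow> (nat \<Rightarrow> real) \<Rightarrow> (nat \<Rightarrow> real) \<Rightarrow> real" where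
  "overlap N \<sigma> \<tau> = (\<Sum>j<N. \<sigma> j * \<tau> j) / real N"

lemma measurable_proj [measurable]: "proj N \<sigma> \<in> borel_measurable (gaussian_row N)"
  unfolding proj_def [abs_def] by measurable

lemma integral_cos_combination:
  assumes "N > 0" "\<sigma>1 \<in> cube N" "\<sigma>2 \<in> cube N" "\<sigma>3 \<in> cube N" "\<sigma>4 \<in> cube N"
  shows "(\<integral>x. cos (a * (u * proj N \<sigma>1 x) + b * (u * proj N \<sigma>2 x) + c * (u * proj N \<sigma>3 x) + d * (u * proj N \<sigma>4 x)) \<partial>gaussian_row N) =
    exp (- u\<^sup>2 / 2 * (a\<^sup>2 + b\<^sup>2 + c\<^sup>2 + d\<^sup>2 + 2 * (a * b * overlap N \<sigma>1 \<sigma>2 + a * c * overlap N \<sigma>1 \<sigma>3 +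
      a * d * overlap N \<sigma>1 \<sigma>4 + b * c * overlap N \<sigma>2 \<sigma>3 + b * d * overlap N \<sigma>2 \<sigma>4 + c * d * overlap N \<sigma>3 \<sigma>4)))"
proof -
  define w where "w = (\<lambda>j. u / sqrt N * (a * \<sigma>1 j + b * \<sigma>2 j + c * \<sigma>3 j + d * \<sigma>4 j))"
  have N: "real N > 0" using assms by simp
  have lin: "a * (u * proj N \<sigma>1 x) + b * (u * proj N \<sigma>2 x) + c * (u * proj N \<sigma>3 x) + d * (u * proj N \<sigma>4 x) = (\<Sum>j<N. w j * x j)" for x
    by (simp add: w_def proj_def sum_distrib_left sum_divide_distrib sum.distrib[symmetric] algebra_simps add_divide_distrib)
  have sq: "(\<tau> j)\<^sup>2 = 1" if "\<tau> \<in> cube N" "j < N" for \<tau> j using cubeD[OF that] by auto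
  have "(\<Sum>j<N. (w j)\<^sup>2) = (\<Sum>j<N. u\<^sup>2 / N * (a\<^sup>2 + b\<^sup>2 + c\<^sup>2 + d\<^sup>2 + 2 * (a * b * (\<sigma>1 j * \<sigma>2 j) + a * c * (\<sigma>1 j * \<sigma>3 j) +
      a * d * (\<sigma>1 j * \<sigma>4 j) + b * c * (\<sigma>2 j * \<sigma>3 j) + b * d * (\<sigma>2 j * \<sigma>4 j) + c * d * (\<sigma>3 j * \<sigma>4 j))))"
  proof (intro sum.cong refl)
    fix j assume "j \<in> {..<N}"
    then have s: "(\<sigma>1 j)\<^sup>2 = 1" "(\<sigma>2 j)\<^sup>2 = 1" "(\<sigma>3 j)\<^sup>2 = 1" "(\<sigma>4 j)\<^sup>2 = 1" using sq assms by auto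
    have "(w j)\<^sup>2 = u\<^sup>2 / N * (a * \<sigma>1 j + b * \<sigma>2 j + c * \<sigma>3 j + d * \<sigma>4 j)\<^sup>2"
      by (simp add: w_def power_mult_distrib power_divide)
    also have "(a * \<sigma>1 j + b * \<sigma>2 j + c * \<sigma>3 j + d * \<sigma>4 j)\<^sup>2 = a\<^sup>2 * (\<sigma>1 j)\<^sup>2 + b\<^sup>2 * (\<sigma>2 j)\<^sup>2 + c\<^sup>2 * (\<sigma>3 j)\<^sup>2 + d\<^sup>2 * (\<sigma>4 j)\<^sup>2 +
      2 * (a * b * (\<sigma>1 j * \<sigma>2 j) + a * c * (\<sigma>1 j * \<sigma>3 j) +
      a * d * (\<sigma>1 j * \<sigma>4 j) + b * c * (\<sigma>2 j * \<sigma>3 j) + b * d * (\<sigma>2 j * \<sigma>4 j) + c * d * (\<sigma>3 j * \<sigma>4 j))"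
      by algebra
    finally show "(w j)\<^sup>2 = u\<^sup>2 / N * (a\<^sup>2 + b\<^sup>2 + c\<^sup>2 + d\<^sup>2 + 2 * (a * b * (\<sigma>1 j * \<sigma>2 j) + a * c * (\<sigma>1 j * \<sigma>3 j) +
      a * d * (\<sigma>1 j * \<sigma>4 j) + b * c * (\<sigma>2 j * \<sigma>3 j) + b * d * (\<sigma>2 j * \<sigma>4 j) + c * d * (\<sigma>3 j * \<sigma>4 j)))"
      by (simp only: s mult_1_right)
  qed
  also have "\<dots> = u\<^sup>2 / N * (N * (a\<^sup>2 + b\<^sup>2 + c\<^sup>2 + d\<^sup>2) + 2 * (a * b * (\<Sum>j<N. \<sigma>1 j * \<sigma>2 j) + a * c * (\<Sum>j<N. \<sigma>1 j * \<sigma>3 j) +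
      a * d * (\<Sum>j<N. \<sigma>1 j * \<sigma>4 j) + b * c * (\<Sum>j<N. \<sigma>2 j * \<sigma>3 j) + b * d * (\<Sum>j<N. \<sigma>2 j * \<sigma>4 j) + c * d * (\<Sum>j<N. \<sigma>3 j * \<sigma>4 j)))"
    by (simp only: sum_distrib_left[symmetric] sum.distrib sum_constant card_lessThan) (simp add: algebra_simps)
  also have "\<dots> = u\<^sup>2 * (a\<^sup>2 + b\<^sup>2 + c\<^sup>2 + d\<^sup>2 + 2 * (a * b * overlap N \<sigma>1 \<sigma>2 + a * c * overlap N \<sigma>1 \<sigma>3 +
      a * d * overlap N \<sigma>1 \<sigma>4 + b * c * overlap N \<sigma>2 \<sigma>3 + b * d * overlap N \<sigma>2 \<sigma>4 + c * d * overlap N \<sigma>3 \<sigma>4))"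
    using N by (simp add: overlap_def field_simps)
  finally show ?thesis unfolding lin integral_cos_row by simp
qed

definition exp_rem :: "real \<Rightarrow> real" where
  "exp_rem z = exp (- z) - (1 - z + z\<^sup>2 / 2)"

lemma exp_rem_bound: assumes "\<bar>z\<bar> \<le> y" shows "\<bar>exp_rem z\<bar> \<le> y ^ 3 * exp y"
proof -
  obtain t where t: "\<bar>t\<bar> \<le> \<bar>- z\<bar>" "exp (- z) = (\<Sum>m<3. ((- z) ^ m) / fact m) + (exp t / fact 3) * (- z) ^ 3"
    using Maclaurin_exp_le by blast
  then have "exp_rem z = (exp t / 6) * (- z) ^ 3"
    by (simp add: exp_rem_def eval_nat_numeral)
  then have "\<bar>exp_rem z\<bar> = exp t / 6 * \<bar>z\<bar> ^ 3" by (simp add: abs_mult power_abs)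
  also have "\<dots> \<le> exp y * y ^ 3"
  proof (intro mult_mono power_mono)
    have "exp t \<le> exp y" using t(1) assms by simp
    then show "exp t / 6 \<le> exp y" using exp_gt_zero[of t] by linarith
  qed (use assms in auto)
  finally show ?thesis by (simp add: mult.commute)
qed

text \<open>Averages of exp (- (sum over i < j of s_i s_j x_ij)) over signs s_i, with s_1 = 1. For
  x_ij equal to u^2 times the overlaps these are the expected products of two, three and four
  cosines, divided by the matching power of the mean of one cosine.\<close>

definition T2 :: "real \<Rightarrow> real" where "T2 x = (exp (- x) + exp (- (- x))) / 2"
definition T3 :: "real \<Rightarrow> real \<Rightarrow> real \<Rightarrow> real" where
  "T3 x y z = (exp (- (x + y + z)) + exp (- (x - y - z)) + exp (- (- x + y - z)) + exp (- (- x - y + z))) / 4"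
definition T4 :: "real \<Rightarrow> real \<Rightarrow> real \<Rightarrow> real \<Rightarrow> real \<Rightarrow> real \<Rightarrow> real" where
  "T4 x12 x13 x14 x23 x24 x34 =
    (exp (- (x12 + x13 + x14 + x23 + x24 + x34)) + exp (- (x12 + x13 - x14 + x23 - x24 - x34)) +
     exp (- (x12 - x13 + x14 - x23 + x24 - x34)) + exp (- (x12 - x13 - x14 - x23 - x24 + x34)) +
     exp (- (- x12 + x13 + x14 - x23 - x24 + x34)) + exp (- (- x12 + x13 - x14 - x23 + x24 - x34)) +
     exp (- (- x12 - x13 + x14 + x23 - x24 - x34)) + exp (- (- x12 - x13 - x14 + x23 + x24 + x34))) / 8"

text \<open>The second-order Taylor terms cancel by inclusion-exclusion, since no graph with at most two
  edges, counted with the signs averaged, covers four vertices.\<close>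

lemma inclusion_exclusion_bound:
  assumes "\<bar>x12\<bar> \<le> y" "\<bar>x13\<bar> \<le> y" "\<bar>x14\<bar> \<le> y" "\<bar>x23\<bar> \<le> y" "\<bar>x24\<bar> \<le> y" "\<bar>x34\<bar> \<le> y"
  shows "\<bar>T4 x12 x13 x14 x23 x24 x34 - (T3 x12 x13 x23 + T3 x12 x14 x24 + T3 x13 x14 x34 + T3 x23 x24 x34)
    + (T2 x12 + T2 x13 + T2 x14 + T2 x23 + T2 x24 + T2 x34) - 3\<bar> \<le> 11 * ((6 * y) ^ 3 * exp (6 * y))"
proof -
  let ?M = "(6 * y) ^ 3 * exp (6 * y)"
  have r: "\<bar>exp_rem z\<bar> \<le> ?M" if "\<bar>z\<bar> \<le> 6 * y" for z by (rule exp_rem_bound[OF that])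
  have y: "0 \<le> y" using assms(1) by linarith
  have e: "exp (- z) = exp_rem z + 1 - z + z\<^sup>2 / 2" for z by (simp add: exp_rem_def)
  have t2: "\<bar>T2 x - (1 + x\<^sup>2 / 2)\<bar> \<le> ?M" if "\<bar>x\<bar> \<le> y" for x
  proof -
    have "T2 x - (1 + x\<^sup>2 / 2) = (exp_rem x + exp_rem (- x)) / 2"
      unfolding T2_def e by (simp add: field_simps)
    then show ?thesis using r[of x] r[of "- x"] that y by simp
  qed
  have t3: "\<bar>T3 x x' x'' - (1 + (x\<^sup>2 + x'\<^sup>2 + x''\<^sup>2) / 2)\<bar> \<le> ?M" if "\<bar>x\<bar> \<le> y" "\<bar>x'\<bar> \<le> y" "\<bar>x''\<bar> \<le> y" for x x' x''
  proof -
    have eq: "T3 x x' x'' - (1 + (x\<^sup>2 + x'\<^sup>2 + x''\<^sup>2) / 2) =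
      (exp_rem (x + x' + x'') + exp_rem (x - x' - x'') + exp_rem (- x + x' - x'') + exp_rem (- x - x' + x'')) / 4"
      unfolding T3_def e by (simp add: field_simps power2_eq_square)
    have "\<bar>x + x' + x''\<bar> \<le> 6 * y" "\<bar>x - x' - x''\<bar> \<le> 6 * y" "\<bar>- x + x' - x''\<bar> \<le> 6 * y"
      "\<bar>- x - x' + x''\<bar> \<le> 6 * y"
      using that y by (auto simp: abs_le_iff)
    note this[THEN r]
    then show ?thesis unfolding eq by (auto simp: abs_le_iff)
  qed
  have t4: "\<bar>T4 x12 x13 x14 x23 x24 x34 - (1 + (x12\<^sup>2 + x13\<^sup>2 + x14\<^sup>2 + x23\<^sup>2 + x24\<^sup>2 + x34\<^sup>2) / 2)\<bar> \<le> ?M"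
  proof -
    let ?z1 = "x12 + x13 + x14 + x23 + x24 + x34" let ?z2 = "x12 + x13 - x14 + x23 - x24 - x34"
    let ?z3 = "x12 - x13 + x14 - x23 + x24 - x34" let ?z4 = "x12 - x13 - x14 - x23 - x24 + x34"
    let ?z5 = "- x12 + x13 + x14 - x23 - x24 + x34" let ?z6 = "- x12 + x13 - x14 - x23 + x24 - x34"
    let ?z7 = "- x12 - x13 + x14 + x23 - x24 - x34" let ?z8 = "- x12 - x13 - x14 + x23 + x24 + x34"
    have eq: "T4 x12 x13 x14 x23 x24 x34 - (1 + (x12\<^sup>2 + x13\<^sup>2 + x14\<^sup>2 + x23\<^sup>2 + x24\<^sup>2 + x34\<^sup>2) / 2) =
      (exp_rem ?z1 + exp_rem ?z2 + exp_rem ?z3 + exp_rem ?z4 + exp_rem ?z5 + exp_rem ?z6 + exp_rem ?z7 + exp_rem ?z8) / 8"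
      unfolding T4_def e by (simp add: field_simps power2_eq_square)
    have "\<bar>?z1\<bar> \<le> 6 * y" "\<bar>?z2\<bar> \<le> 6 * y" "\<bar>?z3\<bar> \<le> 6 * y" "\<bar>?z4\<bar> \<le> 6 * y"
      "\<bar>?z5\<bar> \<le> 6 * y" "\<bar>?z6\<bar> \<le> 6 * y" "\<bar>?z7\<bar> \<le> 6 * y" "\<bar>?z8\<bar> \<le> 6 * y"
      using assms by (auto simp: abs_le_iff)
    note this[THEN r]
    then show ?thesis unfolding eq by (auto simp: abs_le_iff)
  qed
  define M where "M = ?M"
  define s where "s = (\<lambda>x::real. x\<^sup>2 / 2)"
  have t3': "\<bar>T3 x x' x'' - (1 + s x + s x' + s x'')\<bar> \<le> M" if "\<bar>x\<bar> \<le> y" "\<bar>x'\<bar> \<le> y" "\<bar>x''\<bar> \<le> y" for x x' x''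
    using t3[OF that] by (simp only: M_def s_def add_divide_distrib add.assoc)
  have t2': "\<bar>T2 x - (1 + s x)\<bar> \<le> M" if "\<bar>x\<bar> \<le> y" for x
    using t2[OF that] by (simp only: M_def s_def)
  have t4': "\<bar>T4 x12 x13 x14 x23 x24 x34 - (1 + s x12 + s x13 + s x14 + s x23 + s x24 + s x34)\<bar> \<le> M"
    using t4 by (simp only: M_def s_def add_divide_distrib add.assoc)
  \<comment> \<open>Replace each of the eleven averages by 1 plus half the sum of its squares, at
    cost M each. Everything cancels: the constants give 1 - 4 + 6 - 3, and each square occurs once
    in \<open>T4\<close>, in two of the \<open>T3\<close> and in one \<open>T2\<close>.\<close>
  show ?thesis
    using t4' t3'[OF assms(1,2,4)] t3'[OF assms(1,3,5)] t3'[OF assms(2,3,6)] t3'[OF assms(4,5,6)]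
      assms[THEN t2']
    unfolding M_def[symmetric] abs_le_iff by linarith
qed

lemma integrable_row_bounded:
  assumes "f \<in> borel_measurable (gaussian_row N)" "\<And>x. \<bar>f x\<bar> \<le> (B::real)"
  shows "integrable (gaussian_row N) f"
  by (rule row.integrable_const_bound[where B = B]) (use assms in auto)

lemma abs_mult_le_one: "\<bar>a\<bar> \<le> 1 \<Longrightarrow> \<bar>b\<bar> \<le> 1 \<Longrightarrow> \<bar>a * b\<bar> \<le> (1::real)"
  by (simp add: abs_mult mult_le_one)

context
  fixes N :: nat and u :: real
  assumes N: "N > 0"
begin

abbreviation (input) "co \<sigma> x \<equiv> cos (u * proj N \<sigma> x)"
abbreviation (input) "cu \<equiv> exp (- u\<^sup>2 / 2)"
abbreviation (input) "ov \<sigma> \<tau> \<equiv> u\<^sup>2 * overlap N \<sigma> \<tau>"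

lemma co_integral1:
  assumes "\<sigma> \<in> cube N"
  shows "(\<integral>x. co \<sigma> x \<partial>gaussian_row N) = cu"
  using integral_cos_combination[OF N assms assms assms assms, of 1 u 0 0 0] by simp

text \<open>Product-to-sum formulas express the product as an average of cosines of sums with signs,
  each of which has an explicit Gaussian integral; the cases of three and four factors work in the
  same way.\<close>

lemma co_integral2:
  assumes "\<sigma>1 \<in> cube N" "\<sigma>2 \<in> cube N"
  shows "(\<integral>x. co \<sigma>1 x * co \<sigma>2 x \<partial>gaussian_row N) = cu ^ 2 * T2 (ov \<sigma>1 \<sigma>2)"
proof -
  define k where "k = (\<lambda>b x. cos (u * proj N \<sigma>1 x + b * (u * proj N \<sigma>2 x)))"
  have K: "(\<integral>x. k b x \<partial>gaussian_row N) = cu ^ 2 * exp (- (b * ov \<sigma>1 \<sigma>2))" if "b\<^sup>2 = 1" for b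
  proof -
    have "cu ^ 2 = exp (- u\<^sup>2)" by (simp flip: exp_of_nat_mult)
    then show ?thesis
      using integral_cos_combination[OF N assms(1,2,1,1), of 1 u b 0 0] that
      unfolding k_def by (simp add: mult_exp_exp algebra_simps)
  qed
  have i: "integrable (gaussian_row N) (k b)" for b
    unfolding k_def by (rule integrable_row_bounded[where B = 1]) auto
  have pt: "co \<sigma>1 x * co \<sigma>2 x = (k 1 x + k (-1) x) / 2" for x
    unfolding k_def by (simp add: cos_add cos_diff)
  show ?thesis unfolding pt
    using K[of 1] K[of "-1"] by (simp add: i T2_def algebra_simps)
qed

lemma co_integral3:
  assumes "\<sigma>1 \<in> cube N" "\<sigma>2 \<in> cube N" "\<sigma>3 \<in> cube N"
  shows "(\<integral>x. co \<sigma>1 x * co \<sigma>2 x * co \<sigma>3 x \<partial>gaussian_row N) = cu ^ 3 * T3 (ov \<sigma>1 \<sigma>2) (ov \<sigma>1 \<sigma>3) (ov \<sigma>2 \<sigma>3)"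
proof -
  define k where "k = (\<lambda>b c x. cos (u * proj N \<sigma>1 x + b * (u * proj N \<sigma>2 x) + c * (u * proj N \<sigma>3 x)))"
  have K: "(\<integral>x. k b c x \<partial>gaussian_row N) = cu ^ 3 * exp (- (b * ov \<sigma>1 \<sigma>2 + c * ov \<sigma>1 \<sigma>3 + b * c * ov \<sigma>2 \<sigma>3))"
    if "b\<^sup>2 = 1" "c\<^sup>2 = 1" for b c
  proof -
    have "cu ^ 3 = exp (- (3 / 2) * u\<^sup>2)" by (simp flip: exp_of_nat_mult)
    then show ?thesis
      using integral_cos_combination[OF N assms(1,2,3,1), of 1 u b c 0] that
      unfolding k_def by (simp add: mult_exp_exp algebra_simps)
  qed
  have i: "integrable (gaussian_row N) (k b c)" for b c
    unfolding k_def by (rule integrable_row_bounded[where B = 1]) auto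
  have pt: "co \<sigma>1 x * co \<sigma>2 x * co \<sigma>3 x = (k 1 1 x + k 1 (-1) x + k (-1) 1 x + k (-1) (-1) x) / 4" for x
    unfolding k_def by (simp add: cos_add cos_diff sin_add sin_diff algebra_simps)
  show ?thesis unfolding pt
    using K[of 1 1] K[of 1 "-1"] K[of "-1" 1] K[of "-1" "-1"]
    by (simp add: i T3_def algebra_simps)
qed

lemma co_integral4:
  assumes "\<sigma>1 \<in> cube N" "\<sigma>2 \<in> cube N" "\<sigma>3 \<in> cube N" "\<sigma>4 \<in> cube N"
  shows "(\<integral>x. co \<sigma>1 x * co \<sigma>2 x * co \<sigma>3 x * co \<sigma>4 x \<partial>gaussian_row N) =
    cu ^ 4 * T4 (ov \<sigma>1 \<sigma>2) (ov \<sigma>1 \<sigma>3) (ov \<sigma>1 \<sigma>4) (ov \<sigma>2 \<sigma>3) (ov \<sigma>2 \<sigma>4) (ov \<sigma>3 \<sigma>4)"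
proof -
  define k where "k = (\<lambda>b c d x. cos (u * proj N \<sigma>1 x + b * (u * proj N \<sigma>2 x) + c * (u * proj N \<sigma>3 x) + d * (u * proj N \<sigma>4 x)))"
  have K: "(\<integral>x. k b c d x \<partial>gaussian_row N) = cu ^ 4 * exp (- (b * ov \<sigma>1 \<sigma>2 + c * ov \<sigma>1 \<sigma>3 + d * ov \<sigma>1 \<sigma>4 + b * c * ov \<sigma>2 \<sigma>3 + b * d * ov \<sigma>2 \<sigma>4 + c * d * ov \<sigma>3 \<sigma>4))"
    if "b\<^sup>2 = 1" "c\<^sup>2 = 1" "d\<^sup>2 = 1" for b c d
  proof -
    have "cu ^ 4 = exp (- 2 * u\<^sup>2)" by (simp flip: exp_of_nat_mult)
    then show ?thesis
      using integral_cos_combination[OF N assms, of 1 u b c d] that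
      unfolding k_def by (simp add: mult_exp_exp algebra_simps)
  qed
  have i: "integrable (gaussian_row N) (k b c d)" for b c d
    unfolding k_def by (rule integrable_row_bounded[where B = 1]) auto
  have pt: "co \<sigma>1 x * co \<sigma>2 x * co \<sigma>3 x * co \<sigma>4 x =
      (k 1 1 1 x + k 1 1 (-1) x + k 1 (-1) 1 x + k 1 (-1) (-1) x + k (-1) 1 1 x + k (-1) 1 (-1) x + k (-1) (-1) 1 x + k (-1) (-1) (-1) x) / 8" for x
    unfolding k_def by (simp add: cos_add cos_diff sin_add sin_diff algebra_simps)
  show ?thesis unfolding pt
    using K[of 1 1 1] K[of 1 1 "-1"] K[of 1 "-1" 1] K[of 1 "-1" "-1"] K[of "-1" 1 1] K[of "-1" 1 "-1"] K[of "-1" "-1" 1] K[of "-1" "-1" "-1"]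
    by (simp add: i T4_def algebra_simps)
qed

text \<open>Expanding the product gives the fourth power of the mean times the inclusion-exclusion
  combination, hence order \<eta>^3. The bound is uniform in the frequency u, over which it is later
  averaged. The constant is 11 * 6^3 * 6, the last factor bounding u^6 exp (- u^2).\<close>

lemma centred_fourth_moment:
  assumes "\<sigma>1 \<in> cube N" "\<sigma>2 \<in> cube N" "\<sigma>3 \<in> cube N" "\<sigma>4 \<in> cube N"
    and o: "\<bar>overlap N \<sigma>1 \<sigma>2\<bar> \<le> \<eta>" "\<bar>overlap N \<sigma>1 \<sigma>3\<bar> \<le> \<eta>" "\<bar>overlap N \<sigma>1 \<sigma>4\<bar> \<le> \<eta>"
      "\<bar>overlap N \<sigma>2 \<sigma>3\<bar> \<le> \<eta>" "\<bar>overlap N \<sigma>2 \<sigma>4\<bar> \<le> \<eta>" "\<bar>overlap N \<sigma>3 \<sigma>4\<bar> \<le> \<eta>"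
    and \<eta>: "\<eta> \<le> 1/6"
  shows "\<bar>\<integral>x. (co \<sigma>1 x - cu) * (co \<sigma>2 x - cu) * (co \<sigma>3 x - cu) * (co \<sigma>4 x - cu) \<partial>gaussian_row N\<bar> \<le> 14256 * \<eta> ^ 3"
proof -
  let ?Q = "T4 (ov \<sigma>1 \<sigma>2) (ov \<sigma>1 \<sigma>3) (ov \<sigma>1 \<sigma>4) (ov \<sigma>2 \<sigma>3) (ov \<sigma>2 \<sigma>4) (ov \<sigma>3 \<sigma>4)
    - (T3 (ov \<sigma>1 \<sigma>2) (ov \<sigma>1 \<sigma>3) (ov \<sigma>2 \<sigma>3) + T3 (ov \<sigma>1 \<sigma>2) (ov \<sigma>1 \<sigma>4) (ov \<sigma>2 \<sigma>4)
      + T3 (ov \<sigma>1 \<sigma>3) (ov \<sigma>1 \<sigma>4) (ov \<sigma>3 \<sigma>4) + T3 (ov \<sigma>2 \<sigma>3) (ov \<sigma>2 \<sigma>4) (ov \<sigma>3 \<sigma>4))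
    + (T2 (ov \<sigma>1 \<sigma>2) + T2 (ov \<sigma>1 \<sigma>3) + T2 (ov \<sigma>1 \<sigma>4) + T2 (ov \<sigma>2 \<sigma>3) + T2 (ov \<sigma>2 \<sigma>4) + T2 (ov \<sigma>3 \<sigma>4)) - 3"
  have \<eta>0: "0 \<le> \<eta>" using o(1) by linarith
  have i1: "integrable (gaussian_row N) (\<lambda>x. co a x)" for a
    by (rule integrable_row_bounded[where B = 1]) auto
  have i2: "integrable (gaussian_row N) (\<lambda>x. co a x * co b x)" for a b
    by (rule integrable_row_bounded[where B = 1]) (auto intro!: abs_mult_le_one)
  have i3: "integrable (gaussian_row N) (\<lambda>x. co a x * co b x * co c x)" for a b c
    by (rule integrable_row_bounded[where B = 1]) (auto intro!: abs_mult_le_one)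
  have i4: "integrable (gaussian_row N) (\<lambda>x. co a x * co b x * co c x * co d x)" for a b c d
    by (rule integrable_row_bounded[where B = 1]) (auto intro!: abs_mult_le_one)
  have ex: "(A - k) * (B - k) * (C - k) * (D - k) = A * B * C * D
     + (- k) * (A * B * C) + (- k) * (A * B * D) + (- k) * (A * C * D) + (- k) * (B * C * D)
     + k\<^sup>2 * (A * B) + k\<^sup>2 * (A * C) + k\<^sup>2 * (A * D) + k\<^sup>2 * (B * C) + k\<^sup>2 * (B * D) + k\<^sup>2 * (C * D)
     + (- (k ^ 3)) * A + (- (k ^ 3)) * B + (- (k ^ 3)) * C + (- (k ^ 3)) * D + k ^ 4" for A B C D k :: real
    by algebra
  have "(\<integral>x. (co \<sigma>1 x - cu) * (co \<sigma>2 x - cu) * (co \<sigma>3 x - cu) * (co \<sigma>4 x - cu) \<partial>gaussian_row N) =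
    (\<integral>x. co \<sigma>1 x * co \<sigma>2 x * co \<sigma>3 x * co \<sigma>4 x \<partial>gaussian_row N)
     + (- cu) * (\<integral>x. co \<sigma>1 x * co \<sigma>2 x * co \<sigma>3 x \<partial>gaussian_row N) + (- cu) * (\<integral>x. co \<sigma>1 x * co \<sigma>2 x * co \<sigma>4 x \<partial>gaussian_row N)
     + (- cu) * (\<integral>x. co \<sigma>1 x * co \<sigma>3 x * co \<sigma>4 x \<partial>gaussian_row N) + (- cu) * (\<integral>x. co \<sigma>2 x * co \<sigma>3 x * co \<sigma>4 x \<partial>gaussian_row N)
     + cu\<^sup>2 * (\<integral>x. co \<sigma>1 x * co \<sigma>2 x \<partial>gaussian_row N) + cu\<^sup>2 * (\<integral>x. co \<sigma>1 x * co \<sigma>3 x \<partial>gaussian_row N)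
     + cu\<^sup>2 * (\<integral>x. co \<sigma>1 x * co \<sigma>4 x \<partial>gaussian_row N) + cu\<^sup>2 * (\<integral>x. co \<sigma>2 x * co \<sigma>3 x \<partial>gaussian_row N)
     + cu\<^sup>2 * (\<integral>x. co \<sigma>2 x * co \<sigma>4 x \<partial>gaussian_row N) + cu\<^sup>2 * (\<integral>x. co \<sigma>3 x * co \<sigma>4 x \<partial>gaussian_row N)
     + (- (cu ^ 3)) * (\<integral>x. co \<sigma>1 x \<partial>gaussian_row N) + (- (cu ^ 3)) * (\<integral>x. co \<sigma>2 x \<partial>gaussian_row N)
     + (- (cu ^ 3)) * (\<integral>x. co \<sigma>3 x \<partial>gaussian_row N) + (- (cu ^ 3)) * (\<integral>x. co \<sigma>4 x \<partial>gaussian_row N) + cu ^ 4"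
    unfolding ex
    by (simp only: Bochner_Integration.integral_add Bochner_Integration.integrable_add integral_mult_right_zero
        integrable_mult_right i1 i2 i3 i4 row.integrable_const)
      (simp add: row.prob_space)
  also have "\<dots> = cu ^ 4 * ?Q"
    unfolding co_integral4[OF assms(1-4)] co_integral3[OF assms(1,2,3)] co_integral3[OF assms(1,2,4)]
      co_integral3[OF assms(1,3,4)] co_integral3[OF assms(2,3,4)] co_integral2[OF assms(1,2)] co_integral2[OF assms(1,3)]
      co_integral2[OF assms(1,4)] co_integral2[OF assms(2,3)] co_integral2[OF assms(2,4)] co_integral2[OF assms(3,4)]
      co_integral1[OF assms(1)] co_integral1[OF assms(2)] co_integral1[OF assms(3)] co_integral1[OF assms(4)]
    by algebra
  finally have eq: "(\<integral>x. (co \<sigma>1 x - cu) * (co \<sigma>2 x - cu) * (co \<sigma>3 x - cu) * (co \<sigma>4 x - cu) \<partial>gaussian_row N) = cu ^ 4 * ?Q" .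
  have y: "\<bar>u\<^sup>2 * t\<bar> \<le> u\<^sup>2 * \<eta>" if "\<bar>t\<bar> \<le> \<eta>" for t
    using that by (simp add: abs_mult mult_left_mono)
  have Q: "\<bar>?Q\<bar> \<le> 11 * ((6 * (u\<^sup>2 * \<eta>)) ^ 3 * exp (6 * (u\<^sup>2 * \<eta>)))"
    by (rule inclusion_exclusion_bound) (intro y o)+
  \<comment> \<open>\<eta> \<le> 1/6 limits the growth to exp (u^2). The fourth power of the mean is
    exp (- 2 u^2), so exp (- u^2) is left to absorb u^6.\<close>
  have e6: "exp (6 * (u\<^sup>2 * \<eta>)) \<le> exp (u\<^sup>2)"
    using mult_left_mono[OF \<eta>, of "u\<^sup>2"] by simp
  have "\<bar>cu ^ 4 * ?Q\<bar> = cu ^ 4 * \<bar>?Q\<bar>" by (simp add: abs_mult)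
  also have "\<dots> \<le> cu ^ 4 * (11 * ((6 * (u\<^sup>2 * \<eta>)) ^ 3 * exp (u\<^sup>2)))"
    by (intro mult_left_mono order_trans[OF Q] mult_left_mono e6) (use \<eta>0 in auto)
  also have "\<dots> = 2376 * \<eta> ^ 3 * ((u\<^sup>2) ^ 3 * (cu ^ 4 * exp (u\<^sup>2)))"
    by (simp add: power_mult_distrib)
  also have "cu ^ 4 * exp (u\<^sup>2) = exp (- u\<^sup>2)"
    by (simp add: mult_exp_exp flip: exp_of_nat_mult)
  also have "(u\<^sup>2) ^ 3 * exp (- u\<^sup>2) \<le> 6"
  proof -
    have "(u\<^sup>2) ^ 3 / 6 \<le> (\<Sum>k<4. (u\<^sup>2) ^ k / fact k)" by (simp add: eval_nat_numeral)
    also have "\<dots> \<le> exp (u\<^sup>2)" by (rule exp_ge_partial_sum) simp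
    finally show ?thesis by (simp add: exp_minus field_simps)
  qed
  then have "2376 * \<eta> ^ 3 * ((u\<^sup>2) ^ 3 * exp (- u\<^sup>2)) \<le> 2376 * \<eta> ^ 3 * 6"
    using \<eta>0 by (intro mult_left_mono) auto
  finally show ?thesis unfolding eq by simp
qed

end

section \<open>Pairs of solutions\<close>

abbreviation rows :: "nat \<Rightarrow> nat \<Rightarrow> (nat \<Rightarrow> nat \<Rightarrow> real) measure" where
  "rows N t \<equiv> \<Pi>\<^sub>M i\<in>{..<t}. gaussian_row N"

text \<open>The number t of rows is a separate argument so that rows can be revealed one at a time;
  only the rows below t are inspected.\<close>

definition sols :: "real \<Rightarrow> nat \<Rightarrow> nat \<Rightarrow> (nat \<Rightarrow> nat \<Rightarrow> real) \<Rightarrow> (nat \<Rightarrow> real) set" where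
  "sols \<kappa> N t X = {\<sigma> \<in> cube N. \<forall>i<t. sat \<kappa> N (X i) \<sigma>}"

lemma sols_subset: "sols \<kappa> N t X \<subseteq> cube N"
  by (auto simp: sols_def)

lemma finite_sols [simp]: "finite (sols \<kappa> N t X)"
  using finite_subset[OF sols_subset finite_cube] .

lemma prob_space_rows: "prob_space (rows N t)"
  by (intro prob_space_PiM prob_space_std_gaussian)

lemma measurable_sat_component [measurable]:
  assumes "i < t" shows "Measurable.pred (rows N t) (\<lambda>X. sat \<kappa> N (X i) \<sigma>)"
  using measurable_compose[OF measurable_component_singleton[of i "{..<t}" "\<lambda>_. gaussian_row N"] measurable_sat] assms
  by simp

lemma measurable_in_sols [measurable]: "Measurable.pred (rows N t) (\<lambda>X. \<sigma> \<in> sols \<kappa> N t X)"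
proof -
  have "Measurable.pred (rows N t) (\<lambda>X. \<forall>i\<in>{..<t}. sat \<kappa> N (X i) \<sigma>)"
    by (rule pred_intros_finite) (auto intro: measurable_sat_component)
  then show ?thesis by (cases "\<sigma> \<in> cube N") (auto simp: sols_def Ball_def)
qed

lemma card_eq_sum: "finite A \<Longrightarrow> real (card {x\<in>A. P x}) = (\<Sum>x\<in>A. if P x then 1 else 0)"
  by (simp add: sum.If_cases Int_def conj_commute)

lemma ennreal_card_eq_sum: "finite A \<Longrightarrow> ennreal (real (card {x\<in>A. P x})) = (\<Sum>x\<in>A. if P x then 1 else 0)"
  by (simp add: sum.If_cases Int_def conj_commute ennreal_of_nat_eq_real_of_nat)

lemma PiM_Collect_eq_PiE:
  "{X \<in> space (PiM I M). \<forall>i\<in>I. P (X i)} = (\<Pi>\<^sub>E i\<in>I. {x \<in> space (M i). P x})"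
  by (auto simp: space_PiM PiE_iff extensional_def)

lemma emeasure_rows_pair:
  assumes "\<kappa> > 0" "N > 0" "\<sigma> \<in> cube N" "\<tau> \<in> cube N"
  shows "emeasure (rows N t) {X \<in> space (rows N t). \<sigma> \<in> sols \<kappa> N t X \<and> \<tau> \<in> sols \<kappa> N t X} =
    ennreal (q \<kappa> (real (hamming_dist N \<sigma> \<tau>) / real N) ^ t)"
proof -
  interpret R: product_prob_space "\<lambda>_. gaussian_row N" UNIV
    by (intro product_prob_spaceI prob_space_PiM prob_space_std_gaussian)
  let ?A = "{x \<in> space (gaussian_row N). sat \<kappa> N x \<sigma> \<and> sat \<kappa> N x \<tau>}"
  have "{X \<in> space (rows N t). \<sigma> \<in> sols \<kappa> N t X \<and> \<tau> \<in> sols \<kappa> N t X} = Pi\<^sub>E {..<t} (\<lambda>_. ?A)"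
    using assms(3,4) unfolding PiM_Collect_eq_PiE[symmetric] by (auto simp: sols_def)
  then have "emeasure (rows N t) {X \<in> space (rows N t). \<sigma> \<in> sols \<kappa> N t X \<and> \<tau> \<in> sols \<kappa> N t X} =
      emeasure (rows N t) (Pi\<^sub>E {..<t} (\<lambda>_. ?A))" by simp
  also have "\<dots> = (\<Prod>i<t. emeasure (gaussian_row N) ?A)"
    by (rule R.emeasure_PiM) auto
  also have "\<dots> = ennreal (q \<kappa> (real (hamming_dist N \<sigma> \<tau>) / real N)) ^ t"
    unfolding emeasure_pair_sat[OF assms] by simp
  also have "\<dots> = ennreal (q \<kappa> (real (hamming_dist N \<sigma> \<tau>) / real N) ^ t)"
    by (simp add: ennreal_power q_def)
  finally show ?thesis .
qed

lemma nn_integral_card_pairs: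
  assumes "\<kappa> > 0" "N > 0"
  shows "(\<integral>\<^sup>+X. ennreal (real (card {(\<sigma>, \<tau>) \<in> sols \<kappa> N t X \<times> sols \<kappa> N t X. P \<sigma> \<tau>})) \<partial>rows N t) =
    ennreal (\<Sum>\<sigma>\<in>cube N. \<Sum>\<tau>\<in>cube N. if P \<sigma> \<tau> then q \<kappa> (real (hamming_dist N \<sigma> \<tau>) / real N) ^ t else 0)"
proof -
  have e: "ennreal (real (card {(\<sigma>, \<tau>) \<in> sols \<kappa> N t X \<times> sols \<kappa> N t X. P \<sigma> \<tau>})) =
      (\<Sum>\<sigma>\<in>cube N. \<Sum>\<tau>\<in>cube N. if P \<sigma> \<tau> then (if \<sigma> \<in> sols \<kappa> N t X \<and> \<tau> \<in> sols \<kappa> N t X then 1 else 0) else 0)" for X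
  proof -
    have "{(\<sigma>, \<tau>) \<in> sols \<kappa> N t X \<times> sols \<kappa> N t X. P \<sigma> \<tau>} =
        {z \<in> cube N \<times> cube N. P (fst z) (snd z) \<and> fst z \<in> sols \<kappa> N t X \<and> snd z \<in> sols \<kappa> N t X}"
      using sols_subset by force
    then have "ennreal (real (card {(\<sigma>, \<tau>) \<in> sols \<kappa> N t X \<times> sols \<kappa> N t X. P \<sigma> \<tau>})) =
        (\<Sum>z\<in>cube N \<times> cube N. if P (fst z) (snd z) \<and> fst z \<in> sols \<kappa> N t X \<and> snd z \<in> sols \<kappa> N t X then 1 else 0)"
      by (simp only:, subst ennreal_card_eq_sum) auto
    also have "\<dots> = (\<Sum>\<sigma>\<in>cube N. \<Sum>\<tau>\<in>cube N. if P \<sigma> \<tau> then (if \<sigma> \<in> sols \<kappa> N t X \<and> \<tau> \<in> sols \<kappa> N t X then 1 else 0) else 0)"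
      unfolding sum.cartesian_product by (intro sum.cong refl) auto
    finally show ?thesis .
  qed
  have qnn: "0 \<le> q \<kappa> \<beta>" for \<beta> by (simp add: q_def)
  have "(\<integral>\<^sup>+X. (if \<sigma> \<in> sols \<kappa> N t X \<and> \<tau> \<in> sols \<kappa> N t X then 1 else 0) \<partial>rows N t) =
      ennreal (q \<kappa> (real (hamming_dist N \<sigma> \<tau>) / real N) ^ t)" if "\<sigma> \<in> cube N" "\<tau> \<in> cube N" for \<sigma> \<tau>
  proof -
    have "(\<integral>\<^sup>+X. (if \<sigma> \<in> sols \<kappa> N t X \<and> \<tau> \<in> sols \<kappa> N t X then 1 else 0) \<partial>rows N t) =
        (\<integral>\<^sup>+X. indicator {X \<in> space (rows N t). \<sigma> \<in> sols \<kappa> N t X \<and> \<tau> \<in> sols \<kappa> N t X} X \<partial>rows N t)"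
      by (intro nn_integral_cong) (simp add: indicator_def)
    also have "\<dots> = emeasure (rows N t) {X \<in> space (rows N t). \<sigma> \<in> sols \<kappa> N t X \<and> \<tau> \<in> sols \<kappa> N t X}"
      by (rule nn_integral_indicator) measurable
    finally show ?thesis unfolding emeasure_rows_pair[OF assms that] .
  qed
  then have t: "(\<integral>\<^sup>+X. (if P \<sigma> \<tau> then (if \<sigma> \<in> sols \<kappa> N t X \<and> \<tau> \<in> sols \<kappa> N t X then 1 else 0) else 0) \<partial>rows N t) =
      ennreal (if P \<sigma> \<tau> then q \<kappa> (real (hamming_dist N \<sigma> \<tau>) / real N) ^ t else 0)" if "\<sigma> \<in> cube N" "\<tau> \<in> cube N" for \<sigma> \<tau>
    using that by auto
  show ?thesis
    unfolding e
    by (simp add: nn_integral_sum t qnn sum_nonneg sum_ennreal)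
qed

text \<open>The set of flipped coordinates identifies the cube, seen from \<sigma>, with the power
  set of the coordinates.\<close>

lemma sum_cube_hamming:
  assumes "\<sigma> \<in> cube N"
  shows "(\<Sum>\<tau>\<in>cube N. f (hamming_dist N \<sigma> \<tau>)) = (\<Sum>d\<le>N. real (N choose d) * f d)"
proof -
  let ?U = "{..<N}"
  let ?b = "\<lambda>\<tau>. {i \<in> ?U. \<sigma> i \<noteq> \<tau> i}"
  let ?c = "\<lambda>A. (\<lambda>i\<in>?U. if i \<in> A then - \<sigma> i else \<sigma> i)"
  have bij: "bij_betw ?b (cube N) (Pow ?U)"
  proof (rule bij_betw_byWitness[where f' = ?c])
    show "\<forall>\<tau>\<in>cube N. ?c (?b \<tau>) = \<tau>"
    proof
      fix \<tau> assume t: "\<tau> \<in> cube N"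
      show "?c (?b \<tau>) = \<tau>"
      proof
        fix i
        show "?c (?b \<tau>) i = \<tau> i"
        proof (cases "i < N")
          case True
          then show ?thesis using cubeD[OF t True] cubeD[OF assms True] by auto
        next
          case False
          then show ?thesis using t by (auto simp: cube_def PiE_def extensional_def)
        qed
      qed
    qed
    show "\<forall>A\<in>Pow ?U. ?b (?c A) = A"
    proof
      fix A assume "A \<in> Pow ?U"
      moreover have "\<sigma> i \<noteq> - \<sigma> i" if "i < N" for i using cubeD[OF assms that] by auto
      ultimately show "?b (?c A) = A" by auto
    qed
    show "?c ` Pow ?U \<subseteq> cube N" using cubeD[OF assms] by (fastforce simp: cube_def)
  qed auto
  have "(\<Sum>\<tau>\<in>cube N. f (hamming_dist N \<sigma> \<tau>)) = (\<Sum>\<tau>\<in>cube N. f (card (?b \<tau>)))"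
    by (simp add: hamming_dist_def)
  also have "\<dots> = (\<Sum>A\<in>Pow ?U. f (card A))"
    using sum.reindex_bij_betw[OF bij, of "\<lambda>A. f (card A)"] .
  also have "\<dots> = (\<Sum>d\<le>N. \<Sum>A\<in>{A \<in> Pow ?U. card A = d}. f (card A))"
    by (rule sum.group[symmetric]) (auto intro: card_mono[of ?U, simplified])
  also have "\<dots> = (\<Sum>d\<le>N. real (N choose d) * f d)"
  proof (intro sum.cong refl)
    fix d
    have "(\<Sum>A\<in>{A \<in> Pow ?U. card A = d}. f (card A)) = (\<Sum>A\<in>{A. A \<subseteq> ?U \<and> card A = d}. f d)"
      by (intro sum.cong) auto
    also have "\<dots> = real (N choose d) * f d" using n_subsets[of ?U d] by simp
    finally show "(\<Sum>A\<in>{A \<in> Pow ?U. card A = d}. f (card A)) = real (N choose d) * f d" .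
  qed
  finally show ?thesis .
qed

lemma card_cube: "real (card (cube N)) = 2 ^ N"
proof -
  have "card (cube N) = 2 ^ N" by (simp add: cube_def card_PiE numeral_2_eq_2)
  then show ?thesis by simp
qed

lemma hamming_le: "hamming_dist N \<sigma> \<tau> \<le> N"
proof -
  have "{i \<in> {..<N}. \<sigma> i \<noteq> \<tau> i} \<subseteq> {..<N}" by auto
  from card_mono[OF _ this] show ?thesis unfolding hamming_dist_def by simp
qed

lemma hamming_self [simp]: "hamming_dist N \<sigma> \<sigma> = 0"
  by (simp add: hamming_dist_def)

text \<open>A single term of the binomial expansion of (x + (1 - x))^N is at most 1; take x = d /
  N.\<close>

lemma binomial_le_exp_entropy:
  assumes "d \<le> N" "N > 0"
  shows "real (N choose d) \<le> exp (real N * entropy (real d / real N))"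
proof (cases "d = 0 \<or> d = N")
  case True
  then show ?thesis using assms by (auto simp: entropy_def)
next
  case False
  define x where "x = real d / real N"
  have x: "0 < x" "x < 1" using False assms by (auto simp: x_def)
  have "real (N choose d) * x ^ d * (1 - x) ^ (N - d) \<le> (\<Sum>k\<le>N. real (N choose k) * x ^ k * (1 - x) ^ (N - k))"
    by (rule member_le_sum) (use x assms in auto)
  also have "\<dots> = (x + (1 - x)) ^ N" by (rule binomial_ring[symmetric])
  also have "\<dots> = 1" by simp
  finally have "real (N choose d) * (x ^ d * (1 - x) ^ (N - d)) \<le> 1" by (simp add: mult.assoc)
  moreover have "x ^ d * (1 - x) ^ (N - d) = exp (- (real N * entropy x))"
  proof -
    have "x ^ d = exp (real d * ln x)" using x by (simp add: exp_of_nat_mult)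
    moreover have "(1 - x) ^ (N - d) = exp (real (N - d) * ln (1 - x))" using x by (simp add: exp_of_nat_mult)
    moreover have "real d = real N * x" "real (N - d) = real N * (1 - x)"
      using assms by (auto simp: x_def of_nat_diff field_simps)
    ultimately show ?thesis by (simp add: mult_exp_exp entropy_def algebra_simps)
  qed
  ultimately have "real (N choose d) * exp (- (real N * entropy x)) \<le> 1" by simp
  then show ?thesis unfolding x_def[symmetric] exp_minus by (simp add: field_simps)
qed

lemma num_constraints_le: "\<alpha> > 0 \<Longrightarrow> real (num_constraints \<alpha> N) \<le> \<alpha> * real N"
  unfolding num_constraints_def by (simp add: of_nat_floor)

lemma num_constraints_ge: "\<alpha> * real N - 1 \<le> real (num_constraints \<alpha> N)"
  unfolding num_constraints_def by linarith

definition mean_sols :: "real \<Rightarrow> nat \<Rightarrow> nat \<Rightarrow> real" where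
  "mean_sols \<kappa> N t = 2 ^ N * p \<kappa> ^ t"

lemma sum_pairs_hamming:
  "(\<Sum>\<sigma>\<in>cube N. \<Sum>\<tau>\<in>cube N. f (hamming_dist N \<sigma> \<tau>)) = 2 ^ N * (\<Sum>d\<le>N. real (N choose d) * f d)"
  using sum_cube_hamming[of _ N f] by (simp add: card_cube)

section \<open>Expected numbers of correlated pairs and of close pairs\<close>

context frozen_regime
begin

text \<open>Relative to the squared mean, distance d contributes at most exp (N H(\<beta>) + t ln (q
  / P^2) - N ln 2). As q \<ge> P^2, this grows with t, so t may be raised to \<alpha> N, where the
  exponent is N (F(\<beta>) - F(1/2)). Thus one rate c serves all intermediate numbers of
  rows.\<close>

lemma bad_pair_expectation:
  obtains c where "c > 0"
    "\<And>N t \<eta>. N > 0 \<Longrightarrow> t \<le> num_constraints \<alpha> N \<Longrightarrow> 0 \<le> \<eta> \<Longrightarrow>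
      (\<integral>\<^sup>+X. ennreal (real (card {(\<sigma>, \<tau>) \<in> sols \<kappa> N t X \<times> sols \<kappa> N t X.
          \<eta> < \<bar>1 - 2 * (real (hamming_dist N \<sigma> \<tau>) / real N)\<bar>})) \<partial>rows N t)
        \<le> ennreal (real (N + 1) * exp (- c * real N * \<eta>\<^sup>2) * (mean_sols \<kappa> N t)\<^sup>2)"
proof -
  obtain c where c: "c > 0" "\<And>\<beta>. 0 \<le> \<beta> \<Longrightarrow> \<beta> \<le> 1 \<Longrightarrow> \<phi> \<beta> \<le> \<phi> (1/2) - c * (2 * \<beta> - 1)\<^sup>2"
    by (fact F_quadratic_gap)
  show ?thesis
  proof (rule that[OF c(1)])
    fix N t :: nat and \<eta> :: real assume N: "N > 0" and t: "t \<le> num_constraints \<alpha> N" and \<eta>: "0 \<le> \<eta>"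
    let ?f = "\<lambda>d. if \<eta> < \<bar>1 - 2 * (real d / real N)\<bar> then q \<kappa> (real d / real N) ^ t else 0"
    have term_le: "real (N choose d) * ?f d \<le> exp (- c * real N * \<eta>\<^sup>2) * (2 ^ N * (P ^ t)\<^sup>2)" if d: "d \<le> N" for d
    proof (cases "\<eta> < \<bar>1 - 2 * (real d / real N)\<bar>")
      case True
      define \<beta> where "\<beta> = real d / real N"
      have \<beta>: "0 \<le> \<beta>" "\<beta> \<le> 1" using d N by (auto simp: \<beta>_def)
      have qb: "0 < q \<kappa> \<beta>" "P\<^sup>2 \<le> q \<kappa> \<beta>" using q_bounds(1,2)[OF \<kappa>_pos \<beta>] by auto
      have l: "0 \<le> ln (q \<kappa> \<beta>) - 2 * ln P"
      proof -
        have "ln (P\<^sup>2) \<le> ln (q \<kappa> \<beta>)" using qb P_pos by (intro ln_mono) auto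
        then show ?thesis using P_pos by (simp add: ln_realpow)
      qed
      have "real t \<le> \<alpha> * real N" using t num_constraints_le[OF \<alpha>_pos, of N] by linarith
      then have tl: "real t * (ln (q \<kappa> \<beta>) - 2 * ln P) \<le> \<alpha> * real N * (ln (q \<kappa> \<beta>) - 2 * ln P)"
        by (rule mult_right_mono[OF _ l])
      have "\<eta>\<^sup>2 \<le> (2 * \<beta> - 1)\<^sup>2"
        using power_mono[of \<eta> "\<bar>1 - 2 * \<beta>\<bar>" 2] True \<eta> by (simp add: \<beta>_def power2_commute)
      then have "c * \<eta>\<^sup>2 \<le> c * (2 * \<beta> - 1)\<^sup>2" using c(1) by (intro mult_left_mono) auto
      then have "\<phi> \<beta> - \<phi> (1/2) \<le> - c * \<eta>\<^sup>2" using c(2)[OF \<beta>] by simp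
      then have gap: "real N * (\<phi> \<beta> - \<phi> (1/2)) \<le> real N * (- c * \<eta>\<^sup>2)" by (intro mult_left_mono) auto
      have "real (N choose d) * ?f d = real (N choose d) * exp (real t * ln (q \<kappa> \<beta>))"
        using True qb by (simp add: \<beta>_def exp_of_nat_mult)
      also have "\<dots> \<le> exp (real N * entropy \<beta>) * exp (real t * ln (q \<kappa> \<beta>))"
        using binomial_le_exp_entropy[OF d N] by (intro mult_right_mono) (auto simp: \<beta>_def)
      also have "\<dots> = exp (real N * entropy \<beta> + real t * (ln (q \<kappa> \<beta>) - 2 * ln P) - real N * ln 2) * (exp (real N * ln 2) * exp (2 * (real t * ln P)))"
        by (simp add: mult_exp_exp algebra_simps)
      also have "exp (real N * ln 2) * exp (2 * (real t * ln P)) = 2 ^ N * (P ^ t)\<^sup>2"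
      proof -
        have "exp (2 * (real t * ln P)) = (exp (real t * ln P))\<^sup>2" by (simp flip: exp_of_nat_mult)
        then show ?thesis using P_pos by (simp add: exp_of_nat_mult)
      qed
      also have "exp (real N * entropy \<beta> + real t * (ln (q \<kappa> \<beta>) - 2 * ln P) - real N * ln 2) \<le> exp (- c * real N * \<eta>\<^sup>2)"
      proof -
        have "real N * entropy \<beta> + \<alpha> * real N * (ln (q \<kappa> \<beta>) - 2 * ln P) - real N * ln 2 = real N * (\<phi> \<beta> - \<phi> (1/2))"
          by (simp add: F_half[OF \<kappa>_pos]) (simp add: F_def algebra_simps)
        then show ?thesis using tl gap by (simp add: algebra_simps)
      qed
      finally show ?thesis by (simp add: mult_right_mono)
    next
      case False
      then show ?thesis by simp
    qed
    have "(\<Sum>\<sigma>\<in>cube N. \<Sum>\<tau>\<in>cube N. ?f (hamming_dist N \<sigma> \<tau>)) = 2 ^ N * (\<Sum>d\<le>N. real (N choose d) * ?f d)"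
      by (rule sum_pairs_hamming)
    also have "\<dots> \<le> 2 ^ N * (\<Sum>d\<le>N. exp (- c * real N * \<eta>\<^sup>2) * (2 ^ N * (P ^ t)\<^sup>2))"
      by (intro mult_left_mono sum_mono term_le) auto
    also have "\<dots> = real (N + 1) * exp (- c * real N * \<eta>\<^sup>2) * (mean_sols \<kappa> N t)\<^sup>2"
      by (simp add: mean_sols_def power_mult_distrib power2_eq_square)
    finally show "(\<integral>\<^sup>+X. ennreal (real (card {(\<sigma>, \<tau>) \<in> sols \<kappa> N t X \<times> sols \<kappa> N t X.
          \<eta> < \<bar>1 - 2 * (real (hamming_dist N \<sigma> \<tau>) / real N)\<bar>})) \<partial>rows N t)
        \<le> ennreal (real (N + 1) * exp (- c * real N * \<eta>\<^sup>2) * (mean_sols \<kappa> N t)\<^sup>2)"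
      unfolding nn_integral_card_pairs[OF \<kappa>_pos N] by (rule ennreal_leI)
  qed
qed

text \<open>Now the comparison is with the mean itself and the exponent is N (F(\<beta>) - \<alpha>
  ln P). Since q \<le> P, rounding \<alpha> N down goes in the unfavourable direction; less than one
  row is lost and q / P \<ge> P, which costs the factor 1 / P.\<close>

lemma close_pair_expectation:
  assumes "\<delta> \<in> {0<..<beta_c \<kappa> \<alpha>}"
  obtains c where "c > 0"
    "\<And>N. N > 0 \<Longrightarrow>
      (\<integral>\<^sup>+X. ennreal (real (card {(\<sigma>, \<tau>) \<in> sols \<kappa> N (num_constraints \<alpha> N) X \<times> sols \<kappa> N (num_constraints \<alpha> N) X.
          0 < hamming_dist N \<sigma> \<tau> \<and> real (hamming_dist N \<sigma> \<tau>) \<le> (beta_c \<kappa> \<alpha> - \<delta>) * real N})) \<partial>rows N (num_constraints \<alpha> N))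
        \<le> ennreal (real (N + 1) / P * exp (- c * sqrt (real N)) * mean_sols \<kappa> N (num_constraints \<alpha> N))"
proof -
  let ?bc = "beta_c \<kappa> \<alpha>"
  from beta_c_props(3)[OF assms] obtain c where c: "c > 0"
    "\<And>\<beta>. 0 < \<beta> \<Longrightarrow> \<beta> \<le> ?bc - \<delta> \<Longrightarrow> \<phi> \<beta> \<le> \<alpha> * ln P - c * sqrt \<beta>" by auto
  show ?thesis
  proof (rule that[OF c(1)])
    fix N :: nat assume N: "N > 0"
    let ?t = "num_constraints \<alpha> N"
    let ?f = "\<lambda>d. if 0 < d \<and> real d \<le> (?bc - \<delta>) * real N then q \<kappa> (real d / real N) ^ ?t else 0"
    have term_le: "real (N choose d) * ?f d \<le> exp (- c * sqrt (real N)) / P * P ^ ?t" if d: "d \<le> N" for d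
    proof (cases "0 < d \<and> real d \<le> (?bc - \<delta>) * real N")
      case True
      define \<beta> where "\<beta> = real d / real N"
      have \<beta>: "0 < \<beta>" "\<beta> \<le> 1" "\<beta> \<le> ?bc - \<delta>" using d N True by (auto simp: \<beta>_def field_simps)
      have qb: "0 < q \<kappa> \<beta>" "P\<^sup>2 \<le> q \<kappa> \<beta>" "q \<kappa> \<beta> \<le> P" using q_bounds(1,2,3)[OF \<kappa>_pos, of \<beta>] \<beta> by auto
      have l: "ln (q \<kappa> \<beta>) - ln P \<le> 0" "ln P \<le> ln (q \<kappa> \<beta>) - ln P"
      proof -
        show "ln (q \<kappa> \<beta>) - ln P \<le> 0" using qb P_pos by simp
        have "ln (P\<^sup>2) \<le> ln (q \<kappa> \<beta>)" using qb P_pos by (intro ln_mono) auto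
        then show "ln P \<le> ln (q \<kappa> \<beta>) - ln P" using P_pos by (simp add: ln_realpow)
      qed
      have "(real ?t - (\<alpha> * real N - 1)) * (ln (q \<kappa> \<beta>) - ln P) \<le> 0"
        using num_constraints_ge[of \<alpha> N] l by (intro mult_nonneg_nonpos) auto
      then have tl: "real ?t * (ln (q \<kappa> \<beta>) - ln P) \<le> \<alpha> * real N * (ln (q \<kappa> \<beta>) - ln P) - ln P"
        using l(2) by (simp add: algebra_simps)
      \<comment> \<open>A positive distance is at least 1, so \<beta> \<ge> 1 / N: this is where the
        gain sqrt N comes from.\<close>
      have sq: "sqrt (real N) \<le> real N * sqrt \<beta>"
      proof -
        have "real N * sqrt \<beta> = sqrt (real N) * sqrt (real N * \<beta>)"
          by (simp add: real_sqrt_mult)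
        moreover have "real N * \<beta> \<ge> 1" using N True by (simp add: \<beta>_def)
        ultimately show ?thesis using mult_left_mono[of 1 "sqrt (real N * \<beta>)" "sqrt (real N)"] by simp
      qed
      have gap: "real N * (\<phi> \<beta> - \<alpha> * ln P) \<le> - c * sqrt (real N)"
      proof -
        have "real N * (\<phi> \<beta> - \<alpha> * ln P) \<le> real N * (- c * sqrt \<beta>)"
          using c(2)[OF \<beta>(1,3)] by (intro mult_left_mono) auto
        also have "\<dots> \<le> - c * sqrt (real N)" using mult_left_mono[OF sq, of c] c(1) by (simp add: algebra_simps)
        finally show ?thesis .
      qed
      have "real (N choose d) * ?f d = real (N choose d) * exp (real ?t * ln (q \<kappa> \<beta>))"
        using True qb by (simp add: \<beta>_def exp_of_nat_mult)
      also have "\<dots> \<le> exp (real N * entropy \<beta>) * exp (real ?t * ln (q \<kappa> \<beta>))"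
        using binomial_le_exp_entropy[OF d N] by (intro mult_right_mono) (auto simp: \<beta>_def)
      also have "\<dots> = exp (real N * entropy \<beta> + real ?t * (ln (q \<kappa> \<beta>) - ln P)) * exp (real ?t * ln P)"
        by (simp add: mult_exp_exp algebra_simps)
      also have "exp (real ?t * ln P) = P ^ ?t" using P_pos by (simp add: exp_of_nat_mult)
      also have "exp (real N * entropy \<beta> + real ?t * (ln (q \<kappa> \<beta>) - ln P)) \<le> exp (- c * sqrt (real N) - ln P)"
      proof -
        have "real N * entropy \<beta> + \<alpha> * real N * (ln (q \<kappa> \<beta>) - ln P) = real N * (\<phi> \<beta> - \<alpha> * ln P)"
          by (simp add: F_def algebra_simps)
        then show ?thesis using tl gap by simp
      qed
      also have "exp (- c * sqrt (real N) - ln P) = exp (- c * sqrt (real N)) / P"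
        using P_pos by (simp add: exp_diff)
      finally show ?thesis using P_pos by (simp add: mult_right_mono)
    next
      case False
      then have "?f d = 0" by (rule if_not_P)
      then show ?thesis using P_pos by simp
    qed
    have "(\<Sum>\<sigma>\<in>cube N. \<Sum>\<tau>\<in>cube N. ?f (hamming_dist N \<sigma> \<tau>)) = 2 ^ N * (\<Sum>d\<le>N. real (N choose d) * ?f d)"
      by (rule sum_pairs_hamming)
    also have "\<dots> \<le> 2 ^ N * (\<Sum>d\<le>N. exp (- c * sqrt (real N)) / P * P ^ ?t)"
      by (intro mult_left_mono sum_mono term_le) auto
    also have "\<dots> = real (N + 1) / P * exp (- c * sqrt (real N)) * mean_sols \<kappa> N ?t"
      by (simp add: mean_sols_def)
    finally show "(\<integral>\<^sup>+X. ennreal (real (card {(\<sigma>, \<tau>) \<in> sols \<kappa> N ?t X \<times> sols \<kappa> N ?t X.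
          0 < hamming_dist N \<sigma> \<tau> \<and> real (hamming_dist N \<sigma> \<tau>) \<le> (?bc - \<delta>) * real N})) \<partial>rows N ?t)
        \<le> ennreal (real (N + 1) / P * exp (- c * sqrt (real N)) * mean_sols \<kappa> N ?t)"
      unfolding nn_integral_card_pairs[OF \<kappa>_pos N] by (rule ennreal_leI)
  qed
qed

end

section \<open>The fraction of a set of vectors that satisfies a new row\<close>

definition bad_pairs :: "nat \<Rightarrow> real \<Rightarrow> (nat \<Rightarrow> real) set \<Rightarrow> ((nat \<Rightarrow> real) \<times> (nat \<Rightarrow> real)) set" where
  "bad_pairs N \<eta> S = {(\<sigma>, \<tau>) \<in> S \<times> S. \<bar>overlap N \<sigma> \<tau>\<bar> > \<eta>}"

definition centred_avg :: "nat \<Rightarrow> (nat \<Rightarrow> real) set \<Rightarrow> real \<Rightarrow> (nat \<Rightarrow> real) \<Rightarrow> real" where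
  "centred_avg N S u x = (\<Sum>\<sigma>\<in>S. cos (u * proj N \<sigma> x) - exp (- u\<^sup>2 / 2)) / real (card S)"

lemma abs_cos_minus_exp: "\<bar>cos t - exp (- u\<^sup>2 / 2)\<bar> \<le> (2::real)"
proof -
  have "exp (- u\<^sup>2 / 2) \<le> 1" "0 < exp (- u\<^sup>2 / 2)" by simp_all
  moreover have "-1 \<le> cos t" "cos t \<le> 1" by simp_all
  ultimately show ?thesis unfolding abs_le_iff by linarith
qed

lemma abs_mult4_le: "\<bar>a\<bar> \<le> 2 \<Longrightarrow> \<bar>b\<bar> \<le> 2 \<Longrightarrow> \<bar>c\<bar> \<le> 2 \<Longrightarrow> \<bar>d\<bar> \<le> 2 \<Longrightarrow> \<bar>a * b * c * d\<bar> \<le> (16::real)"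
  using mult_mono[of "\<bar>a\<bar>" 2 "\<bar>b\<bar>" 2] mult_mono[of "\<bar>c\<bar>" 2 "\<bar>d\<bar>" 2]
    mult_mono[of "\<bar>a\<bar> * \<bar>b\<bar>" 4 "\<bar>c\<bar> * \<bar>d\<bar>" 4] by (simp add: abs_mult mult.assoc)

text \<open>Expand into quadruples. If all six overlaps are small, the centred moment applies;
  otherwise the trivial bound 16 is charged to a bad pair among the six, whence 96 = 16 * 6.
  Diagonal pairs have overlap 1 and so count as bad, which covers coincidences.\<close>

lemma centred_avg_fourth_moment:
  assumes N: "N > 0" and S: "S \<subseteq> cube N" "S \<noteq> {}" and \<eta>: "0 \<le> \<eta>" "\<eta> \<le> 1/6"
  shows "(\<integral>x. (centred_avg N S u x) ^ 4 \<partial>gaussian_row N) \<le>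
    14256 * \<eta> ^ 3 + 96 * real (card (bad_pairs N \<eta> S)) / (real (card S))\<^sup>2"
proof -
  have fin: "finite S" using S finite_cube finite_subset by blast
  define n where "n = real (card S)"
  have n: "n > 0" using S fin by (simp add: n_def card_gt_0_iff)
  define h where "h = (\<lambda>\<sigma> x. cos (u * proj N \<sigma> x) - exp (- u\<^sup>2 / 2))"
  define b where "b = (\<lambda>\<sigma> \<tau>. if \<bar>overlap N \<sigma> \<tau>\<bar> > \<eta> then 1 else 0 :: real)"
  define B where "B = (\<Sum>\<sigma>\<in>S. \<Sum>\<tau>\<in>S. b \<sigma> \<tau>)"
  have h2: "\<bar>h \<sigma> x\<bar> \<le> 2" for \<sigma> x unfolding h_def by (rule abs_cos_minus_exp)
  have [measurable]: "h \<sigma> \<in> borel_measurable (gaussian_row N)" for \<sigma> unfolding h_def by measurable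
  have int4: "integrable (gaussian_row N) (\<lambda>x. h \<sigma>1 x * h \<sigma>2 x * h \<sigma>3 x * h \<sigma>4 x)" for \<sigma>1 \<sigma>2 \<sigma>3 \<sigma>4
    by (rule integrable_row_bounded[where B = 16]) (auto intro!: abs_mult4_le h2)
  have bsum: "(\<Sum>\<sigma>\<in>S. \<Sum>\<tau>\<in>S. b \<sigma> \<tau>) = real (card (bad_pairs N \<eta> S))"
  proof -
    have "(\<Sum>\<sigma>\<in>S. \<Sum>\<tau>\<in>S. b \<sigma> \<tau>) = (\<Sum>z\<in>S \<times> S. if \<bar>overlap N (fst z) (snd z)\<bar> > \<eta> then 1 else 0)"
      by (simp add: sum.cartesian_product case_prod_unfold b_def)
    also have "\<dots> = real (card {z \<in> S \<times> S. \<bar>overlap N (fst z) (snd z)\<bar> > \<eta>})"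
      using fin by (simp add: sum.If_cases Int_def conj_commute)
    also have "{z \<in> S \<times> S. \<bar>overlap N (fst z) (snd z)\<bar> > \<eta>} = bad_pairs N \<eta> S"
      by (auto simp: bad_pairs_def)
    finally show ?thesis .
  qed
  have each: "(\<integral>x. h \<sigma>1 x * h \<sigma>2 x * h \<sigma>3 x * h \<sigma>4 x \<partial>gaussian_row N) \<le> 14256 * \<eta> ^ 3
      + 16 * (b \<sigma>1 \<sigma>2 + b \<sigma>1 \<sigma>3 + b \<sigma>1 \<sigma>4 + b \<sigma>2 \<sigma>3 + b \<sigma>2 \<sigma>4 + b \<sigma>3 \<sigma>4)"
    if "\<sigma>1 \<in> S" "\<sigma>2 \<in> S" "\<sigma>3 \<in> S" "\<sigma>4 \<in> S" for \<sigma>1 \<sigma>2 \<sigma>3 \<sigma>4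
  proof (cases "\<bar>overlap N \<sigma>1 \<sigma>2\<bar> \<le> \<eta> \<and> \<bar>overlap N \<sigma>1 \<sigma>3\<bar> \<le> \<eta> \<and> \<bar>overlap N \<sigma>1 \<sigma>4\<bar> \<le> \<eta> \<and>
      \<bar>overlap N \<sigma>2 \<sigma>3\<bar> \<le> \<eta> \<and> \<bar>overlap N \<sigma>2 \<sigma>4\<bar> \<le> \<eta> \<and> \<bar>overlap N \<sigma>3 \<sigma>4\<bar> \<le> \<eta>")
    case True
    then have "\<bar>\<integral>x. h \<sigma>1 x * h \<sigma>2 x * h \<sigma>3 x * h \<sigma>4 x \<partial>gaussian_row N\<bar> \<le> 14256 * \<eta> ^ 3"
      unfolding h_def using that S \<eta> by (intro centred_fourth_moment N) auto
    moreover have "b \<sigma>1 \<sigma>2 = 0" "b \<sigma>1 \<sigma>3 = 0" "b \<sigma>1 \<sigma>4 = 0" "b \<sigma>2 \<sigma>3 = 0" "b \<sigma>2 \<sigma>4 = 0" "b \<sigma>3 \<sigma>4 = 0"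
      using True by (simp_all add: b_def)
    ultimately show ?thesis by simp
  next
    case False
    have "(\<integral>x. h \<sigma>1 x * h \<sigma>2 x * h \<sigma>3 x * h \<sigma>4 x \<partial>gaussian_row N) \<le> (\<integral>x. 16 \<partial>gaussian_row N)"
      using abs_mult4_le[OF h2 h2 h2 h2] by (intro integral_mono int4) (auto simp: abs_le_iff)
    also have "\<dots> = 16" by (simp add: row.prob_space)
    also have "\<dots> \<le> 16 * (b \<sigma>1 \<sigma>2 + b \<sigma>1 \<sigma>3 + b \<sigma>1 \<sigma>4 + b \<sigma>2 \<sigma>3 + b \<sigma>2 \<sigma>4 + b \<sigma>3 \<sigma>4)"
    proof -
      have nn: "0 \<le> b \<sigma> \<tau>" and b1: "(b \<sigma> \<tau> = 1) = (\<not> \<bar>overlap N \<sigma> \<tau>\<bar> \<le> \<eta>)" for \<sigma> \<tau>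
        by (simp_all add: b_def not_le)
      have "b \<sigma>1 \<sigma>2 = 1 \<or> b \<sigma>1 \<sigma>3 = 1 \<or> b \<sigma>1 \<sigma>4 = 1 \<or> b \<sigma>2 \<sigma>3 = 1 \<or> b \<sigma>2 \<sigma>4 = 1 \<or> b \<sigma>3 \<sigma>4 = 1"
        unfolding b1 using False by blast
      then show ?thesis
        using nn[of \<sigma>1 \<sigma>2] nn[of \<sigma>1 \<sigma>3] nn[of \<sigma>1 \<sigma>4] nn[of \<sigma>2 \<sigma>3] nn[of \<sigma>2 \<sigma>4] nn[of \<sigma>3 \<sigma>4]
        by (elim disjE) simp_all
    qed
    finally show ?thesis using \<eta>(1) zero_le_power[of \<eta> 3] by linarith
  qed
  have avg: "centred_avg N S u x = (\<Sum>\<sigma>\<in>S. h \<sigma> x) / n" for x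
    by (simp only: centred_avg_def h_def n_def)
  have "(\<integral>x. (centred_avg N S u x) ^ 4 \<partial>gaussian_row N) =
      (\<integral>x. (\<Sum>\<sigma>1\<in>S. \<Sum>\<sigma>2\<in>S. \<Sum>\<sigma>3\<in>S. \<Sum>\<sigma>4\<in>S. h \<sigma>1 x * h \<sigma>2 x * h \<sigma>3 x * h \<sigma>4 x) / n ^ 4 \<partial>gaussian_row N)"
  proof (intro Bochner_Integration.integral_cong refl)
    fix x
    have "(\<Sum>\<sigma>1\<in>S. \<Sum>\<sigma>2\<in>S. \<Sum>\<sigma>3\<in>S. \<Sum>\<sigma>4\<in>S. h \<sigma>1 x * h \<sigma>2 x * h \<sigma>3 x * h \<sigma>4 x) = (\<Sum>\<sigma>\<in>S. h \<sigma> x) ^ 4"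
    proof -
      define s where "s = (\<Sum>\<sigma>\<in>S. h \<sigma> x)"
      have "(\<Sum>\<sigma>\<in>S. r * h \<sigma> x) = r * s" "(\<Sum>\<sigma>\<in>S. r * h \<sigma> x * t) = r * s * t"
        "(\<Sum>\<sigma>\<in>S. r * h \<sigma> x * t * t') = r * s * t * t'" "(\<Sum>\<sigma>\<in>S. h \<sigma> x * t * t' * t'') = s * t * t' * t''"
        for r t t' t''
        unfolding s_def by (simp_all only: sum_distrib_left sum_distrib_right)
      then show ?thesis by (simp only: s_def[symmetric] power4_eq_xxxx)
    qed
    then show "(centred_avg N S u x) ^ 4 =
        (\<Sum>\<sigma>1\<in>S. \<Sum>\<sigma>2\<in>S. \<Sum>\<sigma>3\<in>S. \<Sum>\<sigma>4\<in>S. h \<sigma>1 x * h \<sigma>2 x * h \<sigma>3 x * h \<sigma>4 x) / n ^ 4"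
      by (simp only: avg power_divide)
  qed
  also have "\<dots> = (\<Sum>\<sigma>1\<in>S. \<Sum>\<sigma>2\<in>S. \<Sum>\<sigma>3\<in>S. \<Sum>\<sigma>4\<in>S. \<integral>x. h \<sigma>1 x * h \<sigma>2 x * h \<sigma>3 x * h \<sigma>4 x \<partial>gaussian_row N) / n ^ 4"
    by (simp add: int4)
  also have "\<dots> \<le> (\<Sum>\<sigma>1\<in>S. \<Sum>\<sigma>2\<in>S. \<Sum>\<sigma>3\<in>S. \<Sum>\<sigma>4\<in>S. 14256 * \<eta> ^ 3
      + 16 * (b \<sigma>1 \<sigma>2 + b \<sigma>1 \<sigma>3 + b \<sigma>1 \<sigma>4 + b \<sigma>2 \<sigma>3 + b \<sigma>2 \<sigma>4 + b \<sigma>3 \<sigma>4)) / n ^ 4"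
    using n by (intro divide_right_mono sum_mono each) auto
  also have "\<dots> = (n ^ 4 * (14256 * \<eta> ^ 3) + 16 * (6 * (n * (n * B)))) / n ^ 4"
  proof -
    have "(\<Sum>\<sigma>1\<in>S. \<Sum>\<sigma>2\<in>S. \<Sum>\<sigma>3\<in>S. \<Sum>\<sigma>4\<in>S. 14256 * \<eta> ^ 3
        + 16 * (b \<sigma>1 \<sigma>2 + b \<sigma>1 \<sigma>3 + b \<sigma>1 \<sigma>4 + b \<sigma>2 \<sigma>3 + b \<sigma>2 \<sigma>4 + b \<sigma>3 \<sigma>4)) =
      (\<Sum>\<sigma>1\<in>S. \<Sum>\<sigma>2\<in>S. \<Sum>\<sigma>3\<in>S. \<Sum>\<sigma>4\<in>S. 14256 * \<eta> ^ 3) + 16 * (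
        (\<Sum>\<sigma>1\<in>S. \<Sum>\<sigma>2\<in>S. \<Sum>\<sigma>3\<in>S. \<Sum>\<sigma>4\<in>S. b \<sigma>1 \<sigma>2) + (\<Sum>\<sigma>1\<in>S. \<Sum>\<sigma>2\<in>S. \<Sum>\<sigma>3\<in>S. \<Sum>\<sigma>4\<in>S. b \<sigma>1 \<sigma>3)
      + (\<Sum>\<sigma>1\<in>S. \<Sum>\<sigma>2\<in>S. \<Sum>\<sigma>3\<in>S. \<Sum>\<sigma>4\<in>S. b \<sigma>1 \<sigma>4) + (\<Sum>\<sigma>1\<in>S. \<Sum>\<sigma>2\<in>S. \<Sum>\<sigma>3\<in>S. \<Sum>\<sigma>4\<in>S. b \<sigma>2 \<sigma>3)
      + (\<Sum>\<sigma>1\<in>S. \<Sum>\<sigma>2\<in>S. \<Sum>\<sigma>3\<in>S. \<Sum>\<sigma>4\<in>S. b \<sigma>2 \<sigma>4) + (\<Sum>\<sigma>1\<in>S. \<Sum>\<sigma>2\<in>S. \<Sum>\<sigma>3\<in>S. \<Sum>\<sigma>4\<in>S. b \<sigma>3 \<sigma>4))"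
      by (simp only: sum.distrib sum_distrib_left distrib_left)
    moreover have "(\<Sum>\<sigma>1\<in>S. \<Sum>\<sigma>2\<in>S. \<Sum>\<sigma>3\<in>S. \<Sum>\<sigma>4\<in>S. 14256 * \<eta> ^ 3) = n ^ 4 * (14256 * \<eta> ^ 3)"
      by (simp add: n_def power4_eq_xxxx)
    moreover have "(\<Sum>\<sigma>1\<in>S. \<Sum>\<sigma>2\<in>S. \<Sum>\<sigma>3\<in>S. \<Sum>\<sigma>4\<in>S. b \<sigma>1 \<sigma>2) = n * (n * B)"
      "(\<Sum>\<sigma>1\<in>S. \<Sum>\<sigma>2\<in>S. \<Sum>\<sigma>3\<in>S. \<Sum>\<sigma>4\<in>S. b \<sigma>1 \<sigma>3) = n * (n * B)"
      "(\<Sum>\<sigma>1\<in>S. \<Sum>\<sigma>2\<in>S. \<Sum>\<sigma>3\<in>S. \<Sum>\<sigma>4\<in>S. b \<sigma>1 \<sigma>4) = n * (n * B)"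
      "(\<Sum>\<sigma>1\<in>S. \<Sum>\<sigma>2\<in>S. \<Sum>\<sigma>3\<in>S. \<Sum>\<sigma>4\<in>S. b \<sigma>2 \<sigma>3) = n * (n * B)"
      "(\<Sum>\<sigma>1\<in>S. \<Sum>\<sigma>2\<in>S. \<Sum>\<sigma>3\<in>S. \<Sum>\<sigma>4\<in>S. b \<sigma>2 \<sigma>4) = n * (n * B)"
      "(\<Sum>\<sigma>1\<in>S. \<Sum>\<sigma>2\<in>S. \<Sum>\<sigma>3\<in>S. \<Sum>\<sigma>4\<in>S. b \<sigma>3 \<sigma>4) = n * (n * B)"
      by (simp_all only: sum_constant n_def B_def sum_distrib_left)
    ultimately show ?thesis by simp
  qed
  also have "\<dots> = 14256 * \<eta> ^ 3 + 96 * B / n\<^sup>2"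
    using n by (simp add: add_divide_distrib power4_eq_xxxx power2_eq_square)
  also have "B = real (card (bad_pairs N \<eta> S))" unfolding B_def by (rule bsum)
  finally show ?thesis by (simp add: n_def)
qed

text \<open>The indicator of the slab is replaced by the function exp (- a t^2), an average of
  cosines over a Gaussian frequency, so the cosine moments apply. If few vectors satisfy the row,
  the average of this function over S is at most r + exp (- a \<kappa>^2), noticeably below its mean
  c0; Markov's inequality for the fourth power of the deviation finishes.\<close>

lemma fraction_lower_tail:
  assumes "\<kappa> > 0"
  obtains C r where "C > 0" "r > 0"
    "\<And>N S \<eta>. N > 0 \<Longrightarrow> S \<subseteq> cube N \<Longrightarrow> S \<noteq> {} \<Longrightarrow> 0 \<le> \<eta> \<Longrightarrow> \<eta> \<le> 1/6 \<Longrightarrow>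
      measure (gaussian_row N) {x \<in> space (gaussian_row N). real (card {\<sigma>\<in>S. sat \<kappa> N x \<sigma>}) < r * real (card S)}
        \<le> C * (\<eta> ^ 3 + real (card (bad_pairs N \<eta> S)) / (real (card S))\<^sup>2)"
proof -
  define p2 where "p2 = p (\<kappa> / 2)"
  have p2: "0 < p2" "p2 < 1" using p_pos[of "\<kappa> / 2"] p_less_1[of "\<kappa> / 2"] assms by (auto simp: p2_def)
  \<comment> \<open>Chosen so that 3/4 a \<kappa>^2 = 1 - ln p2. Restricting to \<bar>v\<bar> \<le>
    \<kappa> / 2 gives c0 \<ge> p2 exp (- a \<kappa>^2 / 4), while exp (- a \<kappa>^2) is smaller
    than this by the factor exp (- 1). Half of the resulting gap is r.\<close>
  define a where "a = 4 / (3 * \<kappa>\<^sup>2) * (1 - ln p2)"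
  have "1 - ln p2 > 0" using p2 ln_less_zero[of p2] by linarith
  then have a: "a > 0" using assms by (simp only: a_def) (intro mult_pos_pos divide_pos_pos, auto)
  define c0 where "c0 = (\<integral>v. exp (- (sqrt (2 * a) * v)\<^sup>2 / 2) \<partial>std_gaussian)"
  define r where "r = (c0 - exp (- a * \<kappa>\<^sup>2)) / 2"
  have ie: "integrable std_gaussian (\<lambda>v. exp (- (sqrt (2 * a) * v)\<^sup>2 / 2))"
    by (rule std.integrable_const_bound[where B = 1]) auto
  have "exp (- a * \<kappa>\<^sup>2) = exp (- a * \<kappa>\<^sup>2 / 4) * exp (- (3 / 4 * a * \<kappa>\<^sup>2))"
    by (simp add: mult_exp_exp algebra_simps)
  also have "3 / 4 * a * \<kappa>\<^sup>2 = 1 - ln p2" using assms by (simp add: a_def field_simps)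
  also have "exp (- (1 - ln p2)) = p2 * exp (-1)" using p2 by (simp add: exp_diff exp_minus field_simps)
  also have "exp (- a * \<kappa>\<^sup>2 / 4) * (p2 * exp (-1)) < exp (- a * \<kappa>\<^sup>2 / 4) * (p2 * 1)"
    using p2 by (intro mult_strict_left_mono) auto
  also have "\<dots> = (\<integral>v. exp (- a * \<kappa>\<^sup>2 / 4) * indicator {z. \<bar>z\<bar> \<le> \<kappa> / 2} v \<partial>std_gaussian)"
    by (simp add: p2_def p_def)
  also have "\<dots> \<le> c0"
    unfolding c0_def
  proof (rule integral_mono[OF _ ie])
    fix v
    show "exp (- a * \<kappa>\<^sup>2 / 4) * indicator {z. \<bar>z\<bar> \<le> \<kappa> / 2} v \<le> exp (- (sqrt (2 * a) * v)\<^sup>2 / 2)"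
    proof (cases "\<bar>v\<bar> \<le> \<kappa> / 2")
      case True
      then have "v\<^sup>2 \<le> (\<kappa> / 2)\<^sup>2" using power_mono[OF True, of 2] by simp
      then have "a * v\<^sup>2 \<le> a * (\<kappa>\<^sup>2 / 4)" using a by (intro mult_left_mono) (auto simp: power_divide)
      then show ?thesis using True a by (simp add: power_mult_distrib)
    qed simp
  next
    have "integrable std_gaussian (indicator {-(\<kappa> / 2)..\<kappa> / 2} :: real \<Rightarrow> real)"
      by (rule std.integrable_const_bound[where B = 1]) auto
    then show "integrable std_gaussian (\<lambda>v. exp (- a * \<kappa>\<^sup>2 / 4) * indicator {z. \<bar>z\<bar> \<le> \<kappa> / 2} v)"
      unfolding abs_le_Icc by (intro integrable_mult_right)
  qed
  finally have r: "r > 0" by (simp add: r_def)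
  show ?thesis
  proof (rule that[of "14256 / r ^ 4" r])
    fix N S and \<eta> :: real
    assume N: "N > 0" and S: "S \<subseteq> cube N" "S \<noteq> {}" and \<eta>: "0 \<le> \<eta>" "\<eta> \<le> 1/6"
    have fin: "finite S" using S finite_cube finite_subset by blast
    define n where "n = real (card S)"
    have n: "n > 0" using S fin by (simp add: n_def card_gt_0_iff)
    define w where "w = (\<lambda>v. sqrt (2 * a) * v)"
    define A where "A = (\<lambda>x. (\<Sum>\<sigma>\<in>S. exp (- a * (proj N \<sigma> x)\<^sup>2)) / n - c0)"
    let ?K = "14256 * \<eta> ^ 3 + 96 * real (card (bad_pairs N \<eta> S)) / n\<^sup>2"
    have bound: "\<bar>centred_avg N S u x\<bar> \<le> 2" for u x
    proof -
      have "\<bar>\<Sum>\<sigma>\<in>S. cos (u * proj N \<sigma> x) - exp (- u\<^sup>2 / 2)\<bar> \<le> (\<Sum>\<sigma>\<in>S. 2)"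
        by (intro order_trans[OF sum_abs] sum_mono abs_cos_minus_exp)
      then show ?thesis using n by (simp add: centred_avg_def n_def[symmetric] field_simps)
    qed
    then have bound4: "(centred_avg N S u x) ^ 4 \<le> 16" for u x
      using power_mono[OF bound[of u x], of 4] by (simp add: power_abs)
    have mu: "(\<lambda>v. centred_avg N S (w v) x) \<in> borel_measurable std_gaussian" for x
      unfolding centred_avg_def w_def by measurable
    have mx: "centred_avg N S u \<in> borel_measurable (gaussian_row N)" for u
      unfolding centred_avg_def [abs_def] by measurable
    have mp: "(\<lambda>z. centred_avg N S (w (snd z)) (fst z)) \<in> borel_measurable (gaussian_row N \<Otimes>\<^sub>M std_gaussian)"
      unfolding centred_avg_def w_def by measurable
    have A_eq: "A x = (\<integral>v. centred_avg N S (w v) x \<partial>std_gaussian)" for x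
    proof -
      have i: "integrable std_gaussian (\<lambda>v. cos (w v * t))" for t
        by (rule std.integrable_const_bound[where B = 1]) (auto simp: w_def)
      have e: "(\<integral>v. cos (w v * t) \<partial>std_gaussian) = exp (- a * t\<^sup>2)" for t
        using integral_cos_std_gaussian[of "sqrt (2 * a) * t"] a
        by (simp add: w_def power_mult_distrib mult_ac)
      have "(\<integral>v. centred_avg N S (w v) x \<partial>std_gaussian) = (\<Sum>\<sigma>\<in>S. exp (- a * (proj N \<sigma> x)\<^sup>2) - c0) / n"
        unfolding centred_avg_def n_def[symmetric] using ie
        by (simp add: i e c0_def w_def[symmetric])
      also have "\<dots> = A x" using n by (simp add: A_def sum_subtractf diff_divide_distrib n_def)
      finally show ?thesis ..
    qed
    have Am: "A \<in> borel_measurable (gaussian_row N)" unfolding A_def [abs_def] by measurable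
    have A2: "\<bar>A x\<bar> \<le> 2" for x
      unfolding A_eq
    proof (rule order_trans[OF integral_abs_bound])
      have "(\<integral>v. \<bar>centred_avg N S (w v) x\<bar> \<partial>std_gaussian) \<le> (\<integral>v. 2 \<partial>std_gaussian)"
        using mu bound by (intro integral_mono std.integrable_const_bound[where B = 2]) auto
      then show "(\<integral>v. \<bar>centred_avg N S (w v) x\<bar> \<partial>std_gaussian) \<le> 2" using std.prob_space by simp
    qed
    have iA: "integrable (gaussian_row N) (\<lambda>x. (A x) ^ 4)"
    proof (rule integrable_row_bounded[where B = 16])
      fix x
      show "\<bar>(A x) ^ 4\<bar> \<le> 16" using power_mono[OF A2[of x], of 4] by (simp add: power_abs)
    qed (use Am in measurable)
    interpret PP: pair_prob_space "gaussian_row N" std_gaussian ..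
    have ip: "integrable (gaussian_row N \<Otimes>\<^sub>M std_gaussian) (\<lambda>(x, v). (centred_avg N S (w v) x) ^ 4)"
      by (rule PP.P.integrable_const_bound[where B = 16]) (use bound4 mp in \<open>auto simp: case_prod_unfold\<close>)
    \<comment> \<open>Jensen's inequality for the fourth power moves it inside the average over
      frequencies, and Fubini then lets the bound for a fixed frequency be used.\<close>
    have "(\<integral>x. (A x) ^ 4 \<partial>gaussian_row N) \<le> (\<integral>x. (\<integral>v. (centred_avg N S (w v) x) ^ 4 \<partial>std_gaussian) \<partial>gaussian_row N)"
    proof (rule integral_mono[OF iA])
      show "integrable (gaussian_row N) (\<lambda>x. \<integral>v. (centred_avg N S (w v) x) ^ 4 \<partial>std_gaussian)"
        using PP.integrable_fst'[OF ip] by simp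
      fix x
      show "(A x) ^ 4 \<le> (\<integral>v. (centred_avg N S (w v) x) ^ 4 \<partial>std_gaussian)"
      proof -
        have "integrable std_gaussian (\<lambda>v. centred_avg N S (w v) x)"
          by (rule std.integrable_const_bound[where B = 2]) (use mu bound in auto)
        moreover have "integrable std_gaussian (\<lambda>v. (centred_avg N S (w v) x) ^ 4)"
          by (rule std.integrable_const_bound[where B = 16]) (use mu bound4 in auto)
        moreover have "convex_on UNIV (\<lambda>x::real. x ^ 4)" by (rule convex_power_even) simp
        ultimately show ?thesis
          unfolding A_eq by (intro std.jensens_inequality[where I = UNIV]) auto
      qed
    qed
    also have "\<dots> = (\<integral>v. (\<integral>x. (centred_avg N S (w v) x) ^ 4 \<partial>gaussian_row N) \<partial>std_gaussian)"
      by (rule PP.Fubini_integral[OF ip, symmetric])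
    also have "\<dots> \<le> (\<integral>v. ?K \<partial>std_gaussian)"
      using centred_avg_fourth_moment[OF N S \<eta>] PP.integrable_snd[OF ip]
      by (intro integral_mono) (auto simp: n_def)
    also have "\<dots> = ?K" using std.prob_space by simp
    finally have A4: "(\<integral>x. (A x) ^ 4 \<partial>gaussian_row N) \<le> ?K" .
    let ?E = "{x \<in> space (gaussian_row N). real (card {\<sigma>\<in>S. sat \<kappa> N x \<sigma>}) < r * n}"
    have card_sum: "real (card {\<sigma>\<in>S. sat \<kappa> N x \<sigma>}) = (\<Sum>\<sigma>\<in>S. if sat \<kappa> N x \<sigma> then 1 else 0)" for x
      using fin by (simp add: sum.If_cases Int_def conj_commute)
    have Em: "?E \<in> sets (gaussian_row N)" unfolding card_sum by measurable
    have "r ^ 4 * measure (gaussian_row N) ?E = (\<integral>x. r ^ 4 * indicator ?E x \<partial>gaussian_row N)"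
      using Em by simp
    also have "\<dots> \<le> (\<integral>x. (A x) ^ 4 \<partial>gaussian_row N)"
    proof (rule integral_mono[OF _ iA])
      show "integrable (gaussian_row N) (\<lambda>x. r ^ 4 * indicator ?E x)"
        by (intro integrable_mult_right integrable_real_indicator Em) (simp add: row.emeasure_eq_measure)
      fix x
      show "r ^ 4 * indicator ?E x \<le> (A x) ^ 4"
      proof (cases "x \<in> ?E")
        case True
        \<comment> \<open>A violating vector has projection at least \<kappa> in absolute value,
          hence contributes at most exp (- a \<kappa>^2).\<close>
        have "exp (- a * (proj N \<sigma> x)\<^sup>2) \<le> (if sat \<kappa> N x \<sigma> then 1 else 0) + exp (- a * \<kappa>\<^sup>2)" for \<sigma>
        proof (cases "sat \<kappa> N x \<sigma>")
          case True
          have "exp (- a * (proj N \<sigma> x)\<^sup>2) \<le> 1" using a by simp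
          then show ?thesis using True by (simp add: add_increasing2)
        next
          case False
          then have "\<kappa> * sqrt (real N) \<le> \<bar>\<Sum>j<N. x j * \<sigma> j\<bar>" by (simp add: sat_def)
          then have "\<kappa> \<le> \<bar>proj N \<sigma> x\<bar>"
            using N by (simp add: proj_def pos_le_divide_eq)
          then have "\<kappa>\<^sup>2 \<le> (proj N \<sigma> x)\<^sup>2" using assms power_mono[of \<kappa> "\<bar>proj N \<sigma> x\<bar>" 2] by simp
          then show ?thesis using False a by simp
        qed
        then have "(\<Sum>\<sigma>\<in>S. exp (- a * (proj N \<sigma> x)\<^sup>2)) \<le> (\<Sum>\<sigma>\<in>S. (if sat \<kappa> N x \<sigma> then 1 else 0) + exp (- a * \<kappa>\<^sup>2))"
          by (intro sum_mono)
        also have "\<dots> = real (card {\<sigma>\<in>S. sat \<kappa> N x \<sigma>}) + n * exp (- a * \<kappa>\<^sup>2)"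
          unfolding card_sum by (simp add: sum.distrib n_def)
        also have "\<dots> < r * n + n * exp (- a * \<kappa>\<^sup>2)" using True by simp
        also have "\<dots> = (c0 - r) * n" by (simp add: r_def field_simps)
        finally have "A x < - r" using n by (simp add: A_def field_simps)
        then have "r ^ 4 \<le> (- A x) ^ 4" using r by (intro power_mono) auto
        then show ?thesis using True by simp
      qed simp
    qed
    also note A4
    finally have "r ^ 4 * measure (gaussian_row N) ?E \<le> ?K" .
    also have "\<dots> \<le> 14256 * (\<eta> ^ 3 + real (card (bad_pairs N \<eta> S)) / n\<^sup>2)"
      by (simp add: divide_right_mono)
    finally show "measure (gaussian_row N) {x \<in> space (gaussian_row N). real (card {\<sigma>\<in>S. sat \<kappa> N x \<sigma>}) < r * real (card S)}
        \<le> 14256 / r ^ 4 * (\<eta> ^ 3 + real (card (bad_pairs N \<eta> S)) / (real (card S))\<^sup>2)"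
      using r by (simp add: n_def field_simps)
  qed (use r in auto)
qed

section \<open>The number of solutions\<close>

lemma overlap_eq_hamming:
  assumes "N > 0" "\<sigma> \<in> cube N" "\<tau> \<in> cube N"
  shows "overlap N \<sigma> \<tau> = 1 - 2 * (real (hamming_dist N \<sigma> \<tau>) / real N)"
proof -
  let ?D = "{i \<in> {..<N}. \<sigma> i \<noteq> \<tau> i}"
  have "(\<Sum>j<N. \<sigma> j * \<tau> j) = (\<Sum>j<N. 1 - 2 * (if \<sigma> j \<noteq> \<tau> j then 1 else 0))"
    using cubeD[OF assms(2)] cubeD[OF assms(3)] by (intro sum.cong refl) force
  also have "\<dots> = (\<Sum>j<N. 1) - 2 * (\<Sum>j<N. if \<sigma> j \<noteq> \<tau> j then 1 else 0)"
    by (simp only: sum_subtractf sum_distrib_left)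
  also have "(\<Sum>j<N. if \<sigma> j \<noteq> \<tau> j then 1 else 0) = real (card ?D)"
    by (rule card_eq_sum[symmetric]) simp
  finally show ?thesis
    using assms(1) by (simp add: overlap_def hamming_dist_def diff_divide_distrib)
qed

lemma bad_pairs_sols:
  assumes "N > 0"
  shows "bad_pairs N \<eta> (sols \<kappa> N t X) = {(\<sigma>, \<tau>) \<in> sols \<kappa> N t X \<times> sols \<kappa> N t X.
          \<eta> < \<bar>1 - 2 * (real (hamming_dist N \<sigma> \<tau>) / real N)\<bar>}"
proof -
  have "overlap N \<sigma> \<tau> = 1 - 2 * (real (hamming_dist N \<sigma> \<tau>) / real N)"
    if "\<sigma> \<in> sols \<kappa> N t X" "\<tau> \<in> sols \<kappa> N t X" for \<sigma> \<tau>
    by (rule overlap_eq_hamming[OF assms subsetD[OF sols_subset that(1)] subsetD[OF sols_subset that(2)]])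
  then show ?thesis unfolding bad_pairs_def by auto
qed

text \<open>For x = R / p the identity 1 / x = 2 - x + (x - 1)^2 / x and the cutoff x \<ge> r / p
  give a quadratic majorant of 1 / x. Only two moments of the kept fraction R are then needed: its
  mean is exactly p, and its variance is small when most overlaps are.\<close>

lemma inverse_fraction:
  assumes \<kappa>: "\<kappa> > 0" and N: "N > 0" and S: "S \<subseteq> cube N" "S \<noteq> {}" and \<eta>: "0 \<le> \<eta>" and r: "0 < r" "r \<le> p \<kappa>"
  shows "(\<integral>\<^sup>+y. (if r * real (card S) \<le> real (card {\<sigma>\<in>S. sat \<kappa> N y \<sigma>})
        then ennreal (real (card S) * p \<kappa> / real (card {\<sigma>\<in>S. sat \<kappa> N y \<sigma>})) else 0) \<partial>gaussian_row N)
    \<le> ennreal (1 + ((\<kappa>\<^sup>2 + 4) * \<eta>\<^sup>2 + real (card (bad_pairs N \<eta> S)) / (real (card S))\<^sup>2) / (p \<kappa> * r))"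
proof -
  have fin: "finite S" using S finite_cube finite_subset by blast
  define n where "n = real (card S)"
  have n: "n > 0" using S fin by (simp add: n_def card_gt_0_iff)
  have pp: "p \<kappa> > 0" using p_pos[OF \<kappa>] .
  define s where "s = (\<lambda>\<sigma> y. if sat \<kappa> N y \<sigma> then 1 else 0 :: real)"
  define b where "b = (\<lambda>\<sigma> \<tau>. if \<bar>overlap N \<sigma> \<tau>\<bar> > \<eta> then 1 else 0 :: real)"
  define R where "R = (\<lambda>y. (\<Sum>\<sigma>\<in>S. s \<sigma> y) / n)"
  have c: "real (card {\<sigma>\<in>S. sat \<kappa> N y \<sigma>}) = n * R y" for y
    unfolding card_eq_sum[OF fin] R_def s_def using n by simp
  have [measurable]: "s \<sigma> \<in> borel_measurable (gaussian_row N)" for \<sigma> unfolding s_def by measurable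
  have s1: "\<bar>s \<sigma> y\<bar> \<le> 1" for \<sigma> y by (simp add: s_def)
  have i1: "integrable (gaussian_row N) (s \<sigma>)" for \<sigma>
    by (rule integrable_row_bounded[where B = 1]) (use s1 in auto)
  have i2: "integrable (gaussian_row N) (\<lambda>y. s \<sigma> y * s \<tau> y)" for \<sigma> \<tau>
    by (rule integrable_row_bounded[where B = 1]) (auto intro!: abs_mult_le_one s1)
  have E2: "(\<integral>y. s \<sigma> y * s \<tau> y \<partial>gaussian_row N) = q \<kappa> (real (hamming_dist N \<sigma> \<tau>) / real N)"
    if "\<sigma> \<in> S" "\<tau> \<in> S" for \<sigma> \<tau>
  proof -
    have "(\<integral>y. s \<sigma> y * s \<tau> y \<partial>gaussian_row N) =
        (\<integral>y. indicator {x \<in> space (gaussian_row N). sat \<kappa> N x \<sigma> \<and> sat \<kappa> N x \<tau>} y \<partial>gaussian_row N)"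
      by (intro Bochner_Integration.integral_cong) (auto simp: s_def)
    also have "\<dots> = measure (gaussian_row N) {x \<in> space (gaussian_row N). sat \<kappa> N x \<sigma> \<and> sat \<kappa> N x \<tau>}"
      by (subst Bochner_Integration.integral_indicator) (auto intro!: arg_cong[of _ _ "measure _"])
    also have "\<dots> = q \<kappa> (real (hamming_dist N \<sigma> \<tau>) / real N)"
      using emeasure_pair_sat[OF \<kappa> N, of \<sigma> \<tau>] that S by (simp add: measure_def q_def subset_iff)
    finally show ?thesis .
  qed
  have E1: "(\<integral>y. s \<sigma> y \<partial>gaussian_row N) = p \<kappa>" if "\<sigma> \<in> S" for \<sigma>
  proof -
    have eq: "(\<lambda>y. s \<sigma> y * s \<sigma> y) = s \<sigma>" by (auto simp: s_def fun_eq_iff)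
    have "(\<integral>y. s \<sigma> y \<partial>gaussian_row N) = q \<kappa> 0" using E2[OF that that] unfolding eq by simp
    then show ?thesis using q_endpoints[of "-1" \<kappa>] by simp
  qed
  have iR: "integrable (gaussian_row N) R" unfolding R_def by (intro integrable_divide Bochner_Integration.integrable_sum i1)
  have R2: "(R y)\<^sup>2 = (\<Sum>\<sigma>\<in>S. \<Sum>\<tau>\<in>S. s \<sigma> y * s \<tau> y) / n\<^sup>2" for y
    by (simp add: R_def power_divide power2_eq_square sum_product)
  have iR2: "integrable (gaussian_row N) (\<lambda>y. (R y)\<^sup>2)"
    unfolding R2 by (intro integrable_divide Bochner_Integration.integrable_sum i2)
  have ER: "(\<integral>y. R y \<partial>gaussian_row N) = p \<kappa>"
    unfolding R_def using i1 E1 n by (simp add: n_def)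
  have bsum: "(\<Sum>\<sigma>\<in>S. \<Sum>\<tau>\<in>S. b \<sigma> \<tau>) = real (card (bad_pairs N \<eta> S))"
  proof -
    have "(\<Sum>\<sigma>\<in>S. \<Sum>\<tau>\<in>S. b \<sigma> \<tau>) = (\<Sum>z\<in>S \<times> S. if \<bar>overlap N (fst z) (snd z)\<bar> > \<eta> then 1 else 0)"
      by (simp add: sum.cartesian_product case_prod_unfold b_def)
    also have "\<dots> = real (card {z \<in> S \<times> S. \<bar>overlap N (fst z) (snd z)\<bar> > \<eta>})"
      using fin by (intro card_eq_sum[symmetric]) simp
    also have "{z \<in> S \<times> S. \<bar>overlap N (fst z) (snd z)\<bar> > \<eta>} = bad_pairs N \<eta> S"
      by (auto simp: bad_pairs_def)
    finally show ?thesis .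
  qed
  let ?e = "(\<kappa>\<^sup>2 + 4) * \<eta>\<^sup>2"
  have qb: "q \<kappa> (real (hamming_dist N \<sigma> \<tau>) / real N) \<le> (p \<kappa>)\<^sup>2 + ?e + b \<sigma> \<tau>" if "\<sigma> \<in> S" "\<tau> \<in> S" for \<sigma> \<tau>
  proof -
    define \<beta> where "\<beta> = real (hamming_dist N \<sigma> \<tau>) / real N"
    have \<beta>: "0 \<le> \<beta>" "\<beta> \<le> 1" using N hamming_le[of N \<sigma> \<tau>] by (auto simp: \<beta>_def)
    have ov: "overlap N \<sigma> \<tau> = 1 - 2 * \<beta>" using overlap_eq_hamming[OF N] that S by (auto simp: \<beta>_def)
    have e0: "0 \<le> ?e" by simp
    show ?thesis
    proof (cases "\<bar>overlap N \<sigma> \<tau>\<bar> > \<eta>")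
      case True
      have "q \<kappa> \<beta> \<le> 1" using q_bounds(3)[OF \<kappa> \<beta>] p_less_1[OF \<kappa>] by simp
      moreover have "b \<sigma> \<tau> = 1" using True by (simp add: b_def)
      ultimately show ?thesis using e0 zero_le_power2[of "p \<kappa>"] unfolding \<beta>_def by linarith
    next
      case False
      then have "(2 * \<beta> - 1)\<^sup>2 \<le> \<eta>\<^sup>2"
        using power_mono[of "\<bar>1 - 2 * \<beta>\<bar>" \<eta> 2] ov by (simp add: power2_commute)
      then have "(\<kappa>\<^sup>2 + 4) * (2 * \<beta> - 1)\<^sup>2 \<le> ?e" by (intro mult_left_mono) auto
      moreover have "b \<sigma> \<tau> = 0" using False by (simp add: b_def)
      ultimately show ?thesis using q_bounds(4)[OF \<kappa> \<beta>] unfolding \<beta>_def by linarith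
    qed
  qed
  have ER2: "(\<integral>y. (R y)\<^sup>2 \<partial>gaussian_row N) \<le> (p \<kappa>)\<^sup>2 + ?e + real (card (bad_pairs N \<eta> S)) / n\<^sup>2"
  proof -
    have "(\<integral>y. (R y)\<^sup>2 \<partial>gaussian_row N) = (\<Sum>\<sigma>\<in>S. \<Sum>\<tau>\<in>S. \<integral>y. s \<sigma> y * s \<tau> y \<partial>gaussian_row N) / n\<^sup>2"
      unfolding R2 by (simp add: i2)
    also have "\<dots> \<le> (\<Sum>\<sigma>\<in>S. \<Sum>\<tau>\<in>S. (p \<kappa>)\<^sup>2 + ?e + b \<sigma> \<tau>) / n\<^sup>2"
      using E2 qb by (intro divide_right_mono sum_mono) auto
    also have "(\<Sum>\<sigma>\<in>S. \<Sum>\<tau>\<in>S. (p \<kappa>)\<^sup>2 + ?e + b \<sigma> \<tau>) = n\<^sup>2 * ((p \<kappa>)\<^sup>2 + ?e) + real (card (bad_pairs N \<eta> S))"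
    proof -
      define t0 where "t0 = (p \<kappa>)\<^sup>2 + ?e"
      have "(\<Sum>\<sigma>\<in>S. \<Sum>\<tau>\<in>S. t0 + b \<sigma> \<tau>) = n * (n * t0) + (\<Sum>\<sigma>\<in>S. \<Sum>\<tau>\<in>S. b \<sigma> \<tau>)"
        by (simp add: sum.distrib n_def)
      then show ?thesis unfolding bsum t0_def by (simp only: power2_eq_square mult.assoc)
    qed
    also have "\<dots> / n\<^sup>2 = (p \<kappa>)\<^sup>2 + ?e + real (card (bad_pairs N \<eta> S)) / n\<^sup>2"
      using n by (simp add: add_divide_distrib)
    finally show ?thesis .
  qed
  \<comment> \<open>The majorant, with the square multiplied out to make it a combination of R and
    R^2. It must also be nonnegative below the cutoff, where the integrand is 0; r \<le> p ensures
    this.\<close>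
  define g where "g = (\<lambda>y. 2 - R y / p \<kappa> + (p \<kappa> / r) * ((R y)\<^sup>2 / (p \<kappa>)\<^sup>2 - 2 * (R y / p \<kappa>) + 1))"
  have g_sq: "g y = 2 - R y / p \<kappa> + (p \<kappa> / r) * (R y / p \<kappa> - 1)\<^sup>2" for y
    by (simp add: g_def power2_diff power_divide)
  have g0: "0 \<le> g y" if "R y < r" for y
  proof -
    have "R y / p \<kappa> \<le> 1" using that r pp by simp
    moreover have "0 \<le> (p \<kappa> / r) * (R y / p \<kappa> - 1)\<^sup>2" using pp r by simp
    ultimately show ?thesis unfolding g_sq by linarith
  qed
  have g1: "p \<kappa> / R y \<le> g y" if "r \<le> R y" for y
  proof -
    define x where "x = R y / p \<kappa>"
    have x: "x > 0" "p \<kappa> / R y = 1 / x" using that r pp by (auto simp: x_def)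
    have "1 / x = 2 - x + (1 / x) * (x - 1)\<^sup>2" using x by (simp add: field_simps power2_eq_square)
    moreover have "1 / x \<le> p \<kappa> / r" using that r pp by (simp add: x_def frac_le)
    then have "(1 / x) * (x - 1)\<^sup>2 \<le> (p \<kappa> / r) * (x - 1)\<^sup>2" by (rule mult_right_mono) simp
    ultimately show ?thesis unfolding g_sq x(2) x_def[symmetric] by linarith
  qed
  have g0': "0 \<le> g y" for y
  proof (cases "R y < r")
    case False
    then have "0 \<le> p \<kappa> / R y" using r pp by simp
    then show ?thesis using g1[of y] False by linarith
  qed (rule g0)
  have ig: "integrable (gaussian_row N) g" unfolding g_def using iR iR2 by auto
  have "(\<integral>\<^sup>+y. (if r * real (card S) \<le> real (card {\<sigma>\<in>S. sat \<kappa> N y \<sigma>})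
        then ennreal (real (card S) * p \<kappa> / real (card {\<sigma>\<in>S. sat \<kappa> N y \<sigma>})) else 0) \<partial>gaussian_row N)
      \<le> (\<integral>\<^sup>+y. ennreal (g y) \<partial>gaussian_row N)"
  proof (intro nn_integral_mono)
    fix y
    show "(if r * real (card S) \<le> real (card {\<sigma>\<in>S. sat \<kappa> N y \<sigma>})
        then ennreal (real (card S) * p \<kappa> / real (card {\<sigma>\<in>S. sat \<kappa> N y \<sigma>})) else 0) \<le> ennreal (g y)"
      unfolding c n_def[symmetric] using n g1[of y] by (auto intro!: ennreal_leI simp: mult.commute[of r])
  qed
  also have "\<dots> = ennreal (\<integral>y. g y \<partial>gaussian_row N)"
    using ig g0' by (intro nn_integral_eq_integral) auto
  also have "(\<integral>y. g y \<partial>gaussian_row N) = 1 + (p \<kappa> / r) * ((\<integral>y. (R y)\<^sup>2 \<partial>gaussian_row N) / (p \<kappa>)\<^sup>2 - 1)"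
    unfolding g_def using iR iR2 pp by (simp add: ER row.prob_space)
  also have "\<dots> \<le> 1 + (?e + real (card (bad_pairs N \<eta> S)) / n\<^sup>2) / (p \<kappa> * r)"
  proof -
    have "(p \<kappa> / r) * ((\<integral>y. (R y)\<^sup>2 \<partial>gaussian_row N) / (p \<kappa>)\<^sup>2 - 1) = ((\<integral>y. (R y)\<^sup>2 \<partial>gaussian_row N) - (p \<kappa>)\<^sup>2) / (p \<kappa> * r)"
      using pp r by (simp add: field_simps power2_eq_square)
    also have "\<dots> \<le> (?e + real (card (bad_pairs N \<eta> S)) / n\<^sup>2) / (p \<kappa> * r)"
      using ER2 pp r by (intro divide_right_mono) auto
    finally show ?thesis by simp
  qed
  finally show ?thesis unfolding n_def by (simp add: ennreal_leI)
qed

section \<open>Measurability of the random solution set\<close>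

lemma measurable_sols:
  assumes "s \<le> t"
  shows "(\<lambda>X. sols \<kappa> N s X) \<in> rows N t \<rightarrow>\<^sub>M count_space (Pow (cube N))"
proof -
  have sat: "Measurable.pred (rows N t) (\<lambda>X. \<sigma> \<in> sols \<kappa> N s X)" for \<sigma>
  proof -
    have "Measurable.pred (rows N t) (\<lambda>X. \<forall>i\<in>{..<s}. sat \<kappa> N (X i) \<sigma>)"
    proof (rule pred_intros_finite)
      fix i assume "i \<in> {..<s}"
      then have "i < t" using assms by simp
      then show "Measurable.pred (rows N t) (\<lambda>X. sat \<kappa> N (X i) \<sigma>)" by (rule measurable_sat_component)
    qed simp
    moreover have "(\<lambda>X. \<sigma> \<in> sols \<kappa> N s X) = (\<lambda>X. \<sigma> \<in> cube N \<and> (\<forall>i\<in>{..<s}. sat \<kappa> N (X i) \<sigma>))"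
      by (simp add: sols_def Ball_def fun_eq_iff)
    ultimately show ?thesis by (cases "\<sigma> \<in> cube N") simp_all
  qed
  have iff: "(sols \<kappa> N s X = S) = (\<forall>\<sigma>\<in>cube N. (\<sigma> \<in> sols \<kappa> N s X) = (\<sigma> \<in> S))"
    if S: "S \<subseteq> cube N" for S X
  proof (rule iffI)
    assume h: "\<forall>\<sigma>\<in>cube N. (\<sigma> \<in> sols \<kappa> N s X) = (\<sigma> \<in> S)"
    have "sols \<kappa> N s X = {\<sigma> \<in> cube N. \<sigma> \<in> sols \<kappa> N s X}" using sols_subset[of \<kappa> N s X] by blast
    also have "\<dots> = {\<sigma> \<in> cube N. \<sigma> \<in> S}" by (rule Collect_cong) (use h in blast)
    also have "\<dots> = S" using S by blast
    finally show "sols \<kappa> N s X = S" .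
  qed (erule ssubst, rule ballI, rule refl)
  have pred: "{X \<in> space (rows N t). sols \<kappa> N s X = S} \<in> sets (rows N t)" if S: "S \<subseteq> cube N" for S
  proof -
    have "Measurable.pred (rows N t) (\<lambda>X. \<forall>\<sigma>\<in>cube N. (\<sigma> \<in> sols \<kappa> N s X) = (\<sigma> \<in> S))"
    proof (rule pred_intros_finite)
      fix \<sigma>
      show "Measurable.pred (rows N t) (\<lambda>X. (\<sigma> \<in> sols \<kappa> N s X) = (\<sigma> \<in> S))"
      proof (cases "\<sigma> \<in> S")
        case True
        then have "(\<lambda>X. (\<sigma> \<in> sols \<kappa> N s X) = (\<sigma> \<in> S)) = (\<lambda>X. \<sigma> \<in> sols \<kappa> N s X)" by (simp only: simp_thms)
        then show ?thesis using sat[of \<sigma>] by (simp only:)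
      next
        case False
        then have "(\<lambda>X. (\<sigma> \<in> sols \<kappa> N s X) = (\<sigma> \<in> S)) = (\<lambda>X. \<not> \<sigma> \<in> sols \<kappa> N s X)" by (simp only: simp_thms)
        then show ?thesis using pred_intros_logic(2)[OF sat[of \<sigma>]] by (simp only:)
      qed
    qed (rule finite_cube)
    then show ?thesis unfolding iff[OF S] pred_def .
  qed
  show ?thesis
  proof (rule measurableI)
    fix X show "sols \<kappa> N s X \<in> space (count_space (Pow (cube N)))"
      unfolding space_count_space by (rule PowI[OF sols_subset])
  next
    fix A assume "A \<in> sets (count_space (Pow (cube N)))"
    then have A: "A \<subseteq> Pow (cube N)" by simp
    have "(\<lambda>X. sols \<kappa> N s X) -` A \<inter> space (rows N t) = (\<Union>S\<in>A. {X \<in> space (rows N t). sols \<kappa> N s X = S})"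
      by blast
    also have "\<dots> \<in> sets (rows N t)"
      by (rule sets.finite_UN) (use A pred finite_subset[OF A] in auto)
    finally show "(\<lambda>X. sols \<kappa> N s X) -` A \<inter> space (rows N t) \<in> sets (rows N t)" .
  qed
qed

text \<open>The solution set takes finitely many values in a discrete space, so every function of it
  is measurable. Most measurability goals below about counts of solutions and of pairs reduce to
  this.\<close>

lemma measurable_fun_sols:
  assumes "s \<le> t" "\<And>S. f S \<in> space M"
  shows "(\<lambda>X. f (sols \<kappa> N s X)) \<in> rows N t \<rightarrow>\<^sub>M M"
  by (rule measurable_compose[OF measurable_sols[OF assms(1)]]) (use assms(2) in auto)

lemma sols_update: "s \<le> t \<Longrightarrow> sols \<kappa> N s (X(t := y)) = sols \<kappa> N s X"
  by (auto simp: sols_def)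

lemma sols_Suc_update: "sols \<kappa> N (Suc t) (X(t := y)) = {\<sigma> \<in> sols \<kappa> N t X. sat \<kappa> N y \<sigma>}"
  by (auto simp: sols_def less_Suc_eq)

lemma sols_0: "sols \<kappa> N 0 X = cube N"
  by (simp add: sols_def)

lemma mean_sols_pos: "\<kappa> > 0 \<Longrightarrow> mean_sols \<kappa> N t > 0"
  using p_pos by (simp add: mean_sols_def)

lemma mean_sols_Suc: "mean_sols \<kappa> N (Suc t) = p \<kappa> * mean_sols \<kappa> N t"
  by (simp add: mean_sols_def)

lemma one_le_sum3: "a = 1 \<or> b = 1 \<or> c = 1 \<Longrightarrow> 1 \<le> a + b + (c :: ennreal)"
proof (elim disjE)
  assume "b = 1"
  then have "a + b + c = 1 + (a + c)" by (simp add: ac_simps)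
  then show ?thesis unfolding le_iff_add by blast
next
  assume "c = 1"
  then have "a + b + c = 1 + (a + b)" by (simp add: ac_simps)
  then show ?thesis unfolding le_iff_add by blast
next
  assume "a = 1"
  then have "a + b + c = 1 + (b + c)" by (simp add: ac_simps)
  then show ?thesis unfolding le_iff_add by blast
qed

section \<open>Adding the rows one at a time\<close>

lemma nn_integral_rows_one: "(\<integral>\<^sup>+X. 1 \<partial>rows N t) = 1"
  using prob_space.emeasure_space_1[OF prob_space_rows[of t N]] by simp

lemma nn_integral_rows_Suc:
  assumes "f \<in> borel_measurable (rows N (Suc t))"
  shows "(\<integral>\<^sup>+X. f X \<partial>rows N (Suc t)) = (\<integral>\<^sup>+X. \<integral>\<^sup>+y. f (X(t := y)) \<partial>gaussian_row N \<partial>rows N t)"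
proof -
  interpret R: product_prob_space "\<lambda>_. gaussian_row N" UNIV
    by (intro product_prob_spaceI prob_space_gaussian_row)
  show ?thesis
    using R.product_nn_integral_insert[of "{..<t}" t f] assms by (simp add: lessThan_Suc)
qed

text \<open>Separates the induction over rows from the choice of parameters. A count below exp (- L
  t) times its mean is regarded as too small; \<eta> t is the overlap threshold, \<epsilon> the
  tolerated fraction of bad pairs, v t the relative growth of the inverse moment, \<delta>1 and
  \<delta>2 the failure probabilities per row. \<open>drift\<close> lets L pay for the growth
  v.\<close>

locale solution_process =
  fixes \<kappa> r \<epsilon> \<delta>1 \<delta>2 :: real and N m :: nat and L \<eta> v :: "nat \<Rightarrow> real"
  assumes \<kappa>: "\<kappa> > 0" and N: "N > 0" and r: "r > 0"
    and nonneg: "0 \<le> \<delta>1" "0 \<le> \<delta>2" "\<And>t. 0 \<le> v t"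
    and step_inverse: "\<And>S t. t < m \<Longrightarrow> S \<subseteq> cube N \<Longrightarrow> S \<noteq> {} \<Longrightarrow>
        real (card (bad_pairs N (\<eta> t) S)) \<le> \<epsilon> * (real (card S))\<^sup>2 \<Longrightarrow>
        (\<integral>\<^sup>+y. (if r * real (card S) \<le> real (card {\<sigma>\<in>S. sat \<kappa> N y \<sigma>})
        then ennreal (real (card S) * p \<kappa> / real (card {\<sigma>\<in>S. sat \<kappa> N y \<sigma>})) else 0) \<partial>gaussian_row N)
        \<le> ennreal (1 + v t)"
    and step_tail: "\<And>S t. t < m \<Longrightarrow> S \<subseteq> cube N \<Longrightarrow> S \<noteq> {} \<Longrightarrow>
        real (card (bad_pairs N (\<eta> t) S)) \<le> \<epsilon> * (real (card S))\<^sup>2 \<Longrightarrow>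
        emeasure (gaussian_row N) {y \<in> space (gaussian_row N). real (card {\<sigma>\<in>S. sat \<kappa> N y \<sigma>}) < r * real (card S)} \<le> ennreal \<delta>1"
    and pairs: "\<And>t. t < m \<Longrightarrow> emeasure (rows N t) {X \<in> space (rows N t).
        \<epsilon> * (exp (- L t) * mean_sols \<kappa> N t)\<^sup>2 < real (card (bad_pairs N (\<eta> t) (sols \<kappa> N t X)))} \<le> ennreal \<delta>2"
    and \<epsilon>: "0 \<le> \<epsilon>"
    and drift: "\<And>t. t < m \<Longrightarrow> v t \<le> L (Suc t) - L t"
begin

definition Z :: "nat \<Rightarrow> (nat \<Rightarrow> nat \<Rightarrow> real) \<Rightarrow> real" where
  "Z t X = real (card (sols \<kappa> N t X))"

lemma Z_update: "s \<le> t \<Longrightarrow> Z s (X(t := y)) = Z s X"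
  by (simp add: Z_def sols_update)

lemma Z_Suc_update: "Z (Suc t) (X(t := y)) = real (card {\<sigma> \<in> sols \<kappa> N t X. sat \<kappa> N y \<sigma>})"
  by (simp add: Z_def sols_Suc_update)

lemma Z_0: "Z 0 X = 2 ^ N"
  by (simp add: Z_def sols_0 card_cube)

abbreviation "EZ t \<equiv> mean_sols \<kappa> N t"

text \<open>Bad pairs are compared with a deterministic threshold, so that their expectation
  controls the failure by Markov's inequality. Since Z is at least exp (- L t) times its mean, the
  bound relative to Z^2 needed for the next row follows.\<close>

definition good :: "nat \<Rightarrow> (nat \<Rightarrow> nat \<Rightarrow> real) \<Rightarrow> bool" where
  "good t X \<longleftrightarrow> exp (- L t) * EZ t \<le> Z t X \<and>
     real (card (bad_pairs N (\<eta> t) (sols \<kappa> N t X))) \<le> \<epsilon> * (exp (- L t) * EZ t)\<^sup>2"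

text \<open>The truncation event. It is determined by the first t rows and forces Z t to be
  positive, so EZ t / Z t involves no division by zero there.\<close>

definition typical :: "nat \<Rightarrow> (nat \<Rightarrow> nat \<Rightarrow> real) \<Rightarrow> bool" where
  "typical t X \<longleftrightarrow> (\<forall>s\<in>{..<t}. good s X \<and> r * Z s X \<le> Z (Suc s) X)"

lemma goodD:
  assumes "good t X"
  shows "Z t X > 0" "sols \<kappa> N t X \<noteq> {}" "real (card (bad_pairs N (\<eta> t) (sols \<kappa> N t X))) \<le> \<epsilon> * (Z t X)\<^sup>2"
proof -
  have pos: "0 < exp (- L t) * EZ t" using mean_sols_pos[OF \<kappa>] by simp
  have le: "exp (- L t) * EZ t \<le> Z t X" using assms by (simp add: good_def)
  show Z: "Z t X > 0" using pos le by linarith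
  then show "sols \<kappa> N t X \<noteq> {}" by (auto simp: Z_def)
  have "(exp (- L t) * EZ t)\<^sup>2 \<le> (Z t X)\<^sup>2" using pos le by (intro power_mono) auto
  then have "\<epsilon> * (exp (- L t) * EZ t)\<^sup>2 \<le> \<epsilon> * (Z t X)\<^sup>2" using \<epsilon> by (rule mult_left_mono)
  then show "real (card (bad_pairs N (\<eta> t) (sols \<kappa> N t X))) \<le> \<epsilon> * (Z t X)\<^sup>2"
    using assms unfolding good_def by linarith
qed

lemma typical_Z_pos: assumes "typical t X" shows "Z t X > 0"
proof (cases t)
  case 0
  then show ?thesis by (simp add: Z_0)
next
  case (Suc s)
  then have "good s X" "r * Z s X \<le> Z t X" using assms by (auto simp: typical_def)
  moreover have "0 < r * Z s X" using goodD(1)[OF \<open>good s X\<close>] r by simp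
  ultimately show ?thesis by linarith
qed

lemma good_update: "good t (X(t := y)) = good t X"
  by (simp add: good_def sols_update Z_update)

lemma typical_Suc_update:
  "typical (Suc t) (X(t := y)) \<longleftrightarrow> typical t X \<and> good t X \<and>
     r * Z t X \<le> real (card {\<sigma> \<in> sols \<kappa> N t X. sat \<kappa> N y \<sigma>})"
proof -
  have "typical t (X(t := y)) = typical t X"
    unfolding typical_def good_def by (intro ball_cong refl) (simp add: sols_update Z_update)
  moreover have "typical (Suc t) Y \<longleftrightarrow> typical t Y \<and> good t Y \<and> r * Z t Y \<le> Z (Suc t) Y" for Y
    unfolding typical_def lessThan_Suc by auto
  ultimately show ?thesis by (simp add: good_update Z_update Z_Suc_update)
qed

lemma measurable_good: "s \<le> t \<Longrightarrow> Measurable.pred (rows N t) (good s)"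
  unfolding good_def [abs_def] Z_def [abs_def] by (rule measurable_fun_sols) auto

lemma measurable_Z: "s \<le> t \<Longrightarrow> Z s \<in> borel_measurable (rows N t)"
  unfolding Z_def [abs_def] by (rule measurable_fun_sols) auto

lemma measurable_typical [measurable]: "Measurable.pred (rows N t) (typical t)"
  unfolding typical_def [abs_def]
proof (rule pred_intros_finite)
  fix s assume "s \<in> {..<t}"
  then have "s \<le> t" "Suc s \<le> t" by auto
  from \<open>s \<le> t\<close> have "Measurable.pred (rows N t) (good s)" by (rule measurable_good)
  moreover have "Measurable.pred (rows N t) (\<lambda>X. r * Z s X \<le> Z (Suc s) X)"
    unfolding pred_def
    by (intro borel_measurable_le borel_measurable_times borel_measurable_const measurable_Z \<open>s \<le> t\<close> \<open>Suc s \<le> t\<close>)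
  ultimately show "Measurable.pred (rows N t) (\<lambda>X. good s X \<and> r * Z s X \<le> Z (Suc s) X)"
    by (rule pred_intros_logic)
qed simp

definition inv_moment :: "nat \<Rightarrow> ennreal" where
  "inv_moment t = (\<integral>\<^sup>+X. (if typical t X then ennreal (EZ t / Z t X) else 0) \<partial>rows N t)"

text \<open>Given the first t rows, EZ / Z is multiplied by p times the old count over the new one;
  on \<open>good t\<close> the average of this factor over the new row is at most 1 + v t.\<close>

lemma inv_moment_Suc:
  assumes "t < m"
  shows "inv_moment (Suc t) \<le> inv_moment t * ennreal (1 + v t)"
proof -
  note [measurable] = measurable_Z[OF order_refl]
  have "inv_moment (Suc t) = (\<integral>\<^sup>+X. \<integral>\<^sup>+y. (if typical (Suc t) (X(t := y)) then ennreal (EZ (Suc t) / Z (Suc t) (X(t := y))) else 0)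
      \<partial>gaussian_row N \<partial>rows N t)"
    unfolding inv_moment_def by (rule nn_integral_rows_Suc) measurable
  also have "\<dots> \<le> (\<integral>\<^sup>+X. (if typical t X then ennreal (EZ t / Z t X) else 0) * ennreal (1 + v t) \<partial>rows N t)"
  proof (intro nn_integral_mono)
    fix X
    let ?c = "\<lambda>y. real (card {\<sigma> \<in> sols \<kappa> N t X. sat \<kappa> N y \<sigma>})"
    show "(\<integral>\<^sup>+y. (if typical (Suc t) (X(t := y)) then ennreal (EZ (Suc t) / Z (Suc t) (X(t := y))) else 0) \<partial>gaussian_row N)
        \<le> (if typical t X then ennreal (EZ t / Z t X) else 0) * ennreal (1 + v t)"
    proof (cases "typical t X \<and> good t X")
      case True
      have Zp: "Z t X > 0" using goodD(1) True by blast
      have "(\<integral>\<^sup>+y. (if typical (Suc t) (X(t := y)) then ennreal (EZ (Suc t) / Z (Suc t) (X(t := y))) else 0) \<partial>gaussian_row N)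
          = (\<integral>\<^sup>+y. ennreal (EZ t / Z t X) * (if r * Z t X \<le> ?c y then ennreal (Z t X * p \<kappa> / ?c y) else 0) \<partial>gaussian_row N)"
      proof (intro nn_integral_cong)
        fix y
        have "ennreal (EZ t / Z t X) * ennreal (Z t X * p \<kappa> / ?c y) = ennreal (p \<kappa> * EZ t / ?c y)"
          using Zp mean_sols_pos[OF \<kappa>, of N t] p_pos[OF \<kappa>]
          by (subst ennreal_mult[symmetric]) (auto simp: field_simps)
        then show "(if typical (Suc t) (X(t := y)) then ennreal (EZ (Suc t) / Z (Suc t) (X(t := y))) else 0)
          = ennreal (EZ t / Z t X) * (if r * Z t X \<le> ?c y then ennreal (Z t X * p \<kappa> / ?c y) else 0)"
          using True by (simp add: typical_Suc_update Z_Suc_update mean_sols_Suc)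
      qed
      also have "\<dots> = ennreal (EZ t / Z t X) * (\<integral>\<^sup>+y. (if r * Z t X \<le> ?c y then ennreal (Z t X * p \<kappa> / ?c y) else 0) \<partial>gaussian_row N)"
      proof (rule nn_integral_cmult)
        have [measurable]: "?c \<in> borel_measurable (gaussian_row N)"
          unfolding card_eq_sum[OF finite_sols] by measurable
        show "(\<lambda>y. if r * Z t X \<le> ?c y then ennreal (Z t X * p \<kappa> / ?c y) else 0) \<in> borel_measurable (gaussian_row N)"
          by measurable
      qed
      also have "\<dots> \<le> ennreal (EZ t / Z t X) * ennreal (1 + v t)"
        using True unfolding Z_def
        by (intro mult_left_mono step_inverse[OF assms sols_subset goodD(2) goodD(3)[unfolded Z_def]]) auto
      finally show ?thesis using True by simp
    next
      case False
      then have "\<not> typical (Suc t) (X(t := y))" for y by (auto simp: typical_Suc_update)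
      then show ?thesis by simp
    qed
  qed
  also have "\<dots> = inv_moment t * ennreal (1 + v t)"
    unfolding inv_moment_def by (rule nn_integral_multc) measurable
  finally show ?thesis .
qed

lemma inv_moment_le: "t \<le> m \<Longrightarrow> inv_moment t \<le> ennreal (exp (L t - L 0))"
proof (induction t)
  case 0
  have "inv_moment 0 \<le> (\<integral>\<^sup>+X. 1 \<partial>rows N 0)"
    unfolding inv_moment_def
    by (intro nn_integral_mono) (simp add: Z_0 mean_sols_def)
  also have "\<dots> = 1" by (rule nn_integral_rows_one)
  finally show ?case by simp
next
  case (Suc t)
  have "inv_moment (Suc t) \<le> inv_moment t * ennreal (1 + v t)" by (rule inv_moment_Suc) (use Suc in simp)
  also have "\<dots> \<le> ennreal (exp (L t - L 0)) * ennreal (exp (L (Suc t) - L t))"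
  proof (intro mult_mono Suc.IH ennreal_leI)
    have "1 + v t \<le> exp (v t)" by (rule exp_ge_add_one_self)
    also have "\<dots> \<le> exp (L (Suc t) - L t)" using drift[of t] Suc.prems by simp
    finally show "1 + v t \<le> exp (L (Suc t) - L t)" .
  qed (use Suc in auto)
  also have "\<dots> = ennreal (exp (L (Suc t) - L 0))"
    by (simp add: ennreal_mult[symmetric] mult_exp_exp)
  finally show ?case .
qed

text \<open>Markov's inequality for the truncated EZ / Z. Its bound exp (L t - L 0) and the
  threshold exp (L t) grow together, so the failure probability is exp (- L 0) at every
  time.\<close>

lemma few_solutions:
  assumes "t \<le> m"
  shows "emeasure (rows N t) {X \<in> space (rows N t). typical t X \<and> Z t X < exp (- L t) * EZ t} \<le> ennreal (exp (- L 0))"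
proof -
  note [measurable] = measurable_Z[OF order_refl]
  let ?E = "{X \<in> space (rows N t). typical t X \<and> Z t X < exp (- L t) * EZ t}"
  have "emeasure (rows N t) ?E = (\<integral>\<^sup>+X. indicator ?E X \<partial>rows N t)"
    by (rule nn_integral_indicator[symmetric]) measurable
  also have "\<dots> \<le> (\<integral>\<^sup>+X. ennreal (exp (- L t)) * (if typical t X then ennreal (EZ t / Z t X) else 0) \<partial>rows N t)"
  proof (intro nn_integral_mono)
    fix X
    show "indicator ?E X \<le> ennreal (exp (- L t)) * (if typical t X then ennreal (EZ t / Z t X) else 0)"
    proof (cases "X \<in> ?E")
      case True
      then have Zp: "Z t X > 0" using typical_Z_pos by blast
      then have "1 \<le> exp (- L t) * (EZ t / Z t X)" using True by (simp add: field_simps)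
      then have "ennreal 1 \<le> ennreal (exp (- L t)) * ennreal (EZ t / Z t X)"
        using Zp mean_sols_pos[OF \<kappa>, of N t] by (subst ennreal_mult[symmetric]) (auto intro!: ennreal_leI)
      then show ?thesis using True by simp
    qed simp
  qed
  also have "\<dots> = ennreal (exp (- L t)) * inv_moment t"
    unfolding inv_moment_def by (rule nn_integral_cmult) measurable
  also have "\<dots> \<le> ennreal (exp (- L t)) * ennreal (exp (L t - L 0))"
    by (intro mult_left_mono inv_moment_le assms) simp
  also have "\<dots> = ennreal (exp (- L 0))" by (simp add: ennreal_mult[symmetric] mult_exp_exp)
  finally show ?thesis .
qed

text \<open>A failure at step t + 1 is an earlier failure (F), too few solutions (G), too many bad
  pairs (H), or a new row that keeps too small a fraction; the last has conditional probability at
  most \<delta>1.\<close>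

lemma not_typical:
  "t \<le> m \<Longrightarrow> emeasure (rows N t) {X \<in> space (rows N t). \<not> typical t X} \<le> ennreal (real t * (exp (- L 0) + \<delta>1 + \<delta>2))"
proof (induction t)
  case 0
  have eq: "{X \<in> space (rows N 0). \<not> typical 0 X} = {}" by (simp add: typical_def)
  show ?case unfolding eq by simp
next
  case (Suc t)
  note [measurable] = measurable_Z[OF order_refl]
  define F where "F = {X \<in> space (rows N t). \<not> typical t X}"
  define G where "G = {X \<in> space (rows N t). typical t X \<and> Z t X < exp (- L t) * EZ t}"
  define H where "H = {X \<in> space (rows N t). \<epsilon> * (exp (- L t) * EZ t)\<^sup>2 < real (card (bad_pairs N (\<eta> t) (sols \<kappa> N t X)))}"
  have Hm: "H \<in> sets (rows N t)"
  proof -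
    have "Measurable.pred (rows N t) (\<lambda>X. \<epsilon> * (exp (- L t) * EZ t)\<^sup>2 < real (card (bad_pairs N (\<eta> t) (sols \<kappa> N t X))))"
      by (rule measurable_fun_sols) auto
    then show ?thesis by (simp only: pred_def H_def)
  qed
  have Fm: "F \<in> sets (rows N t)" and Gm: "G \<in> sets (rows N t)" unfolding F_def G_def by measurable
  interpret R: prob_space "rows N t" by (rule prob_space_rows)
  have "emeasure (rows N (Suc t)) {X \<in> space (rows N (Suc t)). \<not> typical (Suc t) X} =
      (\<integral>\<^sup>+X. indicator {X \<in> space (rows N (Suc t)). \<not> typical (Suc t) X} X \<partial>rows N (Suc t))"
    by (rule nn_integral_indicator[symmetric]) measurable
  also have "\<dots> = (\<integral>\<^sup>+X. (if typical (Suc t) X then 0 else 1) \<partial>rows N (Suc t))"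
    by (rule nn_integral_cong) (simp add: indicator_def)
  also have "\<dots> = (\<integral>\<^sup>+X. \<integral>\<^sup>+y. (if typical (Suc t) (X(t := y)) then 0 else 1) \<partial>gaussian_row N \<partial>rows N t)"
    by (rule nn_integral_rows_Suc) measurable
  also have "\<dots> \<le> (\<integral>\<^sup>+X. indicator F X + indicator G X + indicator H X + ennreal \<delta>1 \<partial>rows N t)"
  proof (rule nn_integral_mono)
    fix X assume X: "X \<in> space (rows N t)"
    define c where "c = (\<lambda>y. real (card {\<sigma> \<in> sols \<kappa> N t X. sat \<kappa> N y \<sigma>}))"
    have upd: "typical (Suc t) (X(t := y)) \<longleftrightarrow> typical t X \<and> good t X \<and> r * Z t X \<le> c y" for y
      unfolding c_def by (rule typical_Suc_update)
    show "(\<integral>\<^sup>+y. (if typical (Suc t) (X(t := y)) then 0 else 1) \<partial>gaussian_row N)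
        \<le> indicator F X + indicator G X + indicator H X + ennreal \<delta>1"
    proof (cases "typical t X \<and> good t X")
      case True
      have c_meas [measurable]: "c \<in> borel_measurable (gaussian_row N)"
        unfolding c_def card_eq_sum[OF finite_sols] by measurable
      define E where "E = {y \<in> space (gaussian_row N). c y < r * Z t X}"
      have "(\<integral>\<^sup>+y. (if typical (Suc t) (X(t := y)) then 0 else 1) \<partial>gaussian_row N)
          = (\<integral>\<^sup>+y. indicator E y \<partial>gaussian_row N)"
      proof (rule nn_integral_cong)
        fix y assume "y \<in> space (gaussian_row N)"
        then show "(if typical (Suc t) (X(t := y)) then 0 else 1) = (indicator E y :: ennreal)"
          using True unfolding upd by (simp add: E_def indicator_def not_le)
      qed
      also have "\<dots> = emeasure (gaussian_row N) E"
        by (rule nn_integral_indicator) (simp only: E_def, measurable)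
      also have "\<dots> \<le> ennreal \<delta>1"
        unfolding E_def c_def Z_def
        by (rule step_tail[OF _ sols_subset goodD(2) goodD(3)[unfolded Z_def]]) (use True Suc.prems in simp_all)
      finally show ?thesis by (rule order_trans) simp
    next
      case False
      have "(\<integral>\<^sup>+y. (if typical (Suc t) (X(t := y)) then 0 else 1) \<partial>gaussian_row N) \<le> (\<integral>\<^sup>+y. 1 \<partial>gaussian_row N)"
        by (rule nn_integral_mono) simp
      also have "\<dots> = 1" using row.emeasure_space_1[of N] by simp
      also have "1 \<le> indicator F X + indicator G X + (indicator H X :: ennreal)"
      proof -
        have "X \<in> F \<or> X \<in> G \<or> X \<in> H"
          using False X unfolding F_def G_def H_def good_def not_le[symmetric] mem_Collect_eq by blast
        then have "indicator F X = (1::ennreal) \<or> indicator G X = (1::ennreal) \<or> indicator H X = (1::ennreal)"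
          by (metis indicator_simps(1))
        then show ?thesis by (rule one_le_sum3)
      qed
      also have "\<dots> \<le> indicator F X + indicator G X + indicator H X + ennreal \<delta>1" by simp
      finally show ?thesis .
    qed
  qed
  also have "\<dots> = emeasure (rows N t) F + emeasure (rows N t) G + emeasure (rows N t) H + ennreal \<delta>1"
  proof -
    show ?thesis
      by (simp only: nn_integral_add borel_measurable_add borel_measurable_const borel_measurable_indicator
        nn_integral_indicator Fm Gm Hm nn_integral_const R.emeasure_space_1 mult_1_right)
  qed
  also have "\<dots> \<le> ennreal (real t * (exp (- L 0) + \<delta>1 + \<delta>2)) + ennreal (exp (- L 0)) + ennreal \<delta>2 + ennreal \<delta>1"
  proof (intro add_mono order_refl)
    show "emeasure (rows N t) F \<le> ennreal (real t * (exp (- L 0) + \<delta>1 + \<delta>2))"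
      unfolding F_def using Suc by simp
    show "emeasure (rows N t) G \<le> ennreal (exp (- L 0))"
      unfolding G_def by (rule few_solutions) (use Suc.prems in simp)
    show "emeasure (rows N t) H \<le> ennreal \<delta>2"
      unfolding H_def by (rule pairs) (use Suc.prems in simp)
  qed
  also have "\<dots> = ennreal (real t * (exp (- L 0) + \<delta>1 + \<delta>2) + exp (- L 0) + \<delta>2 + \<delta>1)"
    using nonneg by (simp only: ennreal_plus add_nonneg_nonneg mult_nonneg_nonneg of_nat_0_le_iff exp_ge_zero)
  also have "real t * (exp (- L 0) + \<delta>1 + \<delta>2) + exp (- L 0) + \<delta>2 + \<delta>1 = real (Suc t) * (exp (- L 0) + \<delta>1 + \<delta>2)"
    by (simp add: algebra_simps)
  finally show ?case .
qed

lemma many_solutions: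
  "emeasure (rows N m) {X \<in> space (rows N m). Z m X < exp (- L m) * EZ m}
     \<le> ennreal (real m * (exp (- L 0) + \<delta>1 + \<delta>2) + exp (- L 0))"
proof -
  note [measurable] = measurable_Z[OF order_refl]
  define F where "F = {X \<in> space (rows N m). \<not> typical m X}"
  define G where "G = {X \<in> space (rows N m). typical m X \<and> Z m X < exp (- L m) * EZ m}"
  have Fm: "F \<in> sets (rows N m)" and Gm: "G \<in> sets (rows N m)" unfolding F_def G_def by measurable
  have "{X \<in> space (rows N m). Z m X < exp (- L m) * EZ m} \<subseteq> F \<union> G" unfolding F_def G_def by blast
  then have "emeasure (rows N m) {X \<in> space (rows N m). Z m X < exp (- L m) * EZ m} \<le> emeasure (rows N m) (F \<union> G)"
    by (rule emeasure_mono) (rule sets.Un[OF Fm Gm])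
  also have "\<dots> \<le> emeasure (rows N m) F + emeasure (rows N m) G"
    by (rule emeasure_subadditive[OF Fm Gm])
  also have "\<dots> \<le> ennreal (real m * (exp (- L 0) + \<delta>1 + \<delta>2)) + ennreal (exp (- L 0))"
    unfolding F_def G_def by (rule add_mono[OF not_typical[OF order_refl] few_solutions[OF order_refl]])
  also have "\<dots> = ennreal (real m * (exp (- L 0) + \<delta>1 + \<delta>2) + exp (- L 0))"
    using nonneg by (intro ennreal_plus[symmetric]) auto
  finally show ?thesis .
qed

end

lemma solutions_eq_sols: "solutions \<kappa> \<alpha> N X = sols \<kappa> N (num_constraints \<alpha> N) X"
  by (auto simp: solutions_def sols_def slab_def sat_def)

lemma hamming_pos:
  assumes "\<sigma> \<in> cube N" "\<tau> \<in> cube N" "\<sigma> \<noteq> \<tau>"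
  shows "0 < hamming_dist N \<sigma> \<tau>"
proof -
  have "\<exists>i<N. \<sigma> i \<noteq> \<tau> i"
  proof (rule ccontr)
    assume "\<not> (\<exists>i<N. \<sigma> i \<noteq> \<tau> i)"
    then have "\<sigma> = \<tau>"
      by (intro PiE_ext[OF assms(1,2)[unfolded cube_def]]) simp
    then show False using assms(3) by simp
  qed
  then have "{i \<in> {..<N}. \<sigma> i \<noteq> \<tau> i} \<noteq> {}" by auto
  then show ?thesis unfolding hamming_dist_def by (simp add: card_gt_0_iff)
qed

lemma hamming_flip:
  assumes "\<sigma> \<in> cube N" "i < N"
  shows "hamming_dist N \<sigma> (\<sigma>(i := - \<sigma> i)) = 1"
proof -
  have "{j \<in> {..<N}. \<sigma> j \<noteq> (\<sigma>(i := - \<sigma> i)) j} = {i}"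
    using cubeD[OF assms] assms(2) by auto
  then show ?thesis by (simp add: hamming_dist_def)
qed

section \<open>The joint law of the disorder and a sampled solution\<close>

context
  fixes \<kappa> \<alpha> :: real and N :: nat
begin

abbreviation (input) "m \<equiv> num_constraints \<alpha> N"
abbreviation (input) "joint_space \<equiv> rows N m \<Otimes>\<^sub>M count_space (cube N)"
abbreviation (input) "sample_kernel X \<equiv> distr (uniform_count_measure (sols \<kappa> N m X)) joint_space (\<lambda>\<sigma>. (X, \<sigma>))"
abbreviation (input) "solvable \<equiv> {X \<in> space (rows N m). sols \<kappa> N m X \<noteq> {}}"

lemma sample_law_eq: "sample_law \<kappa> \<alpha> N = uniform_measure (rows N m) solvable \<bind> (\<lambda>X. sample_kernel X)"
  unfolding sample_law_def disorder_def solutions_eq_sols ..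

lemma emeasure_kernel:
  assumes X: "X \<in> space (rows N m)" and E: "E \<in> sets joint_space"
  shows "emeasure (sample_kernel X) E = ennreal (real (card {\<sigma> \<in> sols \<kappa> N m X. (X, \<sigma>) \<in> E}) / real (card (sols \<kappa> N m X)))"
proof -
  let ?S = "sols \<kappa> N m X"
  have "(\<lambda>\<sigma>. (X, \<sigma>)) \<in> count_space ?S \<rightarrow>\<^sub>M joint_space"
    using X subsetD[OF sols_subset[of \<kappa> N m X]] by (simp add: space_pair_measure Pi_iff)
  moreover have "sets (uniform_count_measure ?S) = sets (count_space ?S)"
    by (simp add: sets_uniform_count_measure)
  ultimately have "(\<lambda>\<sigma>. (X, \<sigma>)) \<in> uniform_count_measure ?S \<rightarrow>\<^sub>M joint_space"
    by (subst measurable_cong_sets[OF _ refl])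
  then have "emeasure (sample_kernel X) E = emeasure (uniform_count_measure ?S) ((\<lambda>\<sigma>. (X, \<sigma>)) -` E \<inter> ?S)"
    using E by (simp add: emeasure_distr space_uniform_count_measure)
  also have "(\<lambda>\<sigma>. (X, \<sigma>)) -` E \<inter> ?S = {\<sigma> \<in> ?S. (X, \<sigma>) \<in> E}" by auto
  also have "emeasure (uniform_count_measure ?S) {\<sigma> \<in> ?S. (X, \<sigma>) \<in> E} = ennreal (real (card {\<sigma> \<in> ?S. (X, \<sigma>) \<in> E}) / real (card ?S))"
    by (rule emeasure_uniform_count_measure) auto
  finally show ?thesis .
qed

text \<open>If X has no solution, the kernel at X is the null measure, since 0 / 0 = 0. Hence it is
  a subprobability kernel, and conditioning on solvability is what restores total mass 1.\<close>

lemma measurable_kernel: "(\<lambda>X. sample_kernel X) \<in> rows N m \<rightarrow>\<^sub>M subprob_algebra joint_space"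
proof (rule measurable_subprob_algebra)
  fix X assume X: "X \<in> space (rows N m)"
  show "subprob_space (sample_kernel X)"
  proof
    have "emeasure (sample_kernel X) (space joint_space) \<le> ennreal 1"
      unfolding emeasure_kernel[OF X sets.top]
      by (rule ennreal_leI) (auto simp: divide_le_eq_1 card_gt_0_iff intro!: card_mono)
    then show "emeasure (sample_kernel X) (space (sample_kernel X)) \<le> 1" by simp
    have "space (rows N m) \<noteq> {}" using X by auto
    moreover have "cube N \<noteq> {}" using card_cube[of N] by auto
    ultimately show "space (sample_kernel X) \<noteq> {}" by (simp add: space_pair_measure)
  qed
  show "sets (sample_kernel X) = sets joint_space" by simp
next
  fix E assume E: "E \<in> sets joint_space"
  have c: "real (card {\<sigma> \<in> sols \<kappa> N m X. (X, \<sigma>) \<in> E}) = (\<Sum>\<sigma>\<in>cube N. if \<sigma> \<in> sols \<kappa> N m X \<and> (X, \<sigma>) \<in> E then 1 else 0)" for X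
  proof -
    have "{\<sigma> \<in> sols \<kappa> N m X. (X, \<sigma>) \<in> E} = {\<sigma> \<in> cube N. \<sigma> \<in> sols \<kappa> N m X \<and> (X, \<sigma>) \<in> E}"
      using sols_subset[of \<kappa> N m X] by blast
    then show ?thesis using card_eq_sum[OF finite_cube] by simp
  qed
  have p1: "Measurable.pred (rows N m) (\<lambda>X. \<sigma> \<in> sols \<kappa> N m X \<and> (X, \<sigma>) \<in> E)" if "\<sigma> \<in> cube N" for \<sigma>
  proof -
    have "(\<lambda>X. (X, \<sigma>)) \<in> rows N m \<rightarrow>\<^sub>M joint_space" using that by (intro measurable_Pair2') simp
    from measurable_sets[OF this E] have "Measurable.pred (rows N m) (\<lambda>X. (X, \<sigma>) \<in> E)"
      unfolding pred_def by (rule back_subst[where P = "\<lambda>A. A \<in> sets (rows N m)"]) blast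
    then show ?thesis using measurable_in_sols by (intro pred_intros_logic)
  qed
  have num: "(\<lambda>X. real (card {\<sigma> \<in> sols \<kappa> N m X. (X, \<sigma>) \<in> E})) \<in> borel_measurable (rows N m)"
    unfolding c using p1 by (intro borel_measurable_sum measurable_If) (auto simp: pred_def)
  have den: "(\<lambda>X. real (card (sols \<kappa> N m X))) \<in> borel_measurable (rows N m)"
    by (rule measurable_fun_sols) auto
  have "(\<lambda>X. ennreal (real (card {\<sigma> \<in> sols \<kappa> N m X. (X, \<sigma>) \<in> E}) / real (card (sols \<kappa> N m X)))) \<in> borel_measurable (rows N m)"
    using num den by (intro measurable_compose[OF _ measurable_ennreal] borel_measurable_divide)
  then show "(\<lambda>X. emeasure (sample_kernel X) E) \<in> borel_measurable (rows N m)"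
    by (subst measurable_cong[OF emeasure_kernel[OF _ E]])
qed

lemma solvable_sets: "solvable \<in> sets (rows N m)"
proof -
  have "Measurable.pred (rows N m) (\<lambda>X. sols \<kappa> N m X \<noteq> {})" by (rule measurable_fun_sols) auto
  then show ?thesis by (simp add: pred_def)
qed

lemma rows_nonempty: "space (rows N m) \<noteq> {}"
  by (rule prob_space.not_empty[OF prob_space_rows])

lemma space_sample_law: "space (sample_law \<kappa> \<alpha> N) = space joint_space"
  and sets_sample_law: "sets (sample_law \<kappa> \<alpha> N) = sets joint_space"
  unfolding sample_law_eq using rows_nonempty by (simp_all add: space_bind sets_bind)

lemma emeasure_sample_law:
  assumes E: "E \<in> sets joint_space"
  shows "emeasure (sample_law \<kappa> \<alpha> N) E =
    (\<integral>\<^sup>+X. ennreal (real (card {\<sigma> \<in> sols \<kappa> N m X. (X, \<sigma>) \<in> E}) / real (card (sols \<kappa> N m X))) * indicator solvable X \<partial>rows N m)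
      / emeasure (rows N m) solvable"
proof -
  let ?U = "uniform_measure (rows N m) solvable"
  have k: "(\<lambda>X. sample_kernel X) \<in> ?U \<rightarrow>\<^sub>M subprob_algebra joint_space"
    using measurable_kernel by (simp cong: measurable_cong_sets)
  have ke: "(\<lambda>X. emeasure (sample_kernel X) E) \<in> borel_measurable (rows N m)"
    using measurable_emeasure_subprob_algebra[OF E] measurable_kernel by (rule measurable_compose[rotated])
  have "emeasure (sample_law \<kappa> \<alpha> N) E = (\<integral>\<^sup>+X. emeasure (sample_kernel X) E \<partial>?U)"
    unfolding sample_law_eq using rows_nonempty k E by (intro emeasure_bind) auto
  also have "\<dots> = (\<integral>\<^sup>+X. emeasure (sample_kernel X) E * indicator solvable X \<partial>rows N m) / emeasure (rows N m) solvable"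
    by (rule nn_integral_uniform_measure[OF ke solvable_sets])
  also have "(\<integral>\<^sup>+X. emeasure (sample_kernel X) E * indicator solvable X \<partial>rows N m) =
    (\<integral>\<^sup>+X. ennreal (real (card {\<sigma> \<in> sols \<kappa> N m X. (X, \<sigma>) \<in> E}) / real (card (sols \<kappa> N m X))) * indicator solvable X \<partial>rows N m)"
    using emeasure_kernel[OF _ E] by (intro nn_integral_cong) simp
  finally show ?thesis .
qed

lemma prob_space_sample_law:
  assumes "emeasure (rows N m) solvable \<noteq> 0"
  shows "prob_space (sample_law \<kappa> \<alpha> N)"
proof
  interpret R: prob_space "rows N m" by (rule prob_space_rows)
  have "emeasure (sample_law \<kappa> \<alpha> N) (space joint_space) =
      (\<integral>\<^sup>+X. indicator solvable X \<partial>rows N m) / emeasure (rows N m) solvable"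
  proof (subst emeasure_sample_law[OF sets.top], rule arg_cong2[where f = "(/)"], intro nn_integral_cong refl)
    fix X assume X: "X \<in> space (rows N m)"
    have "{\<sigma> \<in> sols \<kappa> N m X. (X, \<sigma>) \<in> space joint_space} = sols \<kappa> N m X"
      using X sols_subset[of \<kappa> N m X] by (auto simp: space_pair_measure)
    then show "ennreal (real (card {\<sigma> \<in> sols \<kappa> N m X. (X, \<sigma>) \<in> space joint_space}) / real (card (sols \<kappa> N m X))) * indicator solvable X
        = indicator solvable X"
      by (auto simp: indicator_def)
  qed simp
  also have "\<dots> = 1"
    unfolding nn_integral_indicator[OF solvable_sets]
    by (rule ennreal_divide_self[OF assms less_top[THEN iffD1, OF R.emeasure_finite]])
  finally show "emeasure (sample_law \<kappa> \<alpha> N) (space (sample_law \<kappa> \<alpha> N)) = 1"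
    by (simp only: space_sample_law)
qed

text \<open>Such an event depends on X only through the solution set, so it is pulled back from a
  finite discrete space.\<close>

lemma sets_joint_Collect:
  "{(X, \<sigma>) \<in> space joint_space. G (sols \<kappa> N m X) \<sigma>} \<in> sets joint_space"
proof -
  have "(\<lambda>z. (sols \<kappa> N m (fst z), snd z)) \<in> joint_space \<rightarrow>\<^sub>M count_space (Pow (cube N)) \<Otimes>\<^sub>M count_space (cube N)"
    by (intro measurable_Pair measurable_compose[OF measurable_fst measurable_sols[OF order_refl]] measurable_snd)
  also have "count_space (Pow (cube N)) \<Otimes>\<^sub>M count_space (cube N) = count_space (Pow (cube N) \<times> cube N)"
    by (rule pair_measure_countable) (auto intro: countable_finite)
  finally have "(\<lambda>z. (case (sols \<kappa> N m (fst z), snd z) of (S, \<sigma>) \<Rightarrow> G S \<sigma>)) \<in> joint_space \<rightarrow>\<^sub>M count_space UNIV"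
    by (rule measurable_compose) simp
  then show ?thesis by (simp add: pred_def case_prod_unfold)
qed

text \<open>Given X, the sampled vector fails with probability equal to the failing fraction of
  solutions, at most K / z once there are at least z of them. Averaging gives a + b / z, where a
  pays for fewer than z solutions. Conditioning on solvability, an event of probability at least 1 -
  a \<ge> 1/2, costs a factor of at most 2.\<close>

lemma sample_law_lower_bound:
  fixes G :: "(nat \<Rightarrow> real) set \<Rightarrow> (nat \<Rightarrow> real) \<Rightarrow> bool" and K :: "(nat \<Rightarrow> real) set \<Rightarrow> real"
  assumes z: "z > 0" and a: "0 \<le> a" "a \<le> 1/2" and b: "0 \<le> b"
    and few: "emeasure (rows N m) {X \<in> space (rows N m). real (card (sols \<kappa> N m X)) < z} \<le> ennreal a"
    and K: "\<And>X. real (card {\<sigma> \<in> sols \<kappa> N m X. \<not> G (sols \<kappa> N m X) \<sigma>}) \<le> K (sols \<kappa> N m X)"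
    and int: "(\<integral>\<^sup>+X. ennreal (K (sols \<kappa> N m X)) \<partial>rows N m) \<le> ennreal b"
  shows "prob_space (sample_law \<kappa> \<alpha> N)"
    and "1 - 2 * (a + b / z) \<le> measure (sample_law \<kappa> \<alpha> N)
      {(X, \<sigma>) \<in> space (sample_law \<kappa> \<alpha> N). G (sols \<kappa> N m X) \<sigma>}"
proof -
  interpret R: prob_space "rows N m" by (rule prob_space_rows)
  define Lo where "Lo = {X \<in> space (rows N m). real (card (sols \<kappa> N m X)) < z}"
  have Lo: "Lo \<in> sets (rows N m)"
  proof -
    have "Measurable.pred (rows N m) (\<lambda>X. real (card (sols \<kappa> N m X)) < z)" by (rule measurable_fun_sols) auto
    then show ?thesis unfolding Lo_def pred_def .
  qed
  note few' = few[folded Lo_def]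
  have pLo: "R.prob Lo \<le> a" using few' a(1) unfolding R.emeasure_eq_measure by simp
  define s where "s = R.prob solvable"
  have "R.prob (space (rows N m) - Lo) \<le> R.prob solvable"
  proof (rule R.finite_measure_mono[OF _ solvable_sets], rule subsetI)
    fix X assume X: "X \<in> space (rows N m) - Lo"
    then have X1: "X \<in> space (rows N m)" and X2: "\<not> real (card (sols \<kappa> N m X)) < z" unfolding Lo_def by blast+
    have "sols \<kappa> N m X \<noteq> {}"
    proof
      assume "sols \<kappa> N m X = {}"
      then show False using X2 z by simp
    qed
    with X1 show "X \<in> solvable" by blast
  qed
  then have s: "1/2 \<le> s" unfolding s_def R.prob_compl[OF Lo] using pLo a by linarith
  then have s0: "s > 0" by simp
  have es: "emeasure (rows N m) solvable = ennreal s" unfolding s_def by (rule R.emeasure_eq_measure)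
  have "emeasure (rows N m) solvable \<noteq> 0" unfolding es using s0 by simp
  then show ps: "prob_space (sample_law \<kappa> \<alpha> N)" by (rule prob_space_sample_law)
  interpret L: prob_space "sample_law \<kappa> \<alpha> N" by (rule ps)
  define E where "E = {(X, \<sigma>) \<in> space joint_space. \<not> G (sols \<kappa> N m X) \<sigma>}"
  have E: "E \<in> sets joint_space" unfolding E_def by (rule sets_joint_Collect[of "\<lambda>S \<sigma>. \<not> G S \<sigma>"])
  have E_iff: "(X, \<sigma>) \<in> E \<longleftrightarrow> (X, \<sigma>) \<in> space joint_space \<and> \<not> G (sols \<kappa> N m X) \<sigma>" for X \<sigma>
    unfolding E_def by (simp only: mem_Collect_eq prod.case)
  have kz: "ennreal (1 / z) * ennreal k = ennreal (k / z)" if "0 \<le> k" for k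
    by (subst ennreal_mult[symmetric]) (use z that in auto)
  have ind: "y * indicator A X \<le> y" for y :: ennreal and A and X :: "nat \<Rightarrow> nat \<Rightarrow> real"
    by (simp add: indicator_def)
  have quot: "c / n \<le> 1" if "0 \<le> c" "c \<le> n" for c n :: real
    using that by (cases "n = 0") (auto simp: divide_le_eq_1)
  have I: "(\<integral>\<^sup>+X. ennreal (real (card {\<sigma> \<in> sols \<kappa> N m X. (X, \<sigma>) \<in> E}) / real (card (sols \<kappa> N m X))) * indicator solvable X \<partial>rows N m)
      \<le> ennreal (a + b / z)" (is "?I \<le> _")
  proof -
    have "?I \<le> (\<integral>\<^sup>+X. indicator Lo X + ennreal (1 / z) * ennreal (K (sols \<kappa> N m X)) \<partial>rows N m)"
    proof (rule nn_integral_mono)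
      fix X assume X: "X \<in> space (rows N m)"
      define S where "S = sols \<kappa> N m X"
      have fS: "finite S" unfolding S_def by (rule finite_sols)
      have "(X, \<sigma>) \<in> space joint_space" if "\<sigma> \<in> S" for \<sigma>
        unfolding space_pair_measure space_count_space using X that sols_subset[of \<kappa> N m X] unfolding S_def by blast
      then have cE: "{\<sigma> \<in> S. (X, \<sigma>) \<in> E} = {\<sigma> \<in> S. \<not> G S \<sigma>}" unfolding E_iff S_def by blast
      define c where "c = real (card {\<sigma> \<in> S. \<not> G S \<sigma>})"
      have c: "0 \<le> c" "c \<le> real (card S)" using card_mono[OF fS, of "{\<sigma> \<in> S. \<not> G S \<sigma>}"] by (auto simp: c_def)
      have cK: "c \<le> K S" using K[of X] unfolding c_def S_def .
      have "ennreal (c / real (card S)) \<le> indicator Lo X + ennreal (1 / z) * ennreal (K S)"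
      proof (cases "real (card S) < z")
        case True
        then have "X \<in> Lo" using X unfolding Lo_def S_def by blast
        then have "(1 :: ennreal) \<le> indicator Lo X + ennreal (1 / z) * ennreal (K S)" by (simp add: add_increasing2)
        moreover have "ennreal (c / real (card S)) \<le> 1" using quot[OF c] by (simp add: ennreal_le_1)
        ultimately show ?thesis by (rule order_trans[rotated])
      next
        case False
        then have "c / real (card S) \<le> K S / z" using c cK z by (intro frac_le) auto
        then have "ennreal (c / real (card S)) \<le> ennreal (1 / z) * ennreal (K S)"
          using c cK by (subst kz) (auto intro: ennreal_leI)
        then show ?thesis by (rule order_trans) (simp add: add_increasing)
      qed
      then show "ennreal (real (card {\<sigma> \<in> sols \<kappa> N m X. (X, \<sigma>) \<in> E}) / real (card (sols \<kappa> N m X))) * indicator solvable X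
          \<le> indicator Lo X + ennreal (1 / z) * ennreal (K (sols \<kappa> N m X))"
        unfolding S_def[symmetric] cE c_def[symmetric] by (rule order_trans[OF ind])
    qed
    also have "\<dots> = (\<integral>\<^sup>+X. indicator Lo X \<partial>rows N m) + (\<integral>\<^sup>+X. ennreal (1 / z) * ennreal (K (sols \<kappa> N m X)) \<partial>rows N m)"
      by (rule nn_integral_add, rule borel_measurable_indicator[OF Lo], rule measurable_fun_sols) auto
    also have "(\<integral>\<^sup>+X. ennreal (1 / z) * ennreal (K (sols \<kappa> N m X)) \<partial>rows N m)
        = ennreal (1 / z) * (\<integral>\<^sup>+X. ennreal (K (sols \<kappa> N m X)) \<partial>rows N m)"
      by (rule nn_integral_cmult, rule measurable_fun_sols) auto
    also have "(\<integral>\<^sup>+X. indicator Lo X \<partial>rows N m) = emeasure (rows N m) Lo" by (rule nn_integral_indicator[OF Lo])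
    also have "emeasure (rows N m) Lo + ennreal (1 / z) * (\<integral>\<^sup>+X. ennreal (K (sols \<kappa> N m X)) \<partial>rows N m)
        \<le> ennreal a + ennreal (1 / z) * ennreal b"
      by (rule add_mono[OF few' mult_left_mono[OF int]]) simp
    also have "\<dots> = ennreal (a + b / z)" unfolding kz[OF b] by (rule ennreal_plus[symmetric]) (use a b z in auto)
    finally show ?thesis .
  qed
  have "emeasure (sample_law \<kappa> \<alpha> N) E \<le> ennreal (a + b / z) / ennreal s"
    unfolding emeasure_sample_law[OF E] es by (rule divide_right_mono_ennreal[OF I])
  also have "\<dots> = ennreal ((a + b / z) / s)" using a b z s0 by (intro divide_ennreal) auto
  also have "\<dots> \<le> ennreal (2 * (a + b / z))"
  proof (rule ennreal_leI)
    have ab: "0 \<le> a + b / z" using a b z by simp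
    have "(a + b / z) * 1 \<le> (a + b / z) * (2 * s)" using s ab by (intro mult_left_mono) auto
    then show "(a + b / z) / s \<le> 2 * (a + b / z)" using s0 by (simp add: pos_divide_le_eq algebra_simps)
  qed
  finally have "L.prob E \<le> 2 * (a + b / z)"
    unfolding L.emeasure_eq_measure using a b z by (subst (asm) ennreal_le_iff) auto
  moreover have "{(X, \<sigma>) \<in> space (sample_law \<kappa> \<alpha> N). G (sols \<kappa> N m X) \<sigma>} = space (sample_law \<kappa> \<alpha> N) - E"
  proof (rule set_eqI)
    fix w :: "(nat \<Rightarrow> nat \<Rightarrow> real) \<times> (nat \<Rightarrow> real)"
    obtain X \<sigma> where w: "w = (X, \<sigma>)" by (cases w)
    show "w \<in> {(X, \<sigma>) \<in> space (sample_law \<kappa> \<alpha> N). G (sols \<kappa> N m X) \<sigma>} \<longleftrightarrow> w \<in> space (sample_law \<kappa> \<alpha> N) - E"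
      unfolding w Diff_iff E_iff space_sample_law mem_Collect_eq prod.case by blast
  qed
  moreover have "L.prob (space (sample_law \<kappa> \<alpha> N) - E) = 1 - L.prob E"
    by (rule L.prob_compl) (simp only: sets_sample_law E)
  ultimately show "1 - 2 * (a + b / z) \<le> L.prob {(X, \<sigma>) \<in> space (sample_law \<kappa> \<alpha> N). G (sols \<kappa> N m X) \<sigma>}"
    by simp
qed

end

lemma markov_real:
  assumes f: "f \<in> borel_measurable M" and a: "a > 0" and b: "0 \<le> b"
    and int: "(\<integral>\<^sup>+x. ennreal (f x) \<partial>M) \<le> ennreal b"
  shows "emeasure M {x \<in> space M. a < f x} \<le> ennreal (b / a)"
proof -
  have m: "{x \<in> space M. a < f x} \<in> sets M" using f by measurable
  have "emeasure M {x \<in> space M. a < f x} = (\<integral>\<^sup>+x. indicator {x \<in> space M. a < f x} x \<partial>M)"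
    by (rule nn_integral_indicator[OF m, symmetric])
  also have "\<dots> \<le> (\<integral>\<^sup>+x. ennreal (1 / a) * ennreal (f x) \<partial>M)"
  proof (rule nn_integral_mono)
    fix x assume "x \<in> space M"
    show "indicator {x \<in> space M. a < f x} x \<le> ennreal (1 / a) * ennreal (f x)"
    proof (cases "a < f x")
      case True
      then have "1 \<le> f x / a" using a by simp
      moreover have "ennreal (1 / a) * ennreal (f x) = ennreal (f x / a)"
        using True a by (subst ennreal_mult[symmetric]) auto
      ultimately show ?thesis by (simp add: indicator_def)
    qed simp
  qed
  also have "\<dots> = ennreal (1 / a) * (\<integral>\<^sup>+x. ennreal (f x) \<partial>M)" using f by (intro nn_integral_cmult) measurable
  also have "\<dots> \<le> ennreal (1 / a) * ennreal b" by (rule mult_left_mono[OF int]) simp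
  also have "\<dots> = ennreal (b / a)" using a b by (subst ennreal_mult[symmetric]) auto
  finally show ?thesis .
qed

section \<open>Choice of the parameters and polynomial concentration\<close>

context frozen_regime
begin

text \<open>A discrete Gronwall argument. Making bad pairs rare even when Z is short by exp (- L)
  requires \<eta>^2 of order L / N; the inverse moment then grows by at most \<mu> L / N per row,
  and L has to absorb this growth. The recursion multiplies L by 1 + \<mu> / N per row, hence by at
  most E over \<alpha> N rows.\<close>

lemma concentration:
  obtains \<Lambda> e where "\<Lambda> > 0" "e \<longlonglongrightarrow> 0"
    "\<forall>\<^sub>F N in sequentially. 0 \<le> e N \<and> emeasure (rows N (num_constraints \<alpha> N)) {X \<in> space (rows N (num_constraints \<alpha> N)).
       real (card (sols \<kappa> N (num_constraints \<alpha> N) X)) < exp (- (\<Lambda> * ln (real N + 1))) * mean_sols \<kappa> N (num_constraints \<alpha> N)} \<le> ennreal (e N)"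
proof -
  obtain c where c: "c > 0" and pe: "\<And>N t \<eta>. N > 0 \<Longrightarrow> t \<le> num_constraints \<alpha> N \<Longrightarrow> 0 \<le> \<eta> \<Longrightarrow>
      (\<integral>\<^sup>+X. ennreal (real (card {(\<sigma>, \<tau>) \<in> sols \<kappa> N t X \<times> sols \<kappa> N t X.
          \<eta> < \<bar>1 - 2 * (real (hamming_dist N \<sigma> \<tau>) / real N)\<bar>})) \<partial>rows N t)
        \<le> ennreal (real (N + 1) * exp (- c * real N * \<eta>\<^sup>2) * (mean_sols \<kappa> N t)\<^sup>2)"
    by (fact bad_pair_expectation)
  obtain C r0 where C: "C > 0" and r0: "r0 > 0" and tail: "\<And>N S \<eta>. N > 0 \<Longrightarrow> S \<subseteq> cube N \<Longrightarrow> S \<noteq> {} \<Longrightarrow> 0 \<le> \<eta> \<Longrightarrow> \<eta> \<le> 1/6 \<Longrightarrow>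
      measure (gaussian_row N) {x \<in> space (gaussian_row N). real (card {\<sigma>\<in>S. sat \<kappa> N x \<sigma>}) < r0 * real (card S)}
        \<le> C * (\<eta> ^ 3 + real (card (bad_pairs N \<eta> S)) / (real (card S))\<^sup>2)"
    by (fact fraction_lower_tail[OF \<kappa>_pos])
  \<comment> \<open>The inverse moment needs a cutoff of at most P, the tail estimate one of at most
    r0.\<close>
  define r where "r = min r0 P"
  have r: "0 < r" "r \<le> P" "r \<le> r0" using r0 P_pos by (auto simp: r_def)
  \<comment> \<open>With \<eta>^2 = \<theta> L / N the expected relative number of bad pairs decays
    like exp (- 5 L); dividing by the squared shortfall exp (- 2 L) leaves exp (- 3 L).\<close>
  define \<theta> where "\<theta> = 5 / c"
  have \<theta>: "\<theta> > 0" using c by (simp add: \<theta>_def)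
  define \<mu> where "\<mu> = ((\<kappa>\<^sup>2 + 4) * \<theta> + 1) / (P * r)"
  have "0 < (\<kappa>\<^sup>2 + 4) * \<theta> + 1" using \<theta> by (intro add_nonneg_pos mult_nonneg_nonneg) auto
  then have \<mu>: "\<mu> > 0" using P_pos r by (simp add: \<mu>_def)
  define E where "E = exp (\<mu> * \<alpha>)"
  have E: "E > 0" by (simp add: E_def)
  \<comment> \<open>\<alpha> N times the failure probability per row, plus exp (- l) for the final
    count. The terms per row are of order N^(-2), (ln N / N)^(3/2), N^(-2) and N^(-3), all o(1 /
    N).\<close>
  define e where "e = (\<lambda>N. \<alpha> * real N * (exp (- (2 * ln (real N + 1))) + C * (sqrt (\<theta> * (2 * ln (real N + 1) * E) / real N) ^ 3 + 1 / (real N + 1)\<^sup>2)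
      + (real N + 1) ^ 3 * exp (- (3 * (2 * ln (real N + 1))))) + exp (- (2 * ln (real N + 1))))"
  have e_lim: "e \<longlonglongrightarrow> 0"
    unfolding e_def using \<theta> E C \<alpha>_pos by real_asymp
  have ev: "\<forall>\<^sub>F N in sequentially. N > 0 \<and> 1 \<le> 2 * ln (real N + 1) \<and> sqrt (\<theta> * (2 * ln (real N + 1) * E) / real N) \<le> 1/6"
  proof (intro eventually_conj)
    show "\<forall>\<^sub>F N in sequentially. 1 \<le> 2 * ln (real N + 1)" by real_asymp
    show "\<forall>\<^sub>F N in sequentially. sqrt (\<theta> * (2 * ln (real N + 1) * E) / real N) \<le> 1/6" using \<theta> E by real_asymp
  qed (rule eventually_gt_at_top)
  show ?thesis
  proof (rule that[of "2 * E" e])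
    show "2 * E > 0" using E by simp
    show "e \<longlonglongrightarrow> 0" by (fact e_lim)
    show "\<forall>\<^sub>F N in sequentially. 0 \<le> e N \<and> emeasure (rows N (num_constraints \<alpha> N)) {X \<in> space (rows N (num_constraints \<alpha> N)).
       real (card (sols \<kappa> N (num_constraints \<alpha> N) X)) < exp (- (2 * E * ln (real N + 1))) * mean_sols \<kappa> N (num_constraints \<alpha> N)} \<le> ennreal (e N)"
      using ev
    proof (rule eventually_mono)
      fix N :: nat
      assume "N > 0 \<and> 1 \<le> 2 * ln (real N + 1) \<and> sqrt (\<theta> * (2 * ln (real N + 1) * E) / real N) \<le> 1/6"
      then have N: "N > 0" and L0: "1 \<le> 2 * ln (real N + 1)" and \<eta>s: "sqrt (\<theta> * (2 * ln (real N + 1) * E) / real N) \<le> 1/6" by auto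
      define m where "m = num_constraints \<alpha> N"
      have m: "real m \<le> \<alpha> * real N" unfolding m_def by (rule num_constraints_le[OF \<alpha>_pos])
      define l where "l = 2 * ln (real N + 1)"
      have l: "1 \<le> l" using L0 by (simp add: l_def)
      \<comment> \<open>Small enough for N \<epsilon> to tend to 0 in the union over rows and for
        \<epsilon> \<le> L / N in the drift, yet only polynomially small, so that dividing by it in
        Markov's inequality is affordable.\<close>
      define \<epsilon> where "\<epsilon> = 1 / (real N + 1)\<^sup>2"
      have \<epsilon>: "0 < \<epsilon>" by (simp add: \<epsilon>_def)
      \<comment> \<open>The solution of L (Suc t) - L t = \<mu> L t / N with initial value l = 2 ln
        (N + 1), which makes exp (- L 0) equal to (N + 1)^(-2).\<close>
      define L where "L = (\<lambda>t::nat. l * (1 + \<mu> / real N) ^ t)"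
      define \<eta> where "\<eta> = (\<lambda>t. sqrt (\<theta> * L t / real N))"
      define v where "v = (\<lambda>t. ((\<kappa>\<^sup>2 + 4) * (\<eta> t)\<^sup>2 + \<epsilon>) / (P * r))"
      define \<eta>' where "\<eta>' = sqrt (\<theta> * (l * E) / real N)"
      have \<eta>': "0 \<le> \<eta>'" "\<eta>' \<le> 1/6" using \<eta>s \<theta> E l by (auto simp: \<eta>'_def l_def)
      define \<delta>1 where "\<delta>1 = C * (\<eta>' ^ 3 + \<epsilon>)"
      define \<delta>2 where "\<delta>2 = (real N + 1) ^ 3 * exp (- (3 * l))"
      have \<mu>N: "0 \<le> \<mu> / real N" using \<mu> by simp
      have L_ge: "l \<le> L t" for t
      proof -
        have "1 \<le> (1 + \<mu> / real N) ^ t" using \<mu>N by (intro one_le_power) simp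
        then have "l * 1 \<le> l * (1 + \<mu> / real N) ^ t" using l by (intro mult_left_mono) auto
        then show ?thesis by (simp add: L_def)
      qed
      have L1: "1 \<le> L t" for t using L_ge[of t] l by linarith
      have L_le: "L t \<le> l * E" if "t \<le> m" for t
      proof -
        have "(1 + \<mu> / real N) ^ t \<le> exp (\<mu> / real N) ^ t" using \<mu>N by (intro power_mono) (auto intro: exp_ge_add_one_self)
        also have "\<dots> = exp (real t * (\<mu> / real N))" by (rule exp_of_nat_mult[symmetric])
        also have "\<dots> \<le> E"
        proof -
          have "real t \<le> \<alpha> * real N" using that m by linarith
          then have "real t * (\<mu> / real N) \<le> \<alpha> * real N * (\<mu> / real N)" using \<mu>N by (rule mult_right_mono)
          also have "\<dots> = \<mu> * \<alpha>" using N by simp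
          finally show ?thesis by (simp add: E_def)
        qed
        finally show ?thesis using l unfolding L_def by (intro mult_left_mono) auto
      qed
      have \<eta>0: "0 \<le> \<eta> t" for t using \<theta> L1[of t] by (simp add: \<eta>_def)
      have \<eta>sq: "(\<eta> t)\<^sup>2 = \<theta> * L t / real N" for t
        using \<theta> L1[of t] by (simp add: \<eta>_def)
      have \<eta>_le: "\<eta> t \<le> \<eta>'" if "t \<le> m" for t
        unfolding \<eta>_def \<eta>'_def using \<theta> L_le[OF that] by (intro real_sqrt_le_mono divide_right_mono mult_left_mono) auto
      have v0: "0 \<le> v t" for t
        unfolding v_def using P_pos r \<epsilon> by (intro divide_nonneg_nonneg add_nonneg_nonneg mult_nonneg_nonneg) auto
      have drift: "v t \<le> L (Suc t) - L t" for t
      proof -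
        have "\<epsilon> \<le> 1 / real N"
          unfolding \<epsilon>_def using N by (intro divide_left_mono mult_pos_pos zero_less_power) (auto simp: power2_eq_square algebra_simps)
        also have "\<dots> \<le> L t / real N" using L1[of t] by (intro divide_right_mono) auto
        finally have "(\<kappa>\<^sup>2 + 4) * (\<eta> t)\<^sup>2 + \<epsilon> \<le> (\<kappa>\<^sup>2 + 4) * (\<theta> * L t / real N) + L t / real N"
          unfolding \<eta>sq by linarith
        also have "\<dots> = ((\<kappa>\<^sup>2 + 4) * \<theta> + 1) * (L t / real N)" by (simp add: algebra_simps)
        finally have "v t \<le> ((\<kappa>\<^sup>2 + 4) * \<theta> + 1) * (L t / real N) / (P * r)"
          unfolding v_def using P_pos r by (intro divide_right_mono) auto
        also have "\<dots> = \<mu> * (L t / real N)" by (simp add: \<mu>_def)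
        also have "\<dots> = L (Suc t) - L t" by (simp add: L_def algebra_simps)
        finally show ?thesis .
      qed
      have frac: "real (card (bad_pairs N (\<eta> t) S)) / (real (card S))\<^sup>2 \<le> \<epsilon>"
        if "S \<subseteq> cube N" "S \<noteq> {}" "real (card (bad_pairs N (\<eta> t) S)) \<le> \<epsilon> * (real (card S))\<^sup>2" for S t
      proof -
        have "finite S" using that(1) finite_cube by (rule finite_subset)
        then have "0 < (real (card S))\<^sup>2" using that(2) by (simp add: card_gt_0_iff)
        then show ?thesis using that(3) by (simp add: pos_divide_le_eq)
      qed
      have sp: "solution_process \<kappa> r \<epsilon> \<delta>1 \<delta>2 N m L \<eta> v"
      proof (rule solution_process.intro)
        show "0 \<le> \<delta>1" unfolding \<delta>1_def using C \<eta>' \<epsilon> by (intro mult_nonneg_nonneg add_nonneg_nonneg zero_le_power) auto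
        show "0 \<le> \<delta>2" by (simp add: \<delta>2_def)
      next
        fix S t
        assume t: "t < m" and S: "S \<subseteq> cube N" "S \<noteq> {}" and B: "real (card (bad_pairs N (\<eta> t) S)) \<le> \<epsilon> * (real (card S))\<^sup>2"
        have "1 + ((\<kappa>\<^sup>2 + 4) * (\<eta> t)\<^sup>2 + real (card (bad_pairs N (\<eta> t) S)) / (real (card S))\<^sup>2) / (P * r) \<le> 1 + v t"
          unfolding v_def using frac[OF S B] P_pos r by (intro add_left_mono divide_right_mono) auto
        then show "(\<integral>\<^sup>+y. (if r * real (card S) \<le> real (card {\<sigma>\<in>S. sat \<kappa> N y \<sigma>})
            then ennreal (real (card S) * p \<kappa> / real (card {\<sigma>\<in>S. sat \<kappa> N y \<sigma>})) else 0) \<partial>gaussian_row N)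
            \<le> ennreal (1 + v t)"
          by (rule order_trans[OF inverse_fraction[OF \<kappa>_pos N S \<eta>0 r(1,2)] ennreal_leI])
        define c1 where "c1 = (\<lambda>y. real (card {\<sigma>\<in>S. sat \<kappa> N y \<sigma>}))"
        have "finite S" using S(1) finite_cube by (rule finite_subset)
        then have c1: "c1 \<in> borel_measurable (gaussian_row N)"
          unfolding c1_def by (subst card_eq_sum) (assumption, measurable)
        have "measure (gaussian_row N) {y \<in> space (gaussian_row N). c1 y < r * real (card S)}
            \<le> measure (gaussian_row N) {y \<in> space (gaussian_row N). c1 y < r0 * real (card S)}"
        proof (rule row.finite_measure_mono)
          have "r * real (card S) \<le> r0 * real (card S)" using r by (intro mult_right_mono) auto
          then show "{y \<in> space (gaussian_row N). c1 y < r * real (card S)} \<subseteq> {y \<in> space (gaussian_row N). c1 y < r0 * real (card S)}"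
            using order.strict_trans2 by blast
          show "{y \<in> space (gaussian_row N). c1 y < r0 * real (card S)} \<in> sets (gaussian_row N)"
            by (rule borel_measurable_less[OF c1 borel_measurable_const])
        qed
        also have "\<dots> \<le> C * ((\<eta> t) ^ 3 + real (card (bad_pairs N (\<eta> t) S)) / (real (card S))\<^sup>2)"
          unfolding c1_def using \<eta>_le[of t] \<eta>' t by (intro tail[OF N S \<eta>0]) linarith
        also have "\<dots> \<le> \<delta>1"
          unfolding \<delta>1_def using C \<eta>_le[of t] t \<eta>0 frac[OF S B] by (intro mult_left_mono add_mono power_mono) auto
        finally show "emeasure (gaussian_row N) {y \<in> space (gaussian_row N). real (card {\<sigma>\<in>S. sat \<kappa> N y \<sigma>}) < r * real (card S)} \<le> ennreal \<delta>1"
          unfolding c1_def row.emeasure_eq_measure by (rule ennreal_leI)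
      next
        fix t assume t: "t < m"
        define M where "M = mean_sols \<kappa> N t"
        have M: "M > 0" unfolding M_def by (rule mean_sols_pos[OF \<kappa>_pos])
        have "emeasure (rows N t) {X \<in> space (rows N t). \<epsilon> * (exp (- L t) * M)\<^sup>2 < real (card (bad_pairs N (\<eta> t) (sols \<kappa> N t X)))}
            \<le> ennreal (real (N + 1) * exp (- c * real N * (\<eta> t)\<^sup>2) * M\<^sup>2 / (\<epsilon> * (exp (- L t) * M)\<^sup>2))"
        proof (rule markov_real)
          show "(\<lambda>X. real (card (bad_pairs N (\<eta> t) (sols \<kappa> N t X)))) \<in> borel_measurable (rows N t)"
            by (rule measurable_fun_sols) auto
          show "(\<integral>\<^sup>+X. ennreal (real (card (bad_pairs N (\<eta> t) (sols \<kappa> N t X)))) \<partial>rows N t)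
              \<le> ennreal (real (N + 1) * exp (- c * real N * (\<eta> t)\<^sup>2) * M\<^sup>2)"
            unfolding bad_pairs_sols[OF N] M_def using t by (intro pe[OF N _ \<eta>0]) (simp add: m_def)
          show "0 < \<epsilon> * (exp (- L t) * M)\<^sup>2" using \<epsilon> M by (intro mult_pos_pos zero_less_power) auto
          show "0 \<le> real (N + 1) * exp (- c * real N * (\<eta> t)\<^sup>2) * M\<^sup>2" by simp
        qed
        also have "\<dots> \<le> ennreal \<delta>2"
        proof (rule ennreal_leI)
          \<comment> \<open>The Markov quotient is (N + 1) exp (- 5 L) / (\<epsilon> exp (- 2 L)),
            and 1 / \<epsilon> supplies the remaining square in (N + 1)^3.\<close>
          have "c * real N * (\<eta> t)\<^sup>2 = 5 * L t" unfolding \<eta>sq \<theta>_def using c N by simp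
          then have ex: "- c * real N * (\<eta> t)\<^sup>2 = - 5 * L t" by (simp only: minus_mult_left[symmetric])
          define x where "x = exp (- L t)"
          have x: "x > 0" by (simp add: x_def)
          have x5: "exp (- 5 * L t) = x ^ 5" unfolding x_def exp_of_nat_mult[symmetric] by simp
          have x3: "exp (- (3 * L t)) = x ^ 3" unfolding x_def exp_of_nat_mult[symmetric] by simp
          have "real (N + 1) * exp (- c * real N * (\<eta> t)\<^sup>2) * M\<^sup>2 / (\<epsilon> * (exp (- L t) * M)\<^sup>2) = (real N + 1) ^ 3 * x ^ 3"
            unfolding ex x5 x_def[symmetric] \<epsilon>_def using x M by (simp add: field_simps power2_eq_square power3_eq_cube eval_nat_numeral)
          also have "\<dots> \<le> \<delta>2"
            unfolding x3[symmetric] \<delta>2_def using L_ge[of t] by (intro mult_left_mono) auto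
          finally show "real (N + 1) * exp (- c * real N * (\<eta> t)\<^sup>2) * M\<^sup>2 / (\<epsilon> * (exp (- L t) * M)\<^sup>2) \<le> \<delta>2" .
        qed
        finally show "emeasure (rows N t) {X \<in> space (rows N t).
            \<epsilon> * (exp (- L t) * mean_sols \<kappa> N t)\<^sup>2 < real (card (bad_pairs N (\<eta> t) (sols \<kappa> N t X)))} \<le> ennreal \<delta>2"
          unfolding M_def .
      qed (use \<kappa>_pos N r v0 \<epsilon> drift in simp_all)
      have "emeasure (rows N m) {X \<in> space (rows N m). real (card (sols \<kappa> N m X)) < exp (- (2 * E * ln (real N + 1))) * mean_sols \<kappa> N m}
          \<le> emeasure (rows N m) {X \<in> space (rows N m). real (card (sols \<kappa> N m X)) < exp (- L m) * mean_sols \<kappa> N m}"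
      proof (rule emeasure_mono)
        have "exp (- (2 * E * ln (real N + 1))) \<le> exp (- L m)" using L_le[of m] by (simp add: l_def algebra_simps)
        then have "exp (- (2 * E * ln (real N + 1))) * mean_sols \<kappa> N m \<le> exp (- L m) * mean_sols \<kappa> N m"
          using mean_sols_pos[OF \<kappa>_pos, of N m] by (intro mult_right_mono) auto
        then show "{X \<in> space (rows N m). real (card (sols \<kappa> N m X)) < exp (- (2 * E * ln (real N + 1))) * mean_sols \<kappa> N m}
            \<subseteq> {X \<in> space (rows N m). real (card (sols \<kappa> N m X)) < exp (- L m) * mean_sols \<kappa> N m}"
          using order.strict_trans2 by blast
        have "Measurable.pred (rows N m) (\<lambda>X. real (card (sols \<kappa> N m X)) < exp (- L m) * mean_sols \<kappa> N m)"
          by (rule measurable_fun_sols) auto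
        then show "{X \<in> space (rows N m). real (card (sols \<kappa> N m X)) < exp (- L m) * mean_sols \<kappa> N m} \<in> sets (rows N m)"
          unfolding pred_def .
      qed
      also have "\<dots> \<le> ennreal (real m * (exp (- L 0) + \<delta>1 + \<delta>2) + exp (- L 0))"
        using solution_process.many_solutions[OF sp] unfolding solution_process.Z_def[OF sp] .
      also have "\<dots> \<le> ennreal (e N)"
      proof (rule ennreal_leI)
        have L0': "L 0 = l" by (simp add: L_def)
        have "0 \<le> \<delta>1 \<and> 0 \<le> \<delta>2" using solution_process.nonneg(1,2)[OF sp] by blast
        then have "real m * (exp (- l) + \<delta>1 + \<delta>2) \<le> \<alpha> * real N * (exp (- l) + \<delta>1 + \<delta>2)"
          using m by (intro mult_right_mono) (auto intro!: add_nonneg_nonneg)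
        moreover have "e N = \<alpha> * real N * (exp (- l) + \<delta>1 + \<delta>2) + exp (- l)"
          unfolding e_def \<delta>1_def \<delta>2_def \<eta>'_def \<epsilon>_def l_def ..
        ultimately show "real m * (exp (- L 0) + \<delta>1 + \<delta>2) + exp (- L 0) \<le> e N" unfolding L0' by linarith
      qed
      finally have "emeasure (rows N m) {X \<in> space (rows N m). real (card (sols \<kappa> N m X)) < exp (- (2 * E * ln (real N + 1))) * mean_sols \<kappa> N m} \<le> ennreal (e N)" .
      moreover have "0 \<le> e N"
        unfolding e_def using \<alpha>_pos C \<eta>'(1) unfolding \<eta>'_def l_def
        by (intro add_nonneg_nonneg mult_nonneg_nonneg zero_le_power) auto
      ultimately show "0 \<le> e N \<and> emeasure (rows N (num_constraints \<alpha> N)) {X \<in> space (rows N (num_constraints \<alpha> N)).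
         real (card (sols \<kappa> N (num_constraints \<alpha> N) X)) < exp (- (2 * E * ln (real N + 1))) * mean_sols \<kappa> N (num_constraints \<alpha> N)} \<le> ennreal (e N)"
        unfolding m_def by blast
    qed
  qed
qed

end

section \<open>Isolation of a sampled solution\<close>

context frozen_regime
begin

definition isolated :: "real \<Rightarrow> nat \<Rightarrow> (nat \<Rightarrow> real) set \<Rightarrow> (nat \<Rightarrow> real) \<Rightarrow> bool" where
  "isolated \<delta> N S \<sigma> \<longleftrightarrow> {\<sigma>' \<in> S. real (hamming_dist N \<sigma> \<sigma>') \<le> (beta_c \<kappa> \<alpha> - \<delta>) * real N} = {\<sigma>}"

text \<open>Each solution that is not isolated is the first component of some close pair of distinct
  solutions, so the projection of these pairs covers all such solutions.\<close>

lemma card_not_isolated_le: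
  assumes S: "S \<subseteq> cube N" and \<delta>: "\<delta> \<le> beta_c \<kappa> \<alpha>"
  shows "card {\<sigma> \<in> S. \<not> isolated \<delta> N S \<sigma>} \<le> card {(\<sigma>, \<tau>) \<in> S \<times> S.
          0 < hamming_dist N \<sigma> \<tau> \<and> real (hamming_dist N \<sigma> \<tau>) \<le> (beta_c \<kappa> \<alpha> - \<delta>) * real N}"
proof -
  let ?R = "{(\<sigma>, \<tau>) \<in> S \<times> S. 0 < hamming_dist N \<sigma> \<tau> \<and> real (hamming_dist N \<sigma> \<tau>) \<le> (beta_c \<kappa> \<alpha> - \<delta>) * real N}"
  have "finite S" using S finite_cube by (rule finite_subset)
  then have fin: "finite ?R" by (intro finite_subset[of ?R "S \<times> S"] finite_cartesian_product) auto
  have "{\<sigma> \<in> S. \<not> isolated \<delta> N S \<sigma>} \<subseteq> fst ` ?R"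
  proof (rule subsetI)
    fix \<sigma> assume a: "\<sigma> \<in> {\<sigma> \<in> S. \<not> isolated \<delta> N S \<sigma>}"
    then have \<sigma>: "\<sigma> \<in> S" and ni: "\<not> isolated \<delta> N S \<sigma>" by blast+
    have "real (hamming_dist N \<sigma> \<sigma>) \<le> (beta_c \<kappa> \<alpha> - \<delta>) * real N" using \<delta> by (simp add: hamming_self)
    then obtain \<tau> where \<tau>: "\<tau> \<in> S" "\<tau> \<noteq> \<sigma>" "real (hamming_dist N \<sigma> \<tau>) \<le> (beta_c \<kappa> \<alpha> - \<delta>) * real N"
      using \<sigma> ni unfolding isolated_def by blast
    have "0 < hamming_dist N \<sigma> \<tau>" using \<sigma> \<tau>(1,2) S by (intro hamming_pos) auto
    then have "(\<sigma>, \<tau>) \<in> ?R" using \<sigma> \<tau> by blast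
    then show "\<sigma> \<in> fst ` ?R" by (rule image_eqI[rotated]) simp
  qed
  then have "card {\<sigma> \<in> S. \<not> isolated \<delta> N S \<sigma>} \<le> card (fst ` ?R)" using fin by (intro card_mono) auto
  also have "\<dots> \<le> card ?R" by (rule card_image_le[OF fin])
  finally show ?thesis .
qed

text \<open>Both the expected number of close pairs and the lower bound for the number of solutions
  are proportional to the mean, which cancels. What remains is a power of N against exp (- c sqrt
  N).\<close>

lemma isolated_tendsto:
  assumes \<delta>: "\<delta> \<in> {0<..<beta_c \<kappa> \<alpha>}"
  shows "\<forall>\<^sub>F N in sequentially. prob_space (sample_law \<kappa> \<alpha> N)"
    and "(\<lambda>N. measure (sample_law \<kappa> \<alpha> N) {(X, \<sigma>) \<in> space (sample_law \<kappa> \<alpha> N).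
            isolated \<delta> N (sols \<kappa> N (num_constraints \<alpha> N) X) \<sigma>}) \<longlonglongrightarrow> 1"
proof -
  define m where "m = (\<lambda>N. num_constraints \<alpha> N)"
  obtain c where c: "c > 0" and cp: "\<And>N. N > 0 \<Longrightarrow>
      (\<integral>\<^sup>+X. ennreal (real (card {(\<sigma>, \<tau>) \<in> sols \<kappa> N (num_constraints \<alpha> N) X \<times> sols \<kappa> N (num_constraints \<alpha> N) X.
          0 < hamming_dist N \<sigma> \<tau> \<and> real (hamming_dist N \<sigma> \<tau>) \<le> (beta_c \<kappa> \<alpha> - \<delta>) * real N})) \<partial>rows N (num_constraints \<alpha> N))
        \<le> ennreal (real (N + 1) / P * exp (- c * sqrt (real N)) * mean_sols \<kappa> N (num_constraints \<alpha> N))"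
    by (fact close_pair_expectation[OF \<delta>])
  obtain \<Lambda> e where \<Lambda>: "\<Lambda> > 0" and e: "e \<longlonglongrightarrow> 0" and conc:
    "\<forall>\<^sub>F N in sequentially. 0 \<le> e N \<and> emeasure (rows N (num_constraints \<alpha> N)) {X \<in> space (rows N (num_constraints \<alpha> N)).
       real (card (sols \<kappa> N (num_constraints \<alpha> N) X)) < exp (- (\<Lambda> * ln (real N + 1))) * mean_sols \<kappa> N (num_constraints \<alpha> N)} \<le> ennreal (e N)"
    by (fact concentration)
  \<comment> \<open>The quotient of the close-pair bound by the threshold z; exp (\<Lambda> ln (N +
    1)) is the polynomial loss from concentration.\<close>
  define g where "g = (\<lambda>N. (real N + 1) / P * exp (- c * sqrt (real N)) * exp (\<Lambda> * ln (real N + 1)))"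
  have g: "g \<longlonglongrightarrow> 0" unfolding g_def using c \<Lambda> P_pos by real_asymp
  have small: "\<forall>\<^sub>F N in sequentially. e N < 1/2" using e by (rule order_tendstoD) simp
  have main: "\<forall>\<^sub>F N in sequentially. prob_space (sample_law \<kappa> \<alpha> N) \<and>
      1 - 2 * (e N + g N) \<le> measure (sample_law \<kappa> \<alpha> N) {(X, \<sigma>) \<in> space (sample_law \<kappa> \<alpha> N).
            isolated \<delta> N (sols \<kappa> N (num_constraints \<alpha> N) X) \<sigma>}"
    using conc small eventually_gt_at_top[of 0]
  proof eventually_elim
    case (elim N)
    let ?M = "mean_sols \<kappa> N (num_constraints \<alpha> N)"
    let ?K = "\<lambda>S. real (card {(\<sigma>, \<tau>) \<in> S \<times> S. 0 < hamming_dist N \<sigma> \<tau> \<and> real (hamming_dist N \<sigma> \<tau>) \<le> (beta_c \<kappa> \<alpha> - \<delta>) * real N})"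
    define z where "z = exp (- (\<Lambda> * ln (real N + 1))) * ?M"
    define b where "b = real (N + 1) / P * exp (- c * sqrt (real N)) * ?M"
    have M: "?M > 0" by (rule mean_sols_pos[OF \<kappa>_pos])
    have z: "z > 0" using M by (simp add: z_def)
    have b: "0 \<le> b" using M P_pos by (simp add: b_def)
    have a: "0 \<le> e N" "e N \<le> 1/2" using elim by auto
    have few: "emeasure (rows N (num_constraints \<alpha> N)) {X \<in> space (rows N (num_constraints \<alpha> N)).
       real (card (sols \<kappa> N (num_constraints \<alpha> N) X)) < z} \<le> ennreal (e N)" using elim(1) unfolding z_def by blast
    have int: "(\<integral>\<^sup>+X. ennreal (?K (sols \<kappa> N (num_constraints \<alpha> N) X)) \<partial>rows N (num_constraints \<alpha> N)) \<le> ennreal b"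
      unfolding b_def by (rule cp) (use elim in simp)
    have K: "real (card {\<sigma> \<in> sols \<kappa> N (num_constraints \<alpha> N) X. \<not> isolated \<delta> N (sols \<kappa> N (num_constraints \<alpha> N) X) \<sigma>})
        \<le> ?K (sols \<kappa> N (num_constraints \<alpha> N) X)" for X
      by (rule of_nat_mono[OF card_not_isolated_le[OF sols_subset]]) (use \<delta> in simp)
    have cancel: "a * M / (exp (- x) * M) = a * exp x" if "M > 0" for a x M :: real
      using that by (simp add: exp_minus field_simps)
    have "b / z = g N" unfolding b_def z_def g_def by (subst cancel[OF M]) (simp add: add.commute)
    then show ?case
      using sample_law_lower_bound[where G = "isolated \<delta> N" and K = ?K, OF z a b few K int] by simp
  qed
  then show "\<forall>\<^sub>F N in sequentially. prob_space (sample_law \<kappa> \<alpha> N)" by (rule eventually_mono) blast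
  show "(\<lambda>N. measure (sample_law \<kappa> \<alpha> N) {(X, \<sigma>) \<in> space (sample_law \<kappa> \<alpha> N).
            isolated \<delta> N (sols \<kappa> N (num_constraints \<alpha> N) X) \<sigma>}) \<longlonglongrightarrow> 1"
  proof (rule tendsto_sandwich)
    have "(\<lambda>N. 1 - 2 * (e N + g N)) \<longlonglongrightarrow> 1 - 2 * (0 + 0)" by (intro tendsto_intros e g)
    then show "(\<lambda>N. 1 - 2 * (e N + g N)) \<longlonglongrightarrow> 1" by simp
    show "\<forall>\<^sub>F N in sequentially. 1 - 2 * (e N + g N) \<le> measure (sample_law \<kappa> \<alpha> N) {(X, \<sigma>) \<in> space (sample_law \<kappa> \<alpha> N).
            isolated \<delta> N (sols \<kappa> N (num_constraints \<alpha> N) X) \<sigma>}"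
      using main by (rule eventually_mono) blast
    show "\<forall>\<^sub>F N in sequentially. measure (sample_law \<kappa> \<alpha> N) {(X, \<sigma>) \<in> space (sample_law \<kappa> \<alpha> N).
            isolated \<delta> N (sols \<kappa> N (num_constraints \<alpha> N) X) \<sigma>} \<le> 1"
      using main by (rule eventually_mono) (blast intro: prob_space.prob_le_1)
  qed (rule tendsto_const)
qed

text \<open>A single flip moves by Hamming distance 1, so an isolation radius of at least 1 excludes
  every flipped vector.\<close>

lemma isolated_completely_frozen:
  assumes "\<sigma> \<in> cube N" "isolated \<delta> N S \<sigma>" "1 \<le> (beta_c \<kappa> \<alpha> - \<delta>) * real N"
  shows "completely_frozen N S \<sigma>"
  unfolding completely_frozen_def frozen_def
proof (intro allI impI notI)
  fix i assume i: "i < N" and "\<sigma>(i := - \<sigma> i) \<in> S"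
  moreover have "real (hamming_dist N \<sigma> (\<sigma>(i := - \<sigma> i))) \<le> (beta_c \<kappa> \<alpha> - \<delta>) * real N"
    unfolding hamming_flip[OF assms(1) i] using assms(3) by simp
  ultimately have "\<sigma>(i := - \<sigma> i) = \<sigma>" using assms(2) unfolding isolated_def by blast
  then have "- \<sigma> i = \<sigma> i" by (metis fun_upd_same)
  then show False using cubeD[OF assms(1) i] by auto
qed

lemma completely_frozen_tendsto:
  "(\<lambda>N. measure (sample_law \<kappa> \<alpha> N) {(X, \<sigma>) \<in> space (sample_law \<kappa> \<alpha> N).
       completely_frozen N (sols \<kappa> N (num_constraints \<alpha> N) X) \<sigma>}) \<longlonglongrightarrow> 1"
proof -
  \<comment> \<open>With half of \<open>beta_c\<close> the isolation radius is \<delta> N, which is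
    eventually at least 1 because \<open>beta_c\<close> is positive.\<close>
  define \<delta> where "\<delta> = beta_c \<kappa> \<alpha> / 2"
  have \<delta>: "\<delta> \<in> {0<..<beta_c \<kappa> \<alpha>}" and \<delta>0: "0 < \<delta>" and b\<delta>: "beta_c \<kappa> \<alpha> - \<delta> = \<delta>"
    using beta_c_props(1) by (auto simp: \<delta>_def)
  have large: "\<forall>\<^sub>F N in sequentially. 1 \<le> \<delta> * real N" using \<delta>0 by real_asymp
  show ?thesis
  proof (rule tendsto_sandwich[OF _ _ isolated_tendsto(2)[OF \<delta>] tendsto_const])
    show "\<forall>\<^sub>F N in sequentially. measure (sample_law \<kappa> \<alpha> N) {(X, \<sigma>) \<in> space (sample_law \<kappa> \<alpha> N).
            isolated \<delta> N (sols \<kappa> N (num_constraints \<alpha> N) X) \<sigma>}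
        \<le> measure (sample_law \<kappa> \<alpha> N) {(X, \<sigma>) \<in> space (sample_law \<kappa> \<alpha> N).
            completely_frozen N (sols \<kappa> N (num_constraints \<alpha> N) X) \<sigma>}"
      using isolated_tendsto(1)[OF \<delta>] large
    proof eventually_elim
      case (elim N)
      interpret L: prob_space "sample_law \<kappa> \<alpha> N" by (fact elim(1))
      show ?case
      proof (rule L.finite_measure_mono)
        show "{(X, \<sigma>) \<in> space (sample_law \<kappa> \<alpha> N). isolated \<delta> N (sols \<kappa> N (num_constraints \<alpha> N) X) \<sigma>}
            \<subseteq> {(X, \<sigma>) \<in> space (sample_law \<kappa> \<alpha> N). completely_frozen N (sols \<kappa> N (num_constraints \<alpha> N) X) \<sigma>}"
        proof (rule subsetI)
          fix w assume w: "w \<in> {(X, \<sigma>) \<in> space (sample_law \<kappa> \<alpha> N). isolated \<delta> N (sols \<kappa> N (num_constraints \<alpha> N) X) \<sigma>}"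
          obtain X \<sigma> where ws: "w = (X, \<sigma>)" by (cases w)
          have 1: "(X, \<sigma>) \<in> space (sample_law \<kappa> \<alpha> N)" and 2: "isolated \<delta> N (sols \<kappa> N (num_constraints \<alpha> N) X) \<sigma>"
            using w unfolding ws mem_Collect_eq prod.case by blast+
          have "\<sigma> \<in> cube N" using 1 unfolding space_sample_law space_pair_measure space_count_space by blast
          then have "completely_frozen N (sols \<kappa> N (num_constraints \<alpha> N) X) \<sigma>"
            by (rule isolated_completely_frozen[OF _ 2]) (use elim(2) b\<delta> in simp)
          with 1 show "w \<in> {(X, \<sigma>) \<in> space (sample_law \<kappa> \<alpha> N). completely_frozen N (sols \<kappa> N (num_constraints \<alpha> N) X) \<sigma>}"
            unfolding ws mem_Collect_eq prod.case by blast
        qed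
        show "{(X, \<sigma>) \<in> space (sample_law \<kappa> \<alpha> N). completely_frozen N (sols \<kappa> N (num_constraints \<alpha> N) X) \<sigma>} \<in> L.events"
          unfolding space_sample_law sets_sample_law by (rule sets_joint_Collect)
      qed
    qed
    show "\<forall>\<^sub>F N in sequentially. measure (sample_law \<kappa> \<alpha> N) {(X, \<sigma>) \<in> space (sample_law \<kappa> \<alpha> N).
            completely_frozen N (sols \<kappa> N (num_constraints \<alpha> N) X) \<sigma>} \<le> 1"
      using isolated_tendsto(1)[OF \<delta>] by (rule eventually_mono) (rule prob_space.prob_le_1)
  qed
qed

end

theorem theorem1:
  fixes \<kappa> \<alpha> :: real
  assumes "\<kappa> > 0" and "0 < \<alpha>" and "\<alpha> < alpha_c \<kappa>" and "assumption_A"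
  shows "(\<forall>\<delta> \<in> {0<..<beta_c \<kappa> \<alpha>}.
            (\<lambda>N. measure (sample_law \<kappa> \<alpha> N)
               {(X, \<sigma>) \<in> space (sample_law \<kappa> \<alpha> N).
                  {\<sigma>' \<in> solutions \<kappa> \<alpha> N X.
                     real (hamming_dist N \<sigma> \<sigma>') \<le> (beta_c \<kappa> \<alpha> - \<delta>) * real N} = {\<sigma>}})
              \<longlonglongrightarrow> 1) \<and>
         (\<lambda>N. measure (sample_law \<kappa> \<alpha> N)
            {(X, \<sigma>) \<in> space (sample_law \<kappa> \<alpha> N).
               completely_frozen N (solutions \<kappa> \<alpha> N X) \<sigma>}) \<longlonglongrightarrow> 1"
proof -
  interpret frozen_regime \<kappa> \<alpha> using assms by (rule frozen_regime.intro)
  show ?thesis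
    unfolding solutions_eq_sols
    using isolated_tendsto(2)[unfolded isolated_def] completely_frozen_tendsto by blast
qed

end
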